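(* Let $Z_1,\dots,Z_N$ be independent centered random vectors in $\mathbb{R}^p$, and let $Y_1,\dots,Y_N$ be independent Gaussian random vectors with $Y_i\sim\mathcal N(0,\mathbb{E}[Z_iZ_i^\top])$; put $S^Y_N=N^{-1/2}\sum_{i=1}^N Y_i$. Let $e_1,\dots,e_N$ be i.i.d. $\mathcal N(0,1)$ random variables independent of $Z=\{Z_1,\dots,Z_N\}$, let $\bar Z=N^{-1}\sum_{i=1}^N Z_i$, and put $S_N^{eZ}=N^{-1/2}\sum_{i=1}^N e_i(Z_i-\bar Z)$. Let $s\ge1$ be an integer and let $\mathcal I$ be a nonempty collection of subsets of $\{1,\dots,p\}$, each with at most $s$ elements, such that $\{j\}\in\mathcal I$ for every $j=1,\dots,p$. Let $0<b_1\le b_2$ be constants and $B_N\ge1$ a sequence of constants, and assume: (E) $\mathbb{E}[\exp(|v^\top Z_i|/B_N)]\le 2$ for all $v\in\mathbb{S}^{p-1}$ with $\mathrm{supp}(v)\in\mathcal I$ and all $i$; (M) $N^{-1}\sum_{i=1}^N\mathbb{E}[(v^\top Z_i)^2]\ge b_1^2$ and $N^{-1}\sum_{i=1}^N\mathbb{E}[(v^\top Z_i)^4]\le B_N^2b_2^2$ for all $v\in\mathbb{S}^{p-1}$ with $\mathrm{supp}(v)\in\mathcal I$. Then there exist an absolute constant $c_1>0$ and a constant $c_2>0$ depending only on $b_1,b_2$ such that, with probability (over $Z$) at least $1-1/N-3c_1B_Ns^{3/2}\log^{3/2}(pN)/N^{1/2}$, $$\sup_{A\in\mathcal A^{\mathrm{sp}}(s,\mathcal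 I)}\big|\mathbb{P}(S_N^{eZ}\in A\mid Z)-\mathbb{P}(S^Y_N\in A)\big|\le c_2\left(\frac{B_N^2s^5\log^5(pN)}{N}\right)^{1/4}.$$
   Context: For $v\in\mathbb{R}^p$, $\mathrm{supp}(v)$ is the set of indices of nonzero entries. For $A\subset\mathbb{R}^p$, $\mathrm{supp}(\mathbb{I}(w\in A))$ is the set of indices $i$ such that there exist $w,w'$ with $w_i\ne w'_i$ and $\mathbb{I}(w\in A)\ne\mathbb{I}(w'\in A)$. A set $A\subset\mathbb{R}^p$ is an $s$-sparsely generalized convex set on the support collection $\mathcal I$ if $A=\bigcap_{q=1}^Q A_q$ for some integer $Q>0$ and convex sets $A_q\subset\mathbb{R}^p$ whose indicators each depend on at most $s$ coordinates and satisfy $\mathrm{supp}(\mathbb{I}(w\in A_q))\in\mathcal I$. $\mathcal A^{\mathrm{sp}}(s,\mathcal I)$ is the class of all such Borel sets. *)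

theory Defs
  imports "HOL-Probability.Probability"
begin

text \<open>R^p is represented explicitly (so that constants can be independent of p):
  a vector in R^p is an extensional function nat => real on the index set {..<p}
  (coordinates 0..p-1), i.e. an element of the space of the product Borel measure below.\<close>

definition Rp_meas :: "nat \<Rightarrow> (nat \<Rightarrow> real) measure" where
  "Rp_meas p = PiM {..<p} (\<lambda>_. (borel :: real measure))"

definition ip :: "nat \<Rightarrow> (nat \<Rightarrow> real) \<Rightarrow> (nat \<Rightarrow> real) \<Rightarrow> real" where
  "ip p v w = (\<Sum>j<p. v j * w j)"

definition vsupp :: "nat \<Rightarrow> (nat \<Rightarrow> real) \<Rightarrow> nat set" where
  "vsupp p v = {j \<in> {..<p}. v j \<noteq> 0}"

definition unit_sphere :: "nat \<Rightarrow> (nat \<Rightarrow> real) set" where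
  "unit_sphere p = {v \<in> space (Rp_meas p). ip p v v = 1}"

definition ind_supp :: "nat \<Rightarrow> (nat \<Rightarrow> real) set \<Rightarrow> nat set" where
  "ind_supp p A = {i \<in> {..<p}. \<exists>w \<in> space (Rp_meas p). \<exists>w' \<in> space (Rp_meas p).
      (\<forall>j \<in> {..<p}. j \<noteq> i \<longrightarrow> w j = w' j) \<and> (w \<in> A) \<noteq> (w' \<in> A)}"

definition convex_p :: "nat \<Rightarrow> (nat \<Rightarrow> real) set \<Rightarrow> bool" where
  "convex_p p A \<longleftrightarrow> A \<subseteq> space (Rp_meas p) \<and>
     (\<forall>x\<in>A. \<forall>y\<in>A. \<forall>t::real. 0 \<le> t \<and> t \<le> 1 \<longrightarrow>
        restrict (\<lambda>j. (1 - t) * x j + t * y j) {..<p} \<in> A)"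

definition sparse_convex_class :: "nat \<Rightarrow> nat \<Rightarrow> nat set set \<Rightarrow> (nat \<Rightarrow> real) set set" where
  "sparse_convex_class p s I = {A \<in> sets (Rp_meas p).
      \<exists>Q::nat. Q > 0 \<and> (\<exists>As :: nat \<Rightarrow> (nat \<Rightarrow> real) set.
        (\<forall>q<Q. convex_p p (As q) \<and> card (ind_supp p (As q)) \<le> s \<and> ind_supp p (As q) \<in> I)
        \<and> A = (\<Inter>q<Q. As q))}"

definition centered_gaussian_law ::
  "nat \<Rightarrow> (nat \<Rightarrow> real) measure \<Rightarrow> (nat \<Rightarrow> nat \<Rightarrow> real) \<Rightarrow> bool" where
  "centered_gaussian_law p \<nu> C \<longleftrightarrow> prob_space \<nu> \<and> sets \<nu> = sets (Rp_meas p) \<and>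
     (\<forall>v. let \<sigma>2 = (\<Sum>j<p. \<Sum>k<p. v j * C j k * v k) in
        distr \<nu> borel (\<lambda>x. ip p v x) =
          (if \<sigma>2 = 0 then return borel 0 else density lborel (normal_density 0 (sqrt \<sigma>2))))"

definition std_normal_vec :: "nat \<Rightarrow> (nat \<Rightarrow> real) measure" where
  "std_normal_vec N = PiM {..<N} (\<lambda>_. density lborel std_normal_density)"

definition zbar :: "nat \<Rightarrow> nat \<Rightarrow> (nat \<Rightarrow> nat \<Rightarrow> real) \<Rightarrow> (nat \<Rightarrow> real)" where
  "zbar p N z = restrict (\<lambda>j. (1 / real N) * (\<Sum>i<N. z i j)) {..<p}"

definition S_eZ :: "nat \<Rightarrow> nat \<Rightarrow> (nat \<Rightarrow> nat \<Rightarrow> real) \<Rightarrow> (nat \<Rightarrow> real) \<Rightarrow> (nat \<Rightarrow> real)" where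
  "S_eZ p N z e = restrict (\<lambda>j. (1 / sqrt (real N)) * (\<Sum>i<N. e i * (z i j - zbar p N z j))) {..<p}"

definition S_Y :: "nat \<Rightarrow> nat \<Rightarrow> (nat \<Rightarrow> nat \<Rightarrow> real) \<Rightarrow> (nat \<Rightarrow> real)" where
  "S_Y p N y = restrict (\<lambda>j. (1 / sqrt (real N)) * (\<Sum>i<N. y i j)) {..<p}"

text \<open>P(S_N^{eZ} in A | Z = z): probability over e with Z fixed at z.\<close>
definition boot_prob :: "nat \<Rightarrow> nat \<Rightarrow> (nat \<Rightarrow> nat \<Rightarrow> real) \<Rightarrow> (nat \<Rightarrow> real) set \<Rightarrow> real" where
  "boot_prob p N z A = measure (std_normal_vec N) {e \<in> space (std_normal_vec N). S_eZ p N z e \<in> A}"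

end

theory Submission
  imports Defs
begin

text \<open>A sparsely convex set is sandwiched, inside a large cube, between two polytopes whose
  \<open>m \<le> (p N) ^ (8 s)\<close> facet normals form a net of sparse unit vectors, so that it suffices to compare
  two centered Gaussian laws on orthants of dimension \<open>m\<close>. There the indicator is replaced by the smooth function
  \<open>f x = exp (- (\<Sum>j. exp (\<beta> (x j - a j))))\<close>, and the two laws are exchanged one after another in small Gaussian
  increments (Lindeberg). The sum of the absolute second derivatives of \<open>f\<close> is at most
  \<open>8 \<beta>^2\<close> times the increase of \<open>f\<close> under the shift of \<open>a\<close> by \<open>ln 2 / \<beta>\<close>. Nazarov's inequality bounds the
  expectation of this increase by a multiple of \<open>sqrt (ln m) / \<beta>\<close>, which gains one factor \<open>1 / \<beta>\<close> and
  leads, after optimising \<open>\<beta>\<close>, to the rate \<open>sqrt \<Delta> * ln m\<close>, where \<open>\<Delta>\<close> is the largest difference of the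
  covariances on the net. Nazarov's inequality itself follows by splitting the boundary layer according to the
  coordinate with the largest excess \<open>x j - a j\<close>: these pieces are upward closed along the \<open>j\<close>th
  regression direction, where the standard normal law has a bounded hazard rate. Finally, \<open>\<Delta>\<close>
  is of order \<open>B sqrt (s ln (p N) / N)\<close> by Bernstein's inequality for truncated products.\<close>

section \<open>Characteristic functions determine laws\<close>

text \<open>For fixed \<open>z\<close> the vector \<open>S_eZ\<close> is exactly Gaussian, so two
  Gaussian laws are compared and only the covariance of the first one is random. Write l = s ln (p
  N). Then ln m is at most 8 l and Delta is of order B sqrt (l / N), so sqrt Delta times l is of the
  order of (B^2 l^5 / N)^(1/4) itself: the exponent 1/4 leaves no slack in the comparison step. A
  uniform bound of order beta^2 for the second derivatives would only give the power 1/3 of Delta.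
  The bound by an increment of f helps because its expectation is small again under every
  intermediate law of the exchange, and this is why anti-concentration comes first. The third-order
  error of one exchange depends badly on m, but the increments may be taken as small as desired, so
  it disappears in the limit. The laws are often singular: the net map sends R^p to dimension m, and
  the bootstrap covariance has rank at most N. Hence no density on R^p occurs; Gaussian laws are
  handled through characteristic functions, and the first section reduces their uniqueness to the
  one-dimensional theorem of Levy.\<close>

lemma weighted_law_unique:
  fixes X h :: "'a \<Rightarrow> real"
  assumes fin: "finite_measure M" "finite_measure M'" and sets: "sets M' = sets M"
    and X[measurable]: "X \<in> borel_measurable M" and h[measurable]: "h \<in> borel_measurable M"
    and h0: "\<And>x. 0 \<le> h x" and hK: "\<And>x. h x \<le> K"
    and cos_eq: "\<And>t. (\<integral>x. h x * cos (t * X x) \<partial>M) = (\<integral>x. h x * cos (t * X x) \<partial>M')"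
    and sin_eq: "\<And>t. (\<integral>x. h x * sin (t * X x) \<partial>M) = (\<integral>x. h x * sin (t * X x) \<partial>M')"
    and B: "B \<in> sets borel"
  shows "(\<integral>x. h x * indicator B (X x) \<partial>M) = (\<integral>x. h x * indicator B (X x) \<partial>M')"
proof -
  interpret M: finite_measure M by fact
  interpret M': finite_measure M' by fact
  note [measurable_cong] = sets
  have X'[measurable]: "X \<in> borel_measurable M'" and h'[measurable]: "h \<in> borel_measurable M'"
    using X h measurable_cong_sets[OF sets refl] by blast+
  note [measurable] = B
  have int: "integrable N (\<lambda>x. h x * g x)" if "finite_measure N" "sets N = sets M"
      "g \<in> borel_measurable M" "\<And>x. \<bar>g x\<bar> \<le> 1" for N and g :: "'a \<Rightarrow> real"
  proof -
    interpret N: finite_measure N by fact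
    note [measurable_cong] = that(2)
    have "\<And>x. \<bar>h x\<bar> * \<bar>g x\<bar> \<le> K * 1"
      using h0 hK that(4) by (intro mult_mono) (auto simp: order_trans[OF h0 hK])
    then show ?thesis using that(3)
      by (intro N.integrable_const_bound[of _ K]) (auto simp: abs_mult)
  qed
  define c where "c = (\<integral>x. h x \<partial>M)"
  \<comment> \<open>At frequency 0 the cosine identity compares the total masses of the
    weight.\<close>
  have c': "c = (\<integral>x. h x \<partial>M')" using cos_eq[of 0] by (simp add: c_def)
  have inth: "integrable M h" "integrable M' h"
    using int[OF fin(1) refl, of "\<lambda>_. 1"] int[OF fin(2) sets, of "\<lambda>_. 1"] by auto
  show ?thesis
  proof (cases "c = 0")
    case True
    have "AE x in M. h x = 0" using True inth h0
      by (subst (asm) c_def) (simp add: integral_nonneg_eq_0_iff_AE)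
    then have "(\<integral>x. h x * indicator B (X x) \<partial>M) = (\<integral>x. 0 \<partial>M)" by (intro integral_cong_AE) auto
    moreover have "AE x in M'. h x = 0" using True inth h0
      by (subst (asm) c') (simp add: integral_nonneg_eq_0_iff_AE)
    then have "(\<integral>x. h x * indicator B (X x) \<partial>M') = (\<integral>x. 0 \<partial>M')" by (intro integral_cong_AE) auto
    ultimately show ?thesis by simp
  next
    case False
    have "c \<ge> 0" unfolding c_def using h0 by (intro Bochner_Integration.integral_nonneg)
    with False have c: "c > 0" by simp
    \<comment> \<open>Dividing the weight by its mass \<open>c\<close> turns both sides into
      probability laws of \<open>X\<close> on the line. The given integrals are the real and
      imaginary parts of their characteristic functions, so Levy uniqueness applies. For
      \<open>c = 0\<close> the weight vanishes almost everywhere.\<close>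
    define D where "D N = distr (density N (\<lambda>x. ennreal (h x / c))) borel X" for N
    have key: "real_distribution (D N) \<and> (\<forall>t. char (D N) t = Complex ((\<integral>x. h x * cos (t * X x) \<partial>N) / c) ((\<integral>x. h x * sin (t * X x) \<partial>N) / c))
       \<and> measure (D N) B = (\<integral>x. h x * indicator B (X x) \<partial>N) / c"
      if N: "finite_measure N" "sets N = sets M" and cN: "c = (\<integral>x. h x \<partial>N)" for N
    proof -
      interpret N: finite_measure N by fact
      note [measurable_cong] = that(2)
      have ihN: "integrable N h" using int[OF N, of "\<lambda>_. 1"] by auto
      have "emeasure (density N (\<lambda>x. ennreal (h x / c))) (space (density N (\<lambda>x. ennreal (h x / c)))) = (\<integral>\<^sup>+ x. ennreal (h x / c) \<partial>N)"
        by (simp add: emeasure_density cong: nn_integral_cong)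
      also have "\<dots> = ennreal (\<integral>x. h x / c \<partial>N)" using ihN h0 c by (intro nn_integral_eq_integral) auto
      also have "\<dots> = 1" using c cN by simp
      finally have "prob_space (density N (\<lambda>x. ennreal (h x / c)))" by (rule prob_spaceI)
      then have "prob_space (D N)" unfolding D_def by (intro prob_space.prob_space_distr) auto
      then have rd: "real_distribution (D N)"
        unfolding real_distribution_def real_distribution_axioms_def by (auto simp: D_def)
      have ch: "char (D N) t = Complex ((\<integral>x. h x * cos (t * X x) \<partial>N) / c) ((\<integral>x. h x * sin (t * X x) \<partial>N) / c)" for t
      proof -
        have "char (D N) t = (CLINT x|N. (h x / c) *\<^sub>R iexp (t * X x))"
          unfolding char_def D_def using h0 c by (simp add: integral_distr integral_density)
        also have "\<dots> = (CLINT x|N. complex_of_real (h x * cos (t * X x) / c) + \<i> * complex_of_real (h x * sin (t * X x) / c))"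
          by (intro Bochner_Integration.integral_cong) (auto simp: complex_eq_iff Re_exp Im_exp)
        also have "\<dots> = complex_of_real (\<integral>x. h x * cos (t * X x) / c \<partial>N) + \<i> * complex_of_real (\<integral>x. h x * sin (t * X x) / c \<partial>N)"
          using int[OF N, of "\<lambda>x. cos (t * X x)"] int[OF N, of "\<lambda>x. sin (t * X x)"]
          by (subst Bochner_Integration.integral_add)
             (simp_all add: integral_complex_of_real del: of_real_mult of_real_divide)
        finally show ?thesis by (simp add: complex_eq_iff)
      qed
      have "measure (D N) B = (LINT x|D N. indicator B x)" using B by (simp add: D_def)
      also have "\<dots> = (\<integral>x. h x * indicator B (X x) / c \<partial>N)"
        unfolding D_def using h0 c by (subst integral_distr, simp, simp, subst integral_real_density) (auto intro!: Bochner_Integration.integral_cong)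
      finally show ?thesis using rd ch by simp
    qed
    have "char (D M) = char (D M')"
      using key[OF fin(1) refl] key[OF fin(2) sets c'] c_def cos_eq sin_eq by (auto simp: fun_eq_iff)
    then have "D M = D M'"
      using key[OF fin(1) refl] key[OF fin(2) sets c'] c_def by (intro Levy_uniqueness) auto
    then show ?thesis
      using key[OF fin(1) refl] key[OF fin(2) sets c'] c_def c by auto
  qed
qed

lemma Rp_coordinate_measurable:
  assumes "sets M = sets (Rp_meas n)" "j < n"
  shows "(\<lambda>x. x j) \<in> borel_measurable M"
proof -
  have "(\<lambda>x. x j) \<in> measurable (Rp_meas n) borel"
    using assms(2) unfolding Rp_meas_def by (intro measurable_component_singleton) auto
  then show ?thesis by (simp only: measurable_cong_sets[OF assms(1) refl[of "sets borel"]])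
qed

text \<open>Cosines are turned into indicators one coordinate at a time. The induction claim mixes
  the two: the cosine of a linear form in the coordinates from \<open>k\<close> on, times indicators
  of the coordinates below \<open>k\<close>. At \<open>k = 0\<close> this is the hypothesis, at
  \<open>k = n\<close> it says that the laws agree on boxes. The free phase \<open>\<theta>\<close>
  makes sines a special case of cosines.\<close>

theorem Rp_law_unique:
  assumes mu: "prob_space \<mu>" "sets \<mu> = sets (Rp_meas n)"
    and nu: "prob_space \<nu>" "sets \<nu> = sets (Rp_meas n)"
    and eq: "\<And>v. (CLINT x|\<mu>. iexp (ip n v x)) = (CLINT x|\<nu>. iexp (ip n v x))"
  shows "\<mu> = \<nu>"
proof -
  interpret mu: prob_space \<mu> by fact
  interpret nu: prob_space \<nu> by fact
  note [measurable_cong] = mu(2)[unfolded Rp_meas_def] nu(2)[unfolded Rp_meas_def]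
  have sets: "sets \<nu> = sets \<mu>" using mu nu by simp
  have "(\<integral>x. cos (\<theta> + (\<Sum>j\<in>{k..<n}. v j * x j)) * (\<Prod>j<k. indicator (B j) (x j)) \<partial>\<mu>)
      = (\<integral>x. cos (\<theta> + (\<Sum>j\<in>{k..<n}. v j * x j)) * (\<Prod>j<k. indicator (B j) (x j)) \<partial>\<nu>)"
    if "k \<le> n" "\<And>j. B j \<in> sets (borel :: real measure)" for k \<theta> v B using that
  proof (induction k arbitrary: \<theta> v B)
    case 0
    have *: "(\<integral>x. cos (\<theta> + (\<Sum>j\<in>{0..<n}. v j * x j)) \<partial>N) = Re (iexp \<theta> * (CLINT x|N. iexp (ip n v x)))"
      if "prob_space N" "sets N = sets (Rp_meas n)" for N
    proof -
      interpret N: prob_space N by fact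
      note [measurable_cong] = that(2)[unfolded Rp_meas_def]
      have [measurable]: "(\<lambda>x. ip n v x) \<in> borel_measurable N" unfolding ip_def by measurable
      have i: "integrable N (\<lambda>x. iexp (ip n v x))" by (intro N.integrable_iexp) auto
      have "iexp \<theta> * (CLINT x|N. iexp (ip n v x)) = (CLINT x|N. iexp (\<theta> + ip n v x))"
        by (simp add: exp_add ring_distribs)
      then have "Re (iexp \<theta> * (CLINT x|N. iexp (ip n v x))) = (\<integral>x. Re (iexp (\<theta> + ip n v x)) \<partial>N)"
        using i by (subst integral_Re) (auto simp: exp_add ring_distribs)
      also have "\<dots> = (\<integral>x. cos (\<theta> + (\<Sum>j\<in>{0..<n}. v j * x j)) \<partial>N)"
        by (intro Bochner_Integration.integral_cong) (auto simp: Re_exp ip_def lessThan_atLeast0)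
      finally show ?thesis by simp
    qed
    show ?case using *[OF mu] *[OF nu] eq by simp
  next
    case (Suc k)
    note [measurable] = Suc.prems(2)
    have IH: "\<And>\<theta> v. (\<integral>x. cos (\<theta> + (\<Sum>j\<in>{k..<n}. v j * x j)) * (\<Prod>j<k. indicator (B j) (x j)) \<partial>\<mu>)
      = (\<integral>x. cos (\<theta> + (\<Sum>j\<in>{k..<n}. v j * x j)) * (\<Prod>j<k. indicator (B j) (x j)) \<partial>\<nu>)"
      using Suc.prems by (intro Suc.IH) auto
    define P where "P x = (\<Prod>j<k. indicator (B j) (x j) :: real)" for x
    have kn: "k < n" using Suc.prems by simp
    have Pm[measurable]: "P \<in> borel_measurable \<mu>" unfolding P_def
    proof (rule borel_measurable_prod)
      fix j assume "j \<in> {..<k}"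
      then have "j < n" using kn by simp
      then show "(\<lambda>x. indicator (B j) (x j)) \<in> borel_measurable \<mu>"
        by (intro measurable_compose[OF Rp_coordinate_measurable[OF mu(2)]] borel_measurable_indicator) auto
    qed
    have P01: "0 \<le> P x" "P x \<le> 1" for x
      unfolding P_def by (auto intro!: prod_nonneg prod_le_1 simp: indicator_def)
    define L where "L \<theta> v x = cos (\<theta> + (\<Sum>j\<in>{k..<n}. v j * x j))" for \<theta> and v x :: "nat \<Rightarrow> real"
    define L' where "L' \<theta> v x = cos (\<theta> + (\<Sum>j\<in>{Suc k..<n}. v j * x j))" for \<theta> and v x :: "nat \<Rightarrow> real"
    have Lm[measurable]: "L \<theta> v \<in> borel_measurable \<mu>" "L' \<theta> v \<in> borel_measurable \<mu>" for \<theta> v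
      unfolding L_def L'_def using kn by measurable
    have int: "integrable N (\<lambda>x. L \<theta> v x * P x)" "integrable N (\<lambda>x. L' \<theta> v x * P x * indicator (B k) (x k))"
      "integrable N (\<lambda>x. P x * indicator (B k) (x k))"
      if "prob_space N" "sets N = sets \<mu>" for N \<theta> v
    proof -
      interpret N: prob_space N by fact
      note [measurable_cong] = that(2)
      have a: "\<bar>L \<theta> v x * P x\<bar> \<le> 1" "\<bar>L' \<theta> v x * P x\<bar> \<le> 1"  for x
        unfolding L_def L'_def using P01[of x] by (auto simp: abs_mult intro!: mult_le_one)
      show "integrable N (\<lambda>x. L \<theta> v x * P x)"
        using a(1) by (intro N.integrable_const_bound[of _ 1]) auto
      show "integrable N (\<lambda>x. L' \<theta> v x * P x * indicator (B k) (x k))"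
        using a(2) kn by (intro N.integrable_const_bound[of _ 1]) (auto simp: indicator_def)
      show "integrable N (\<lambda>x. P x * indicator (B k) (x k))"
        using P01 kn by (intro N.integrable_const_bound[of _ 1]) (auto simp: indicator_def)
    qed
    have sp: "(\<Sum>j\<in>{k..<n}. (v(k := t)) j * x j) = t * x k + (\<Sum>j\<in>{Suc k..<n}. v j * x j)" for v t and x :: "nat \<Rightarrow> real"
      by (subst sum.atLeast_Suc_lessThan[OF kn]) (auto intro!: sum.cong)
    \<comment> \<open>The one-dimensional lemma needs a nonnegative weight; \<open>L'\<close>
      changes sign, \<open>1 + L'\<close> does not. Product-to-sum formulas reduce the weighted
      cosines and sines of \<open>x k\<close> to integrals covered by the induction hypothesis, a
      sine being a cosine with phase \<open>- pi / 2\<close>.\<close>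
    have e1: "(1 + L' \<theta> v x) * P x * cos (t * x k) =
        L 0 ((\<lambda>_. 0)(k := t)) x * P x + (L \<theta> (v(k := t)) x * P x + L \<theta> (v(k := -t)) x * P x) / 2" for \<theta> v x t
      unfolding L_def L'_def sp
      by (simp add: cos_add sin_add cos_diff sin_diff field_simps)
    have e2: "(1 + L' \<theta> v x) * P x * sin (t * x k) =
        L (-pi/2) ((\<lambda>_. 0)(k := t)) x * P x + (L (\<theta> - pi/2) (v(k := t)) x * P x - L (\<theta> - pi/2) (v(k := -t)) x * P x) / 2" for \<theta> v x t
      unfolding L_def L'_def sp
      by (simp add: cos_add sin_add cos_diff sin_diff, simp add: field_simps)
    have A: "(\<integral>x. (1 + L' \<theta> v x) * P x * indicator (B k) (x k) \<partial>\<mu>) = (\<integral>x. (1 + L' \<theta> v x) * P x * indicator (B k) (x k) \<partial>\<nu>)" for \<theta> v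
    proof (rule weighted_law_unique[where K=2])
      show "finite_measure \<mu>" "finite_measure \<nu>" by unfold_locales
      show "(\<lambda>x. x k) \<in> borel_measurable \<mu>" by (rule Rp_coordinate_measurable[OF mu(2) kn])
      show "(\<lambda>x. (1 + L' \<theta> v x) * P x) \<in> borel_measurable \<mu>" by measurable
      have "-1 \<le> L' \<theta> v x" "L' \<theta> v x \<le> 1" for x unfolding L'_def by auto
      then have "0 \<le> 1 + L' \<theta> v x" "1 + L' \<theta> v x \<le> 2" for x by (smt (verit))+
      then have "0 \<le> (1 + L' \<theta> v x) * P x \<and> (1 + L' \<theta> v x) * P x \<le> 2 * 1" for x
        using P01[of x] mult_mono[of "1 + L' \<theta> v x" 2 "P x" 1] by simp
      then show "0 \<le> (1 + L' \<theta> v x) * P x" "(1 + L' \<theta> v x) * P x \<le> 2" for x by auto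
      show "(\<integral>x. (1 + L' \<theta> v x) * P x * cos (t * x k) \<partial>\<mu>) = (\<integral>x. (1 + L' \<theta> v x) * P x * cos (t * x k) \<partial>\<nu>)" for t
        unfolding e1 using IH[folded P_def L_def] int(1)[OF mu(1) refl] int(1)[OF nu(1) sets] by (simp del: fun_upd_apply)
      show "(\<integral>x. (1 + L' \<theta> v x) * P x * sin (t * x k) \<partial>\<mu>) = (\<integral>x. (1 + L' \<theta> v x) * P x * sin (t * x k) \<partial>\<nu>)" for t
        unfolding e2 using IH[folded P_def L_def] int(1)[OF mu(1) refl] int(1)[OF nu(1) sets] by (simp del: fun_upd_apply)
    qed (use sets Suc.prems in auto)
    \<comment> \<open>With zero phase and zero frequencies \<open>L'\<close> is 1, so
      \<open>A\<close> yields the identity for \<open>P\<close> alone; subtracting it removes the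
      added 1.\<close>
    have A0: "(\<integral>x. P x * indicator (B k) (x k) \<partial>\<mu>) = (\<integral>x. P x * indicator (B k) (x k) \<partial>\<nu>)"
      using A[of 0 "\<lambda>_. 0"] by (simp add: L'_def mult.assoc)
    have "(\<integral>x. L' \<theta> v x * P x * indicator (B k) (x k) \<partial>\<mu>) = (\<integral>x. L' \<theta> v x * P x * indicator (B k) (x k) \<partial>\<nu>)"
      using A[of \<theta> v] A0 int(2,3)[OF mu(1) refl] int(2,3)[OF nu(1) sets]
      by (simp add: ring_distribs)
    then show ?case unfolding L'_def P_def by (simp add: mult.assoc)
  qed
  note main = this
  show ?thesis
  proof (rule measure_eqI_PiM_finite[where A="\<lambda>_. space (Rp_meas n)" and I="{..<n}" and M="\<lambda>_. borel"])
    fix A :: "nat \<Rightarrow> real set" assume A: "\<And>i. i \<in> {..<n} \<Longrightarrow> A i \<in> sets borel"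
    \<comment> \<open>The induction claim asks for measurable sets at every index, hence the empty
      sets from \<open>n\<close> on.\<close>
    define B where "B j = (if j < n then A j else {})" for j
    have [measurable]: "B j \<in> sets borel" for j using A by (auto simp: B_def)
    have *: "measure N (Pi\<^sub>E {..<n} A) = (\<integral>x. cos (0 + (\<Sum>j\<in>{n..<n}. 0 * x j)) * (\<Prod>j<n. indicator (B j) (x j)) \<partial>N)"
      if "sets N = sets (Rp_meas n)" for N
    proof -
      note [measurable_cong] = that[unfolded Rp_meas_def]
      have sp: "space N = Pi\<^sub>E {..<n} (\<lambda>_. UNIV)"
        using sets_eq_imp_space_eq[OF that] by (simp add: Rp_meas_def space_PiM)
      have "measure N (Pi\<^sub>E {..<n} A) = (\<integral>x. indicator (Pi\<^sub>E {..<n} A) x \<partial>N)"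
      proof -
        have "Pi\<^sub>E {..<n} A \<inter> space N = Pi\<^sub>E {..<n} A" by (auto simp: sp)
        then show ?thesis by simp
      qed
      also have "\<dots> = (\<integral>x. (\<Prod>j<n. indicator (B j) (x j)) \<partial>N)"
      proof (intro Bochner_Integration.integral_cong refl)
        fix x assume "x \<in> space N"
        then have "x \<in> Pi\<^sub>E {..<n} A \<longleftrightarrow> (\<forall>j<n. x j \<in> B j)" by (auto simp: sp PiE_iff B_def)
        moreover have "(\<Prod>j<n. indicator (B j) (x j) :: real) = (if \<forall>j<n. x j \<in> B j then 1 else 0)"
          by (auto simp: indicator_def)
        ultimately show "indicator (Pi\<^sub>E {..<n} A) x = (\<Prod>j<n. indicator (B j) (x j) :: real)"
          by (simp add: indicator_def)
      qed
      finally show ?thesis by simp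
    qed
    have "measure \<mu> (Pi\<^sub>E {..<n} A) = measure \<nu> (Pi\<^sub>E {..<n} A)"
      unfolding *[OF mu(2)] *[OF nu(2)] by (rule main) auto
    then show "emeasure \<mu> (Pi\<^sub>E {..<n} A) = emeasure \<nu> (Pi\<^sub>E {..<n} A)"
      by (simp add: mu.emeasure_eq_measure nu.emeasure_eq_measure)
  next
    show "range (\<lambda>_. space (Rp_meas n)) \<subseteq> prod_algebra {..<n} (\<lambda>_. borel)"
      by (auto simp: Rp_meas_def space_PiM intro!: prod_algebraI_finite)
  qed (auto simp: mu nu Rp_meas_def)
qed

section \<open>Gaussian laws\<close>

definition quad_form :: "nat \<Rightarrow> (nat \<Rightarrow> nat \<Rightarrow> real) \<Rightarrow> (nat \<Rightarrow> real) \<Rightarrow> real" where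
  "quad_form n C v = (\<Sum>j<n. \<Sum>k<n. v j * C j k * v k)"

text \<open>Stated through the characteristic function and not through a density, so that singular
  matrices \<open>C\<close> are included. The law depends on \<open>C\<close> only through its
  quadratic form, that is, through the symmetric part of \<open>C\<close>.\<close>

definition gaussian_law :: "nat \<Rightarrow> (nat \<Rightarrow> real) measure \<Rightarrow> (nat \<Rightarrow> nat \<Rightarrow> real) \<Rightarrow> bool" where
  "gaussian_law n \<gamma> C \<longleftrightarrow> prob_space \<gamma> \<and> sets \<gamma> = sets (Rp_meas n) \<and>
     (\<forall>v. (CLINT x|\<gamma>. iexp (ip n v x)) = complex_of_real (exp (- quad_form n C v / 2)))"

lemma space_Rp_meas: "space (Rp_meas n) = {..<n} \<rightarrow>\<^sub>E UNIV"
  by (simp add: Rp_meas_def space_PiM)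

lemma ip_measurable:
  assumes "sets M = sets (Rp_meas n)"
  shows "(\<lambda>x. ip n v x) \<in> borel_measurable M"
  unfolding ip_def using Rp_coordinate_measurable[OF assms]
  by (intro borel_measurable_sum borel_measurable_times) auto

lemma gaussian_lawD:
  assumes "gaussian_law n \<gamma> C"
  shows "prob_space \<gamma>" "sets \<gamma> = sets (Rp_meas n)" "space \<gamma> = space (Rp_meas n)"
    "(CLINT x|\<gamma>. iexp (ip n v x)) = complex_of_real (exp (- quad_form n C v / 2))"
  using assms unfolding gaussian_law_def by (auto dest: sets_eq_imp_space_eq)

lemma gaussian_law_unique:
  assumes "gaussian_law n \<gamma> C" "gaussian_law n \<gamma>' C'" "\<And>v. quad_form n C v = quad_form n C' v"
  shows "\<gamma> = \<gamma>'"
  using assms by (intro Rp_law_unique[of _ n]) (auto simp: gaussian_law_def)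

section \<open>Linear images and independent combinations of Gaussian laws\<close>

definition lin_map :: "nat \<Rightarrow> nat \<Rightarrow> (nat \<Rightarrow> nat \<Rightarrow> real) \<Rightarrow> (nat \<Rightarrow> real) \<Rightarrow> (nat \<Rightarrow> real)" where
  "lin_map m n T x = restrict (\<lambda>i. ip n (T i) x) {..<m}"

lemma restrict_measurable_Rp:
  assumes "\<And>j. j < m \<Longrightarrow> (\<lambda>x. f x j) \<in> borel_measurable M"
  shows "(\<lambda>x. restrict (f x) {..<m}) \<in> measurable M (Rp_meas m)"
  unfolding Rp_meas_def using assms by (intro measurable_restrict) auto

lemma lin_map_measurable:
  "sets M = sets (Rp_meas n) \<Longrightarrow> lin_map m n T \<in> measurable M (Rp_meas m)"
  unfolding lin_map_def by (intro restrict_measurable_Rp ip_measurable)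

lemma ip_lin_map: "ip m v (lin_map m n T x) = ip n (\<lambda>j. \<Sum>i<m. v i * T i j) x"
proof -
  have "ip m v (lin_map m n T x) = (\<Sum>i<m. \<Sum>j<n. v i * T i j * x j)"
    unfolding ip_def lin_map_def by (intro sum.cong) (auto simp: sum_distrib_left mult.assoc)
  also have "\<dots> = ip n (\<lambda>j. \<Sum>i<m. v i * T i j) x"
    unfolding ip_def by (subst sum.swap) (simp add: sum_distrib_right)
  finally show ?thesis .
qed

text \<open>The matrix product \<open>T C T^t\<close>, which is the covariance after applying
  \<open>lin_map\<close>.\<close>

definition push_cov :: "nat \<Rightarrow> (nat \<Rightarrow> nat \<Rightarrow> real) \<Rightarrow> (nat \<Rightarrow> nat \<Rightarrow> real) \<Rightarrow> nat \<Rightarrow> nat \<Rightarrow> real" where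
  "push_cov n T C i k = (\<Sum>a<n. \<Sum>b<n. T i a * C a b * T k b)"

lemma quad_form_push: "quad_form m (push_cov n T C) v = quad_form n C (\<lambda>j. \<Sum>i<m. v i * T i j)"
proof -
  define f where "f a b i k = v i * T i a * C a b * (v k * T k b)" for a b i k
  have "(\<Sum>i<m. v i * T i a) * C a b * (\<Sum>k<m. v k * T k b) = (\<Sum>i<m. \<Sum>k<m. f a b i k)" for a b
    unfolding f_def by (simp only: sum_distrib_right[of "\<lambda>i. v i * T i a" "{..<m}" "C a b"] sum_product)
  then have "quad_form n C (\<lambda>j. \<Sum>i<m. v i * T i j) = (\<Sum>a<n. \<Sum>b<n. \<Sum>i<m. \<Sum>k<m. f a b i k)"
    unfolding quad_form_def by simp
  also have "\<dots> = (\<Sum>a<n. \<Sum>i<m. \<Sum>b<n. \<Sum>k<m. f a b i k)" by (rule sum.cong[OF refl], rule sum.swap)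
  also have "\<dots> = (\<Sum>i<m. \<Sum>a<n. \<Sum>b<n. \<Sum>k<m. f a b i k)" by (rule sum.swap)
  also have "\<dots> = (\<Sum>i<m. \<Sum>a<n. \<Sum>k<m. \<Sum>b<n. f a b i k)"
    by (rule sum.cong[OF refl], rule sum.cong[OF refl], rule sum.swap)
  also have "\<dots> = (\<Sum>i<m. \<Sum>k<m. \<Sum>a<n. \<Sum>b<n. f a b i k)" by (rule sum.cong[OF refl], rule sum.swap)
  also have "\<dots> = quad_form m (push_cov n T C) v"
    unfolding quad_form_def push_cov_def f_def
    by (simp add: sum_distrib_left sum_distrib_right mult_ac)
  finally show ?thesis by simp
qed

lemma gaussian_law_lin_map:
  assumes g: "gaussian_law n \<gamma> C"
  shows "gaussian_law m (distr \<gamma> (Rp_meas m) (lin_map m n T)) (push_cov n T C)"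
proof -
  note G = gaussian_lawD[OF g]
  have m: "lin_map m n T \<in> measurable \<gamma> (Rp_meas m)" by (rule lin_map_measurable[OF G(2)])
  have [measurable]: "(\<lambda>x. ip m v x) \<in> borel_measurable (Rp_meas m)" for v by (rule ip_measurable) simp
  show ?thesis unfolding gaussian_law_def
  proof (intro conjI allI)
    show "prob_space (distr \<gamma> (Rp_meas m) (lin_map m n T))" by (rule prob_space.prob_space_distr[OF G(1) m])
    fix v
    show "(CLINT x|distr \<gamma> (Rp_meas m) (lin_map m n T). iexp (ip m v x)) = complex_of_real (exp (- quad_form m (push_cov n T C) v / 2))"
      using m by (subst integral_distr) (simp_all only: ip_lin_map quad_form_push G(4), measurable)
  qed simp
qed

definition lin_comb :: "nat \<Rightarrow> real \<Rightarrow> real \<Rightarrow> (nat \<Rightarrow> real) \<Rightarrow> (nat \<Rightarrow> real) \<Rightarrow> (nat \<Rightarrow> real)" where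
  "lin_comb n a b x y = restrict (\<lambda>j. a * x j + b * y j) {..<n}"

lemma ip_lin_comb: "ip n v (lin_comb n a b x y) = ip n (\<lambda>j. a * v j) x + ip n (\<lambda>j. b * v j) y"
  unfolding ip_def lin_comb_def by (simp add: sum.distrib[symmetric] algebra_simps)

lemma lin_comb_measurable:
  assumes "sets M = sets (Rp_meas n)" "sets M' = sets (Rp_meas n)"
  shows "(\<lambda>(x, y). lin_comb n a b x y) \<in> measurable (M \<Otimes>\<^sub>M M') (Rp_meas n)"
proof -
  have "(\<lambda>z. restrict (\<lambda>j. a * fst z j + b * snd z j) {..<n}) \<in> measurable (M \<Otimes>\<^sub>M M') (Rp_meas n)"
  proof (intro restrict_measurable_Rp borel_measurable_add borel_measurable_times borel_measurable_const)
    fix j assume "j < n"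
    then have [measurable]: "(\<lambda>x. x j) \<in> borel_measurable M" "(\<lambda>x. x j) \<in> borel_measurable M'"
      using assms by (auto intro!: Rp_coordinate_measurable)
    show "(\<lambda>z. fst z j) \<in> borel_measurable (M \<Otimes>\<^sub>M M')" "(\<lambda>z. snd z j) \<in> borel_measurable (M \<Otimes>\<^sub>M M')"
      by measurable
  qed
  then show ?thesis by (simp add: lin_comb_def split_def)
qed

lemma quad_form_scale: "quad_form n C (\<lambda>j. a * v j) = a\<^sup>2 * quad_form n C v"
  unfolding quad_form_def by (simp add: sum_distrib_left power2_eq_square algebra_simps)

lemma gaussian_law_lin_comb:
  assumes g: "gaussian_law n \<gamma> C" "gaussian_law n \<gamma>' C'"
  shows "gaussian_law n (distr (\<gamma> \<Otimes>\<^sub>M \<gamma>') (Rp_meas n) (\<lambda>(x, y). lin_comb n a b x y))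
    (\<lambda>j k. a\<^sup>2 * C j k + b\<^sup>2 * C' j k)"
proof -
  note G = gaussian_lawD[OF g(1)] and G' = gaussian_lawD[OF g(2)]
  interpret g: prob_space \<gamma> by (rule G)
  interpret g': prob_space \<gamma>' by (rule G')
  interpret gg: pair_prob_space \<gamma> \<gamma>' ..
  have m[measurable]: "(\<lambda>(x, y). lin_comb n a b x y) \<in> measurable (\<gamma> \<Otimes>\<^sub>M \<gamma>') (Rp_meas n)"
    by (rule lin_comb_measurable[OF G(2) G'(2)])
  have [measurable]: "(\<lambda>x. ip n v x) \<in> borel_measurable (Rp_meas n)" "(\<lambda>x. ip n v x) \<in> borel_measurable \<gamma>"
     "(\<lambda>x. ip n v x) \<in> borel_measurable \<gamma>'" for v using G(2) G'(2) by (auto intro: ip_measurable)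
  have q: "quad_form n (\<lambda>j k. a\<^sup>2 * C j k + b\<^sup>2 * C' j k) v = a\<^sup>2 * quad_form n C v + b\<^sup>2 * quad_form n C' v" for v
    unfolding quad_form_def by (simp add: sum_distrib_left sum.distrib[symmetric] algebra_simps)
  show ?thesis unfolding gaussian_law_def
  proof (intro conjI allI)
    show "prob_space (distr (\<gamma> \<Otimes>\<^sub>M \<gamma>') (Rp_meas n) (\<lambda>(x, y). lin_comb n a b x y))"
      by (rule gg.prob_space_distr[OF m])
    fix v
    have i: "integrable (\<gamma> \<Otimes>\<^sub>M \<gamma>') (\<lambda>(x, y). iexp (ip n (\<lambda>j. a * v j) x) * iexp (ip n (\<lambda>j. b * v j) y))"
      by (intro gg.integrable_const_bound[of _ 1]) (auto simp: norm_mult)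
    have "(CLINT x|distr (\<gamma> \<Otimes>\<^sub>M \<gamma>') (Rp_meas n) (\<lambda>(x, y). lin_comb n a b x y). iexp (ip n v x))
      = (CLINT z|\<gamma> \<Otimes>\<^sub>M \<gamma>'. (\<lambda>(x, y). iexp (ip n (\<lambda>j. a * v j) x) * iexp (ip n (\<lambda>j. b * v j) y)) z)"
      by (subst integral_distr) (auto simp: split_def ip_lin_comb exp_add ring_distribs)
    also have "\<dots> = (CLINT x|\<gamma>. CLINT y|\<gamma>'. iexp (ip n (\<lambda>j. a * v j) x) * iexp (ip n (\<lambda>j. b * v j) y))"
      by (rule gg.integral_fst[OF i, symmetric])
    also have "\<dots> = complex_of_real (exp (- quad_form n (\<lambda>j k. a\<^sup>2 * C j k + b\<^sup>2 * C' j k) v / 2))"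
    proof -
      have "(CLINT x|\<gamma>. CLINT y|\<gamma>'. iexp (ip n (\<lambda>j. a * v j) x) * iexp (ip n (\<lambda>j. b * v j) y))
        = complex_of_real (exp (- (a\<^sup>2 * quad_form n C v) / 2)) * complex_of_real (exp (- (b\<^sup>2 * quad_form n C' v) / 2))"
        by (simp only: integral_mult_right_zero integral_mult_left_zero G(4) G'(4) quad_form_scale)
      also have "\<dots> = complex_of_real (exp (- (a\<^sup>2 * quad_form n C v) / 2 + - (b\<^sup>2 * quad_form n C' v) / 2))"
        by (simp only: exp_add of_real_mult)
      also have "- (a\<^sup>2 * quad_form n C v) / 2 + - (b\<^sup>2 * quad_form n C' v) / 2 = - quad_form n (\<lambda>j k. a\<^sup>2 * C j k + b\<^sup>2 * C' j k) v / 2"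
        unfolding q by (simp add: add_divide_distrib diff_divide_distrib)
      finally show ?thesis .
    qed
    finally show "(CLINT x|distr (\<gamma> \<Otimes>\<^sub>M \<gamma>') (Rp_meas n) (\<lambda>(x, y). lin_comb n a b x y). iexp (ip n v x)) =
      complex_of_real (exp (- quad_form n (\<lambda>j k. a\<^sup>2 * C j k + b\<^sup>2 * C' j k) v / 2))" .
  qed simp
qed

section \<open>One-dimensional marginals and moments\<close>

lemma char_normal_density:
  assumes "\<sigma> > 0"
  shows "(CLINT x|density lborel (normal_density 0 \<sigma>). iexp x) = complex_of_real (exp (- \<sigma>\<^sup>2 / 2))"
proof -
  let ?D = "density lborel (normal_density 0 \<sigma>)"
  interpret prob_space ?D using assms by (rule prob_space_normal_density)
  have "distributed ?D lborel (\<lambda>x. x) (normal_density 0 \<sigma>)"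
    unfolding distributed_def by (auto intro: measure_eqI simp: distr_id2)
  then have "distributed ?D lborel (\<lambda>x. (x - 0) / \<sigma>) std_normal_density"
    using normal_standard_normal_convert[OF assms, of "\<lambda>x. x" 0] by simp
  then have d: "distr ?D lborel (\<lambda>x. x / \<sigma>) = std_normal_distribution"
    unfolding distributed_def by simp
  have "(CLINT x|std_normal_distribution. iexp (\<sigma> * x)) = (CLINT x|?D. iexp x)"
    unfolding d[symmetric] using assms by (subst integral_distr) auto
  moreover have "(CLINT x|std_normal_distribution. iexp (\<sigma> * x)) = complex_of_real (exp (- \<sigma>\<^sup>2 / 2))"
    using fun_cong[OF char_std_normal_distribution, of \<sigma>] by (simp add: char_def)
  ultimately show ?thesis by simp
qed

text \<open>The characteristic function at \<open>v\<close> is that of the one-dimensional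
  projection at frequency 1. Nonnegativity of the quadratic form makes the \<open>sqrt\<close> in
  \<open>centered_gaussian_law\<close> a genuine standard deviation.\<close>

lemma centered_gaussian_law_imp:
  assumes g: "centered_gaussian_law p \<nu> C" and nonneg: "\<And>v. quad_form p C v \<ge> 0"
  shows "gaussian_law p \<nu> C"
proof -
  have p: "prob_space \<nu>" and s: "sets \<nu> = sets (Rp_meas p)" using g by (auto simp: centered_gaussian_law_def)
  have "(CLINT x|\<nu>. iexp (ip p v x)) = complex_of_real (exp (- quad_form p C v / 2))" for v
  proof -
    have d: "distr \<nu> borel (\<lambda>x. ip p v x) = (if quad_form p C v = 0 then return borel 0
        else density lborel (normal_density 0 (sqrt (quad_form p C v))))"
      using g by (simp add: centered_gaussian_law_def quad_form_def Let_def)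
    have "(CLINT x|\<nu>. iexp (ip p v x)) = (CLINT x|distr \<nu> borel (\<lambda>x. ip p v x). iexp x)"
      using ip_measurable[OF s] by (subst integral_distr) auto
    also have "\<dots> = complex_of_real (exp (- quad_form p C v / 2))"
    proof (cases "quad_form p C v = 0")
      case True then show ?thesis unfolding d by (simp add: integral_return)
    next
      case False
      then have "quad_form p C v > 0" using nonneg[of v] by simp
      then show ?thesis unfolding d using False by (simp add: char_normal_density)
    qed
    finally show ?thesis .
  qed
  with p s show ?thesis by (simp add: gaussian_law_def)
qed

text \<open>A characteristic function has modulus at most 1, so the exponent
  \<open>- quad_form n C v / 2\<close> cannot be positive.\<close>

lemma gaussian_law_quad_form_nonneg:
  assumes "gaussian_law n \<gamma> C" shows "quad_form n C v \<ge> 0"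
proof -
  interpret prob_space \<gamma> using gaussian_lawD[OF assms] by simp
  have "norm (CLINT x|\<gamma>. iexp (ip n v x)) \<le> (\<integral>x. norm (iexp (ip n v x)) \<partial>\<gamma>)"
    by (rule integral_norm_bound)
  also have "\<dots> = 1" by (simp add: prob_space)
  finally show ?thesis unfolding gaussian_lawD(4)[OF assms] by simp
qed

text \<open>Written as a scaled standard normal variable, so that variance 0 needs no case of its
  own.\<close>

lemma gaussian_law_marginal:
  assumes g: "gaussian_law n \<gamma> C"
  shows "distr \<gamma> borel (ip n v) = distr std_normal_distribution borel (\<lambda>t. sqrt (quad_form n C v) * t)"
proof -
  note G = gaussian_lawD[OF g]
  have [measurable]: "ip n v \<in> borel_measurable \<gamma>" by (rule ip_measurable[OF G(2)])
  interpret S: real_distribution std_normal_distribution by (rule real_dist_normal_dist)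
  interpret g: prob_space \<gamma> by (rule G)
  have rd: "real_distribution (distr M borel f)" if "prob_space M" "f \<in> borel_measurable M" for f and M :: "'a measure"
    using prob_space.prob_space_distr[OF that] by (auto simp: real_distribution_def real_distribution_axioms_def)
  show ?thesis
  proof (rule Levy_uniqueness)
    show "real_distribution (distr \<gamma> borel (ip n v))" using g.prob_space_axioms by (intro rd) auto
    show "real_distribution (distr std_normal_distribution borel (\<lambda>t. sqrt (quad_form n C v) * t))"
      using S.prob_space_axioms by (intro rd) auto
    show "char (distr \<gamma> borel (ip n v)) = char (distr std_normal_distribution borel (\<lambda>t. sqrt (quad_form n C v) * t))"
    proof
      fix t
      have e: "t * ip n v x = ip n (\<lambda>j. t * v j) x" for x unfolding ip_def by (simp add: sum_distrib_left mult.assoc)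
      have "char (distr \<gamma> borel (ip n v)) t = complex_of_real (exp (- (t\<^sup>2 * quad_form n C v) / 2))"
        unfolding char_def by (subst integral_distr) (simp_all only: e G(4) quad_form_scale, measurable)
      moreover have "char (distr std_normal_distribution borel (\<lambda>t. sqrt (quad_form n C v) * t)) t
        = char std_normal_distribution (t * sqrt (quad_form n C v))"
        unfolding char_def by (subst integral_distr) (simp_all add: mult.assoc)
      moreover have "(t * sqrt (quad_form n C v))\<^sup>2 = t\<^sup>2 * quad_form n C v"
        using gaussian_law_quad_form_nonneg[OF g] by (simp add: power_mult_distrib)
      ultimately show "char (distr \<gamma> borel (ip n v)) t = char (distr std_normal_distribution borel (\<lambda>t. sqrt (quad_form n C v) * t)) t"
        by (simp add: char_std_normal_distribution)
    qed
  qed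
qed

lemma gaussian_law_integral_marginal:
  fixes h :: "real \<Rightarrow> real"
  assumes g: "gaussian_law n \<gamma> C" and h[measurable]: "h \<in> borel_measurable borel"
  shows "(\<integral>x. h (ip n v x) \<partial>\<gamma>) = (\<integral>t. h (sqrt (quad_form n C v) * t) \<partial>std_normal_distribution)"
    "integrable \<gamma> (\<lambda>x. h (ip n v x)) \<longleftrightarrow> integrable std_normal_distribution (\<lambda>t. h (sqrt (quad_form n C v) * t))"
proof -
  have [measurable]: "ip n v \<in> borel_measurable \<gamma>" by (rule ip_measurable[OF gaussian_lawD(2)[OF g]])
  have "(\<integral>x. h (ip n v x) \<partial>\<gamma>) = (\<integral>t. h t \<partial>distr \<gamma> borel (ip n v))" by (subst integral_distr) auto
  also have "\<dots> = (\<integral>t. h (sqrt (quad_form n C v) * t) \<partial>std_normal_distribution)"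
    unfolding gaussian_law_marginal[OF g] by (subst integral_distr) auto
  finally show "(\<integral>x. h (ip n v x) \<partial>\<gamma>) = (\<integral>t. h (sqrt (quad_form n C v) * t) \<partial>std_normal_distribution)" .
  have "integrable \<gamma> (\<lambda>x. h (ip n v x)) \<longleftrightarrow> integrable (distr \<gamma> borel (ip n v)) h" by (subst integrable_distr_eq) auto
  also have "\<dots> \<longleftrightarrow> integrable std_normal_distribution (\<lambda>t. h (sqrt (quad_form n C v) * t))"
    unfolding gaussian_law_marginal[OF g] by (subst integrable_distr_eq) auto
  finally show "integrable \<gamma> (\<lambda>x. h (ip n v x)) \<longleftrightarrow> integrable std_normal_distribution (\<lambda>t. h (sqrt (quad_form n C v) * t))" .
qed

lemma gaussian_law_moments:
  assumes g: "gaussian_law n \<gamma> C"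
  shows "integrable \<gamma> (\<lambda>x. \<bar>ip n v x\<bar> ^ k)" "integrable \<gamma> (\<lambda>x. ip n v x ^ k)"
    "(\<integral>x. ip n v x \<partial>\<gamma>) = 0" "(\<integral>x. (ip n v x)\<^sup>2 \<partial>\<gamma>) = quad_form n C v"
proof -
  have i: "integrable std_normal_distribution (\<lambda>t. (sqrt (quad_form n C v) * t) ^ k)" for k
    by (simp add: power_mult_distrib integrable_std_normal_distribution_moment)
  then show "integrable \<gamma> (\<lambda>x. ip n v x ^ k)"
    by (subst gaussian_law_integral_marginal(2)[OF g]) auto
  from integrable_abs[OF this] show "integrable \<gamma> (\<lambda>x. \<bar>ip n v x\<bar> ^ k)"
    by (simp add: power_abs)
  show "(\<integral>x. ip n v x \<partial>\<gamma>) = 0"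
    using gaussian_law_integral_marginal(1)[OF g, of "\<lambda>t. t" v] integral_std_normal_distribution_moment_odd[of 1] by simp
  have "(\<integral>x. (ip n v x)\<^sup>2 \<partial>\<gamma>) = quad_form n C v * (\<integral>t. t ^ 2 \<partial>std_normal_distribution)"
    using gaussian_law_integral_marginal(1)[OF g, of "\<lambda>t. t\<^sup>2" v] gaussian_law_quad_form_nonneg[OF g, of v]
    by (simp add: power_mult_distrib)
  then show "(\<integral>x. (ip n v x)\<^sup>2 \<partial>\<gamma>) = quad_form n C v"
    using std_normal_distribution_even_moments(1)[of 1] by simp
qed

definition basis_vec :: "nat \<Rightarrow> nat \<Rightarrow> real" where "basis_vec j i = (if i = j then 1 else 0)"

lemma ip_basis_vec: "j < n \<Longrightarrow> ip n (basis_vec j) x = x j"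
  by (simp add: ip_def basis_vec_def if_distrib[of "\<lambda>c. c * _"] cong: if_cong)

lemma quad_form_polar:
  assumes "\<And>j k. C j k = C k j"
  shows "quad_form n C (\<lambda>i. u i + v i) = quad_form n C u + quad_form n C v + 2 * (\<Sum>j<n. \<Sum>k<n. u j * C j k * v k)"
proof -
  have "(\<Sum>j<n. \<Sum>k<n. v j * C j k * u k) = (\<Sum>j<n. \<Sum>k<n. u j * C j k * v k)"
    by (subst sum.swap) (auto simp: assms[of _ ] mult_ac intro!: sum.cong)
  moreover have "quad_form n C (\<lambda>i. u i + v i) = quad_form n C u + quad_form n C v
     + (\<Sum>j<n. \<Sum>k<n. u j * C j k * v k) + (\<Sum>j<n. \<Sum>k<n. v j * C j k * u k)"
    unfolding quad_form_def by (simp add: algebra_simps sum.distrib)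
  ultimately show ?thesis by simp
qed

lemma bilinear_basis:
  "j < n \<Longrightarrow> k < n \<Longrightarrow> (\<Sum>a<n. \<Sum>b<n. basis_vec j a * C a b * basis_vec k b) = C j k"
  by (simp add: basis_vec_def if_distrib[of "\<lambda>c. c * _"] if_distrib[of "\<lambda>c. _ * c"] cong: if_cong)

text \<open>Polarisation: the covariance is read off from the second moments of
  \<open>x j + x k\<close>, \<open>x j\<close> and \<open>x k\<close>. Symmetry of \<open>C\<close>
  enters because the law determines only the symmetric part.\<close>

lemma gaussian_law_covariance:
  assumes g: "gaussian_law n \<gamma> C" and sym: "\<And>j k. C j k = C k j" and jk: "j < n" "k < n"
  shows "integrable \<gamma> (\<lambda>x. x j * x k)" "(\<integral>x. x j * x k \<partial>\<gamma>) = C j k"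
proof -
  let ?e = basis_vec
  have ip: "ip n (\<lambda>i. ?e j i + ?e k i) x = x j + x k" for x
    using ip_basis_vec[OF jk(1), of x] ip_basis_vec[OF jk(2), of x]
    by (simp add: ip_def algebra_simps sum.distrib)
  note M = gaussian_law_moments[OF g]
  have i: "integrable \<gamma> (\<lambda>x. (x j + x k)\<^sup>2)" "integrable \<gamma> (\<lambda>x. (x j)\<^sup>2)" "integrable \<gamma> (\<lambda>x. (x k)\<^sup>2)"
    using M(2)[of "\<lambda>i. ?e j i + ?e k i" 2] M(2)[of "?e j" 2] M(2)[of "?e k" 2] jk by (simp_all add: ip ip_basis_vec)
  have e: "x j * x k = ((x j + x k)\<^sup>2 - (x j)\<^sup>2 - (x k)\<^sup>2) / 2" for x :: "nat \<Rightarrow> real"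
    by (simp add: power2_eq_square algebra_simps)
  show "integrable \<gamma> (\<lambda>x. x j * x k)" unfolding e using i by simp
  have "(\<integral>x. x j * x k \<partial>\<gamma>) = (quad_form n C (\<lambda>i. ?e j i + ?e k i) - quad_form n C (?e j) - quad_form n C (?e k)) / 2"
    unfolding e using i M(4)[of "\<lambda>i. ?e j i + ?e k i"] M(4)[of "?e j"] M(4)[of "?e k"] jk
    by (simp add: ip ip_basis_vec)
  also have "\<dots> = C j k" unfolding quad_form_polar[OF sym] bilinear_basis[OF jk] by simp
  finally show "(\<integral>x. x j * x k \<partial>\<gamma>) = C j k" .
qed

section \<open>Product spaces and the laws of the two normalised sums\<close>

lemma integral_PiM_prod:
  fixes f :: "nat \<Rightarrow> 'a \<Rightarrow> 'b::{real_normed_field,banach,second_countable_topology}"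
  assumes p: "\<And>i. i < N \<Longrightarrow> prob_space (M i)" and f: "\<And>i. i < N \<Longrightarrow> integrable (M i) (f i)"
  shows "(\<integral>x. (\<Prod>i<N. f i (x i)) \<partial>PiM {..<N} M) = (\<Prod>i<N. integral\<^sup>L (M i) (f i))"
proof (cases "N = 0")
  case True then show ?thesis by (simp add: product_sigma_finite_def PiM_empty measure_count_space)
next
  case False
  \<comment> \<open>Indices from \<open>N\<close> on receive \<open>M 0\<close>, since
    \<open>product_sigma_finite\<close> speaks about all components and nothing is known about the
    given ones there.\<close>
  define M' where "M' i = (if i < N then M i else M 0)" for i
  have "prob_space (M' i)" for i using p False by (auto simp: M'_def)
  then interpret product_sigma_finite M' unfolding product_sigma_finite_def using prob_space_imp_sigma_finite by blast
  have "PiM {..<N} M = PiM {..<N} M'" by (intro PiM_cong) (auto simp: M'_def)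
  then have "(\<integral>x. (\<Prod>i<N. f i (x i)) \<partial>PiM {..<N} M) = (\<Prod>i<N. integral\<^sup>L (M' i) (f i))"
    using product_integral_prod[of "{..<N}" f] f by (simp add: M'_def)
  then show ?thesis by (simp add: M'_def)
qed

lemma prob_space_PiM_lessThan:
  assumes p: "\<And>i. i < N \<Longrightarrow> prob_space (M i)"
  shows "prob_space (PiM {..<N::nat} M)"
proof (rule prob_space_PiM)
qed (use p in auto)

lemma std_normal_vec_gaussian: "gaussian_law N (std_normal_vec N) (\<lambda>j k. if j = k then 1 else 0)"
proof -
  interpret S: real_distribution std_normal_distribution by (rule real_dist_normal_dist)
  have s: "sets (std_normal_vec N) = sets (Rp_meas N)"
    unfolding std_normal_vec_def Rp_meas_def by (intro sets_PiM_cong) auto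
  have "(CLINT x|std_normal_vec N. iexp (ip N v x)) = complex_of_real (exp (- quad_form N (\<lambda>j k. if j = k then 1 else 0) v / 2))" for v
  proof -
    have "(CLINT x|std_normal_vec N. iexp (ip N v x)) = (CLINT x|std_normal_vec N. (\<Prod>i<N. iexp (v i * x i)))"
      by (simp add: ip_def exp_sum sum_distrib_left)
    also have "\<dots> = (\<Prod>i<N. CLINT x|std_normal_distribution. iexp (v i * x))"
      unfolding std_normal_vec_def
      by (intro integral_PiM_prod S.integrable_iexp) (auto intro: S.prob_space_axioms)
    also have "\<dots> = (\<Prod>i<N. complex_of_real (exp (- (v i)\<^sup>2 / 2)))"
      using fun_cong[OF char_std_normal_distribution] by (simp add: char_def)
    also have "\<dots> = complex_of_real (exp (\<Sum>i<N. - (v i)\<^sup>2 / 2))" by (simp add: exp_sum)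
    also have "(\<Sum>i<N. - (v i)\<^sup>2 / 2) = - quad_form N (\<lambda>j k. if j = k then 1 else 0) v / 2"
      unfolding quad_form_def
      by (simp add: if_distrib[of "\<lambda>c. _ * c"] if_distrib[of "\<lambda>c. c * _"] sum_negf sum_divide_distrib power2_eq_square cong: if_cong)
    finally show ?thesis .
  qed
  moreover have "prob_space (std_normal_vec N)" unfolding std_normal_vec_def
    by (intro prob_space_PiM_lessThan S.prob_space_axioms)
  ultimately show ?thesis using s by (simp add: gaussian_law_def)
qed

lemma push_cov_id: "push_cov n T (\<lambda>j k. if j = k then 1 else 0) = (\<lambda>i k. \<Sum>a<n. T i a * T k a)"
  unfolding push_cov_def
  by (simp add: fun_eq_iff if_distrib[of "\<lambda>c. _ * c"] if_distrib[of "\<lambda>c. c * _"] cong: if_cong)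

text \<open>With \<open>z\<close> fixed, \<open>S_eZ\<close> is a linear map of the standard normal
  vector \<open>e\<close>, so no approximation is involved; the covariance is the empirical
  one.\<close>

lemma S_eZ_gaussian:
  "gaussian_law p (distr (std_normal_vec N) (Rp_meas p) (S_eZ p N z))
     (\<lambda>j k. (1 / real N) * (\<Sum>i<N. (z i j - zbar p N z j) * (z i k - zbar p N z k)))"
proof -
  define T where "T j i = (z i j - zbar p N z j) / sqrt (real N)" for j i
  have "S_eZ p N z = lin_map p N T"
    unfolding S_eZ_def lin_map_def ip_def T_def
    by (auto simp: fun_eq_iff sum_distrib_left intro!: sum.cong)
  moreover have "push_cov N T (\<lambda>j k. if j = k then 1 else 0)
      = (\<lambda>j k. (1 / real N) * (\<Sum>i<N. (z i j - zbar p N z j) * (z i k - zbar p N z k)))"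
    unfolding push_cov_id
    by (auto simp: fun_eq_iff power2_eq_square[symmetric] sum_distrib_left T_def intro!: sum.cong)
  ultimately show ?thesis using gaussian_law_lin_map[OF std_normal_vec_gaussian, of p N T] by simp
qed

lemma S_Y_gaussian:
  assumes g: "\<And>i. i < N \<Longrightarrow> gaussian_law p (\<nu> i) (C i)"
  shows "S_Y p N \<in> measurable (PiM {..<N} \<nu>) (Rp_meas p)"
    "gaussian_law p (distr (PiM {..<N} \<nu>) (Rp_meas p) (S_Y p N)) (\<lambda>j k. (1 / real N) * (\<Sum>i<N. C i j k))"
proof -
  note G = gaussian_lawD[OF g]
  show m[measurable]: "S_Y p N \<in> measurable (PiM {..<N} \<nu>) (Rp_meas p)"
    unfolding S_Y_def
  proof (intro restrict_measurable_Rp borel_measurable_times borel_measurable_sum borel_measurable_const)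
    fix j i assume "j < p" "i \<in> {..<N}"
    then have "(\<lambda>x. x j) \<in> borel_measurable (\<nu> i)" using G(2) by (intro Rp_coordinate_measurable) auto
    with \<open>i \<in> {..<N}\<close> show "(\<lambda>x. x i j) \<in> borel_measurable (PiM {..<N} \<nu>)" by measurable
  qed
  interpret P: prob_space "PiM {..<N} \<nu>" by (intro prob_space_PiM_lessThan G)
  have ipS: "ip p v (S_Y p N y) = (\<Sum>i<N. ip p (\<lambda>j. 1 / sqrt (real N) * v j) (y i))" for v y
    unfolding ip_def S_Y_def by (subst sum.swap) (auto simp: sum_distrib_left mult_ac intro!: sum.cong)
  have "(CLINT x|distr (PiM {..<N} \<nu>) (Rp_meas p) (S_Y p N). iexp (ip p v x))
     = complex_of_real (exp (- quad_form p (\<lambda>j k. (1 / real N) * (\<Sum>i<N. C i j k)) v / 2))" for v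
  proof -
    have "(CLINT x|distr (PiM {..<N} \<nu>) (Rp_meas p) (S_Y p N). iexp (ip p v x))
       = (CLINT y|PiM {..<N} \<nu>. iexp (ip p v (S_Y p N y)))"
      using ip_measurable[of "Rp_meas p" p v] by (subst integral_distr) auto
    also have "\<dots> = (CLINT y|PiM {..<N} \<nu>. (\<Prod>i<N. iexp (ip p (\<lambda>j. 1 / sqrt (real N) * v j) (y i))))"
      by (simp add: ipS exp_sum sum_distrib_left)
    also have "\<dots> = (\<Prod>i<N. CLINT x|\<nu> i. iexp (ip p (\<lambda>j. 1 / sqrt (real N) * v j) x))"
      using ip_measurable[OF G(2)]
      by (intro integral_PiM_prod prob_space.integrable_iexp) (auto intro: G(1))
    also have "\<dots> = (\<Prod>i<N. complex_of_real (exp (- quad_form p (C i) v / (2 * real N))))"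
      by (intro prod.cong refl) (simp only: lessThan_iff G(4) quad_form_scale, simp add: power_divide)
    also have "\<dots> = complex_of_real (exp (\<Sum>i<N. - quad_form p (C i) v / (2 * real N)))" by (simp add: exp_sum)
    also have "(\<Sum>i<N. - quad_form p (C i) v / (2 * real N)) = - (1 / real N * (\<Sum>i<N. quad_form p (C i) v)) / 2"
      by (simp add: sum_negf sum_divide_distrib mult.commute)
    also have "1 / real N * (\<Sum>i<N. quad_form p (C i) v) = quad_form p (\<lambda>j k. (1 / real N) * (\<Sum>i<N. C i j k)) v"
    proof -
      define f where "f i j k = 1 / real N * (v j * C i j k * v k)" for i j k
      have "1 / real N * (\<Sum>i<N. quad_form p (C i) v) = (\<Sum>i<N. \<Sum>j<p. \<Sum>k<p. f i j k)"
        by (simp add: quad_form_def sum_distrib_left f_def)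
      also have "\<dots> = (\<Sum>j<p. \<Sum>i<N. \<Sum>k<p. f i j k)" by (rule sum.swap)
      also have "\<dots> = (\<Sum>j<p. \<Sum>k<p. \<Sum>i<N. f i j k)" by (rule sum.cong[OF refl], rule sum.swap)
      finally show ?thesis
        by (simp add: quad_form_def sum_distrib_left sum_distrib_right f_def mult_ac)
    qed
    finally show ?thesis .
  qed
  then show "gaussian_law p (distr (PiM {..<N} \<nu>) (Rp_meas p) (S_Y p N)) (\<lambda>j k. (1 / real N) * (\<Sum>i<N. C i j k))"
    using P.prob_space_distr[OF m] by (simp add: gaussian_law_def)
qed

section \<open>Anti-concentration of Gaussian maxima\<close>

lemma std_normal_density_shift:
  "std_normal_density (t + r) = std_normal_density t * exp (- (t * r) - r\<^sup>2 / 2)"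
  by (simp add: normal_density_def exp_add[symmetric] power2_eq_square field_simps)

text \<open>An averaged form of the bounded hazard rate. The part of \<open>U\<close> in the strip,
  moved up by \<open>r\<close> in \<open>{0..L}\<close>, stays in \<open>U\<close> and loses only a
  constant factor of its mass. A given point of \<open>U\<close> is hit only by shifts
  \<open>r\<close> from an interval of length \<open>\<epsilon>\<close>, because the strip is that
  thin. Averaging over \<open>r\<close> bounds \<open>L\<close> times the mass in the strip by a
  constant times \<open>\<epsilon>\<close> times the mass of \<open>U\<close>.\<close>

lemma std_normal_strip_up_closed:
  assumes U[measurable]: "U \<in> sets borel" and up: "\<And>t u. t \<in> U \<Longrightarrow> t \<le> u \<Longrightarrow> u \<in> U" and eps: "0 \<le> \<epsilon>"
  shows "measure std_normal_distribution (U \<inter> {a - \<epsilon><..a})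
    \<le> exp (3/2) * \<epsilon> * (1 + max a 0) * measure std_normal_distribution U"
proof -
  interpret S: real_distribution std_normal_distribution by (rule real_dist_normal_dist)
  define A where "A = U \<inter> {a - \<epsilon><..a}"
  have [measurable]: "A \<in> sets borel" unfolding A_def by measurable
  \<comment> \<open>The length over which the normal density, started at or below \<open>a\<close>,
    drops by a constant factor only: \<open>t * r\<close> is at most 1 and \<open>r^2 / 2\<close> at
    most 1/2, whence \<open>exp (- 3/2)\<close>.\<close>
  define L where "L = 1 / (1 + max a 0)"
  have L: "0 < L" "L \<le> 1" unfolding L_def by (auto simp: field_simps)
  have La: "max a 0 * L \<le> 1" unfolding L_def by (auto simp: field_simps)
  let ?\<phi> = std_normal_density
  have dens: "exp (- (3/2)) * ?\<phi> t \<le> ?\<phi> (t + r)" if "t \<le> a" "0 \<le> r" "r \<le> L" for t r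
  proof -
    have "t * r \<le> max a 0 * L"
      using that by (smt (verit) mult_mono mult_nonpos_nonneg max.cobounded1 max.cobounded2 mult_nonneg_nonneg)
    moreover have "r\<^sup>2 \<le> 1" using that L by (simp add: power_le_one)
    ultimately have "exp (- (3/2)) \<le> exp (- (t * r) - r\<^sup>2 / 2)" using La by simp
    then show ?thesis unfolding std_normal_density_shift
      by (subst mult.commute) (intro mult_left_mono, auto)
  qed
  have "ennreal (L * exp (- (3/2))) * emeasure std_normal_distribution A
      = (\<integral>\<^sup>+ r. indicator {0..L} r * (ennreal (exp (- (3/2))) * (\<integral>\<^sup>+ t. ennreal (?\<phi> t) * indicator A t \<partial>lborel)) \<partial>lborel)"
    using L by (subst nn_integral_multc) (auto simp: emeasure_density ennreal_mult mult.assoc)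
  also have "\<dots> = (\<integral>\<^sup>+ r. \<integral>\<^sup>+ t. indicator {0..L} r * (ennreal (exp (- (3/2)) * ?\<phi> t) * indicator A t) \<partial>lborel \<partial>lborel)"
    by (simp add: nn_integral_cmult ennreal_mult mult.assoc)
  also have "\<dots> \<le> (\<integral>\<^sup>+ r. \<integral>\<^sup>+ t. indicator {0..L} r * (ennreal (?\<phi> (t + r)) * indicator A t) \<partial>lborel \<partial>lborel)"
  proof (intro nn_integral_mono)
    fix r t show "indicator {0..L} r * (ennreal (exp (- (3/2)) * ?\<phi> t) * indicator A t)
       \<le> indicator {0..L} r * (ennreal (?\<phi> (t + r)) * indicator A t)"
      using dens[of t r] by (auto simp: indicator_def A_def intro!: ennreal_leI)
  qed
  also have "\<dots> = (\<integral>\<^sup>+ r. \<integral>\<^sup>+ t. indicator {0..L} r * (ennreal (?\<phi> t) * indicator A (t - r)) \<partial>lborel \<partial>lborel)"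
  proof (rule nn_integral_cong)
    fix r
    show "(\<integral>\<^sup>+ t. indicator {0..L} r * (ennreal (?\<phi> (t + r)) * indicator A t) \<partial>lborel)
       = (\<integral>\<^sup>+ t. indicator {0..L} r * (ennreal (?\<phi> t) * indicator A (t - r)) \<partial>lborel)"
      by (subst nn_integral_real_affine[where c=1 and t="-r"]) (auto simp: algebra_simps)
  qed
  also have "\<dots> = (\<integral>\<^sup>+ t. \<integral>\<^sup>+ r. indicator {0..L} r * (ennreal (?\<phi> t) * indicator A (t - r)) \<partial>lborel \<partial>lborel)"
    by (rule lborel_pair.Fubini') measurable
  also have "\<dots> \<le> (\<integral>\<^sup>+ t. ennreal (?\<phi> t) * indicator U t * ennreal \<epsilon> \<partial>lborel)"
  proof (intro nn_integral_mono)
    fix t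
    have "(\<integral>\<^sup>+ r. indicator {0..L} r * (ennreal (?\<phi> t) * indicator A (t - r)) \<partial>lborel)
       \<le> (\<integral>\<^sup>+ r. ennreal (?\<phi> t) * indicator U t * indicator {t - a..<t - a + \<epsilon>} r \<partial>lborel)"
      using up by (intro nn_integral_mono) (auto simp: indicator_def A_def)
    also have "\<dots> = ennreal (?\<phi> t) * indicator U t * ennreal \<epsilon>"
      using eps by (subst nn_integral_cmult) auto
    finally show "(\<integral>\<^sup>+ r. indicator {0..L} r * (ennreal (?\<phi> t) * indicator A (t - r)) \<partial>lborel) \<le> ennreal (?\<phi> t) * indicator U t * ennreal \<epsilon>" .
  qed
  also have "\<dots> = ennreal \<epsilon> * emeasure std_normal_distribution U"
    by (subst nn_integral_multc) (simp_all add: emeasure_density mult_ac)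
  finally have "ennreal (L * exp (- (3/2))) * ennreal (measure std_normal_distribution A) \<le> ennreal \<epsilon> * ennreal (measure std_normal_distribution U)"
    by (simp add: S.emeasure_eq_measure)
  then have "L * exp (- (3/2)) * measure std_normal_distribution A \<le> \<epsilon> * measure std_normal_distribution U"
    using L eps by (simp add: ennreal_mult[symmetric])
  then have "exp (3/2) * (1 + max a 0) * (L * exp (- (3/2)) * measure std_normal_distribution A)
      \<le> exp (3/2) * (1 + max a 0) * (\<epsilon> * measure std_normal_distribution U)"
    by (intro mult_left_mono) auto
  moreover have "exp (3/2) * (1 + max a 0) * (L * exp (- (3/2)) * measure std_normal_distribution A)
      = (exp (3/2) * exp (- (3/2))) * ((1 + max a 0) * L) * measure std_normal_distribution A" by (simp add: mult_ac)
  moreover have "exp (3/2) * exp (- (3/2)) = (1::real)" by (simp add: exp_add[symmetric])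
  moreover have "(1 + max a 0) * L = 1" unfolding L_def by (simp add: add_nonneg_eq_0_iff add_eq_0_iff)
  ultimately have "measure std_normal_distribution A \<le> exp (3/2) * (1 + max a 0) * (\<epsilon> * measure std_normal_distribution U)"
    by (simp only: mult_1)
  then show ?thesis unfolding A_def by (simp only: mult_ac)
qed

text \<open>For thresholds far out, where the factor \<open>1 + max a 0\<close> of the previous
  bound is too large: beyond \<open>L\<close> the density itself is at most
  \<open>exp (- L^2 / 2)\<close>.\<close>

lemma std_normal_tail_strip:
  assumes "0 \<le> \<epsilon>" "0 \<le> L" "L \<le> a - \<epsilon>"
  shows "measure std_normal_distribution {a - \<epsilon><..a} \<le> \<epsilon> * exp (- L\<^sup>2 / 2)"
proof -
  interpret S: real_distribution std_normal_distribution by (rule real_dist_normal_dist)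
  have "emeasure std_normal_distribution {a - \<epsilon><..a} \<le> (\<integral>\<^sup>+ t. ennreal (exp (- L\<^sup>2 / 2)) * indicator {a - \<epsilon><..a} t \<partial>lborel)"
  proof (subst emeasure_density, simp, simp, rule nn_integral_mono)
    fix t
    show "ennreal (std_normal_density t) * indicator {a - \<epsilon><..a} t \<le> ennreal (exp (- L\<^sup>2 / 2)) * indicator {a - \<epsilon><..a} t"
    proof (cases "t \<in> {a - \<epsilon><..a}")
      case True
      then have "L\<^sup>2 \<le> t\<^sup>2" using assms by (intro power_mono) auto
      moreover have "1 / sqrt (2 * pi) \<le> 1" using pi_ge_two by (simp add: real_le_rsqrt)
      ultimately have "std_normal_density t \<le> 1 * exp (- L\<^sup>2 / 2)"
        unfolding std_normal_density_def by (intro mult_mono) auto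
      then show ?thesis using True by (simp add: ennreal_leI)
    qed simp
  qed
  also have "\<dots> = ennreal (exp (- L\<^sup>2 / 2) * \<epsilon>)"
    using assms by (subst nn_integral_cmult) (auto simp: ennreal_mult)
  finally show ?thesis using assms by (simp add: S.emeasure_eq_measure mult.commute)
qed

section \<open>Regression of a Gaussian vector on one coordinate\<close>

lemma bilinear_basis_right:
  "j < n \<Longrightarrow> (\<Sum>a<n. \<Sum>b<n. v a * C a b * (c * basis_vec j b)) = c * ip n v (\<lambda>a. C a j)"
  by (simp add: basis_vec_def ip_def if_distrib[of "\<lambda>c. c * _"] if_distrib[of "\<lambda>c. _ * c"] sum_distrib_left mult_ac cong: if_cong)

lemma quad_form_basis: "j < n \<Longrightarrow> quad_form n C (\<lambda>i. c * basis_vec j i) = c\<^sup>2 * C j j"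
  unfolding quad_form_scale by (simp add: quad_form_def bilinear_basis)

text \<open>What remains of \<open>x\<close> after regression on its coordinate \<open>j\<close>,
  where \<open>\<rho>\<close> collects the regression coefficients; \<open>along\<close> adds the
  regression part back.\<close>

definition residual :: "nat \<Rightarrow> (nat \<Rightarrow> real) \<Rightarrow> nat \<Rightarrow> (nat \<Rightarrow> real) \<Rightarrow> (nat \<Rightarrow> real)" where
  "residual n \<rho> j x = restrict (\<lambda>k. x k - \<rho> k * x j) {..<n}"

definition along :: "nat \<Rightarrow> (nat \<Rightarrow> real) \<Rightarrow> real \<Rightarrow> (nat \<Rightarrow> real) \<Rightarrow> (nat \<Rightarrow> real)" where
  "along n \<rho> t w = restrict (\<lambda>k. w k + t * \<rho> k) {..<n}"

lemma residual_measurable: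
  assumes "sets M = sets (Rp_meas n)" "j < n"
  shows "residual n \<rho> j \<in> measurable M (Rp_meas n)"
  unfolding residual_def using Rp_coordinate_measurable[OF assms(1)] assms(2)
  by (intro restrict_measurable_Rp borel_measurable_diff borel_measurable_times) auto

lemma along_measurable:
  "(\<lambda>(t, w). along n \<rho> t w) \<in> measurable (std_normal_distribution \<Otimes>\<^sub>M Rp_meas n) (Rp_meas n)"
proof -
  have "(\<lambda>z. along n \<rho> (fst z) (snd z)) \<in> measurable (std_normal_distribution \<Otimes>\<^sub>M Rp_meas n) (Rp_meas n)"
    unfolding along_def
  proof (intro restrict_measurable_Rp borel_measurable_add borel_measurable_times borel_measurable_const)
    fix j assume "j < n"
    show "(\<lambda>z. snd z j) \<in> borel_measurable (std_normal_distribution \<Otimes>\<^sub>M Rp_meas n)"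
      using \<open>j < n\<close> by (intro measurable_compose[OF measurable_snd Rp_coordinate_measurable]) auto
    show "fst \<in> borel_measurable (std_normal_distribution \<Otimes>\<^sub>M Rp_meas n)" by measurable
  qed
  then show ?thesis by (simp add: split_def)
qed

text \<open>As \<open>C j j = 1\<close>, the residual is uncorrelated with \<open>x j\<close>, hence
  independent of it in a Gaussian vector; for characteristic functions this is the splitting of the
  quadratic form into \<open>c^2\<close> and the rest. As \<open>\<rho> j = 1\<close>, the residual
  vanishes at \<open>j\<close>, so the coordinate \<open>j\<close> of the reassembled vector is the
  standard normal \<open>t\<close> itself.\<close>

lemma gaussian_split:
  assumes g: "gaussian_law n \<gamma> C" and sym: "\<And>j k. C j k = C k j" and j: "j < n" and Cjj: "C j j = 1"
  defines "\<rho> \<equiv> \<lambda>k. C k j"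
  defines "\<gamma>' \<equiv> distr \<gamma> (Rp_meas n) (residual n \<rho> j)"
  shows "\<gamma> = distr (std_normal_distribution \<Otimes>\<^sub>M \<gamma>') (Rp_meas n) (\<lambda>(t, w). along n \<rho> t w)"
    and "prob_space \<gamma>'" and "AE w in \<gamma>'. w j = 0"
proof -
  note G = gaussian_lawD[OF g]
  have mr: "residual n \<rho> j \<in> measurable \<gamma> (Rp_meas n)" by (rule residual_measurable[OF G(2) j])
  show g': "prob_space \<gamma>'" unfolding \<gamma>'_def by (rule prob_space.prob_space_distr[OF G(1) mr])
  have s': "sets \<gamma>' = sets (Rp_meas n)" by (simp add: \<gamma>'_def)
  have "{w \<in> space (Rp_meas n). w j = 0} \<in> sets (Rp_meas n)"
    using j by (intro borel_measurable_eq Rp_coordinate_measurable borel_measurable_const) auto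
  then show "AE w in \<gamma>'. w j = 0"
    unfolding \<gamma>'_def by (subst AE_distr_iff[OF mr]) (auto simp: residual_def j \<rho>_def Cjj)
  interpret g': prob_space \<gamma>' by fact
  interpret S: real_distribution std_normal_distribution by (rule real_dist_normal_dist)
  interpret P: pair_prob_space std_normal_distribution \<gamma>' ..
  have [measurable]: "(\<lambda>x. ip n v x) \<in> borel_measurable (Rp_meas n)" "(\<lambda>x. ip n v x) \<in> borel_measurable \<gamma>'"
    for v using s' by (auto intro: ip_measurable)
  have ma: "(\<lambda>(t, w). along n \<rho> t w) \<in> measurable (std_normal_distribution \<Otimes>\<^sub>M \<gamma>') (Rp_meas n)"
    using along_measurable[of n \<rho>] by (simp only: measurable_cong_sets[OF sets_pair_measure_cong[OF refl s'] refl])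
  show "\<gamma> = distr (std_normal_distribution \<Otimes>\<^sub>M \<gamma>') (Rp_meas n) (\<lambda>(t, w). along n \<rho> t w)"
  proof (rule Rp_law_unique[OF G(1,2)])
    show "prob_space (distr (std_normal_distribution \<Otimes>\<^sub>M \<gamma>') (Rp_meas n) (\<lambda>(t, w). along n \<rho> t w))"
      by (rule P.prob_space_distr[OF ma])
    fix v
    define c where "c = ip n v \<rho>"
    have ipa: "ip n v (along n \<rho> t w) = t * c + ip n v w" for t w
      unfolding c_def ip_def along_def by (simp add: sum_distrib_left sum.distrib[symmetric] algebra_simps)
    have ipr: "ip n v (residual n \<rho> j x) = ip n (\<lambda>k. v k + (- c) * basis_vec j k) x" for x
    proof -
      have "ip n v (residual n \<rho> j x) = ip n v x - c * x j"
        unfolding c_def ip_def residual_def by (simp add: sum_distrib_left sum_distrib_right sum_subtractf[symmetric] algebra_simps)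
      moreover have "ip n (\<lambda>k. v k + (- c) * basis_vec j k) x = ip n v x - c * ip n (basis_vec j) x"
        unfolding ip_def by (simp add: sum_distrib_left sum_subtractf[symmetric] algebra_simps)
      ultimately show ?thesis by (simp add: ip_basis_vec j)
    qed
    have q: "quad_form n C (\<lambda>k. v k + (- c) * basis_vec j k) = quad_form n C v - c\<^sup>2"
      unfolding quad_form_polar[OF sym] bilinear_basis_right[OF j] quad_form_basis[OF j] Cjj
      by (simp add: c_def \<rho>_def power2_eq_square)
    have cf': "(CLINT w|\<gamma>'. iexp (ip n v w)) = complex_of_real (exp (- (quad_form n C v - c\<^sup>2) / 2))"
      unfolding \<gamma>'_def by (subst integral_distr[OF mr]) (simp_all only: ipr G(4) q, measurable)
    have i: "integrable (std_normal_distribution \<Otimes>\<^sub>M \<gamma>') (\<lambda>(t, w). iexp (t * c) * iexp (ip n v w))"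
    proof (rule P.integrable_const_bound[of _ 1])
      define q where "q = ip n v"
      have [measurable]: "q \<in> borel_measurable \<gamma>'" unfolding q_def using ip_measurable[OF s'] .
      have "(\<lambda>z. iexp (fst z * c) * iexp (q (snd z))) \<in> borel_measurable (std_normal_distribution \<Otimes>\<^sub>M \<gamma>')" by measurable
      then show "(\<lambda>(t, w). iexp (t * c) * iexp (ip n v w)) \<in> borel_measurable (std_normal_distribution \<Otimes>\<^sub>M \<gamma>')"
        by (simp add: q_def split_def)
    qed (auto simp: norm_mult)
    have "(CLINT x|distr (std_normal_distribution \<Otimes>\<^sub>M \<gamma>') (Rp_meas n) (\<lambda>(t, w). along n \<rho> t w). iexp (ip n v x))
      = (CLINT z|std_normal_distribution \<Otimes>\<^sub>M \<gamma>'. (\<lambda>(t, w). iexp (t * c) * iexp (ip n v w)) z)"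
      by (subst integral_distr[OF ma]) (auto simp: split_def ipa exp_add ring_distribs)
    also have "\<dots> = (CLINT t|std_normal_distribution. CLINT w|\<gamma>'. iexp (t * c) * iexp (ip n v w))"
      by (rule P.integral_fst[OF i, symmetric])
    also have "\<dots> = (CLINT t|std_normal_distribution. iexp (c * t)) * complex_of_real (exp (- (quad_form n C v - c\<^sup>2) / 2))"
      by (simp only: integral_mult_right_zero integral_mult_left_zero cf' mult.commute[of _ c])
    also have "\<dots> = complex_of_real (exp (- c\<^sup>2 / 2)) * complex_of_real (exp (- (quad_form n C v - c\<^sup>2) / 2))"
      using fun_cong[OF char_std_normal_distribution, of c] by (simp add: char_def)
    also have "\<dots> = complex_of_real (exp (- c\<^sup>2 / 2 + - (quad_form n C v - c\<^sup>2) / 2))"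
      by (simp only: exp_add of_real_mult)
    also have "- c\<^sup>2 / 2 + - (quad_form n C v - c\<^sup>2) / 2 = - quad_form n C v / 2" by (simp add: field_simps)
    finally show "(CLINT x|\<gamma>. iexp (ip n v x)) = (CLINT x|distr (std_normal_distribution \<Otimes>\<^sub>M \<gamma>') (Rp_meas n) (\<lambda>(t, w). along n \<rho> t w). iexp (ip n v x))"
      unfolding G(4) by simp
  qed simp
qed

text \<open>Fixing the residual \<open>w\<close> leaves a line in the regression direction. On it
  \<open>D\<close> becomes an up-closed set of reals and the strip becomes
  \<open>{a - \<epsilon><..a}\<close>, so the one-dimensional bound holds for almost every
  \<open>w\<close> and integrates.\<close>

lemma gaussian_strip_up_closed:
  assumes g: "gaussian_law n \<gamma> C" and sym: "\<And>j k. C j k = C k j" and j: "j < n" and Cjj: "C j j = 1"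
    and D: "D \<in> sets (Rp_meas n)" and up: "\<And>x r. x \<in> D \<Longrightarrow> 0 \<le> r \<Longrightarrow> along n (\<lambda>k. C k j) r x \<in> D"
    and eps: "0 \<le> \<epsilon>"
  shows "measure \<gamma> (D \<inter> {x \<in> space (Rp_meas n). a - \<epsilon> < x j \<and> x j \<le> a})
    \<le> exp (3/2) * \<epsilon> * (1 + max a 0) * measure \<gamma> D"
proof -
  define \<rho> where "\<rho> k = C k j" for k
  define \<gamma>' where "\<gamma>' = distr \<gamma> (Rp_meas n) (residual n \<rho> j)"
  have \<rho>': "(\<lambda>k. C k j) = \<rho>" by (simp add: \<rho>_def fun_eq_iff)
  note sp = gaussian_split[OF g sym j Cjj, folded \<rho>_def, folded \<gamma>'_def]
  interpret g: prob_space \<gamma> using gaussian_lawD[OF g] by simp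
  interpret g': prob_space \<gamma>' by (rule sp)
  interpret S: real_distribution std_normal_distribution by (rule real_dist_normal_dist)
  interpret P: pair_prob_space std_normal_distribution \<gamma>' ..
  have s': "sets \<gamma>' = sets (Rp_meas n)" by (simp add: \<gamma>'_def)
  have ma: "(\<lambda>(t, w). along n \<rho> t w) \<in> measurable (std_normal_distribution \<Otimes>\<^sub>M \<gamma>') (Rp_meas n)"
    using along_measurable[of n \<rho>] by (simp only: measurable_cong_sets[OF sets_pair_measure_cong[OF refl s'] refl])
  let ?E = "D \<inter> {x \<in> space (Rp_meas n). a - \<epsilon> < x j \<and> x j \<le> a}"
  have "{x \<in> space (Rp_meas n). a - \<epsilon> < x j \<and> x j \<le> a} \<in> sets (Rp_meas n)"
    using j by (intro sets.sets_Collect_conj borel_measurable_less borel_measurable_le borel_measurable_const Rp_coordinate_measurable) auto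
  then have E: "?E \<in> sets (Rp_meas n)" using D by blast
  have slice: "{t. along n \<rho> t w \<in> B} \<in> sets borel" if "B \<in> sets (Rp_meas n)" "w \<in> space \<gamma>'" for w B
  proof -
    have "(\<lambda>t. along n \<rho> t w) \<in> measurable std_normal_distribution (Rp_meas n)"
      using measurable_compose[OF measurable_Pair2'[OF that(2)] ma] by simp
    from measurable_sets[OF this that(1)] show ?thesis by (simp add: vimage_def)
  qed
  have em: "emeasure \<gamma> B = (\<integral>\<^sup>+ w. emeasure std_normal_distribution {t. along n \<rho> t w \<in> B} \<partial>\<gamma>')" if B: "B \<in> sets (Rp_meas n)" for B
  proof -
    have "emeasure \<gamma> B = emeasure (distr (std_normal_distribution \<Otimes>\<^sub>M \<gamma>') (Rp_meas n) (\<lambda>(t, w). along n \<rho> t w)) B"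
      using sp(1) by simp
    also have "\<dots> = emeasure (std_normal_distribution \<Otimes>\<^sub>M \<gamma>') ((\<lambda>(t, w). along n \<rho> t w) -` B \<inter> space (std_normal_distribution \<Otimes>\<^sub>M \<gamma>'))"
      by (rule emeasure_distr[OF ma B])
    also have "\<dots> = (\<integral>\<^sup>+ w. emeasure std_normal_distribution ((\<lambda>t. (t, w)) -` ((\<lambda>(t, w). along n \<rho> t w) -` B \<inter> space (std_normal_distribution \<Otimes>\<^sub>M \<gamma>'))) \<partial>\<gamma>')"
      by (rule P.emeasure_pair_measure_alt2[OF measurable_sets[OF ma B]])
    also have "\<dots> = (\<integral>\<^sup>+ w. emeasure std_normal_distribution {t. along n \<rho> t w \<in> B} \<partial>\<gamma>')"
      by (intro nn_integral_cong arg_cong2[where f=emeasure] refl) (auto simp: space_pair_measure)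
    finally show ?thesis .
  qed
  have along_add: "along n \<rho> r (along n \<rho> t w) = along n \<rho> (t + r) w" for r t w
    by (auto simp: along_def fun_eq_iff algebra_simps)
  let ?K = "exp (3/2) * \<epsilon> * (1 + max a 0)"
  have K: "?K \<ge> 0" using eps by simp
  have "emeasure \<gamma> ?E \<le> (\<integral>\<^sup>+ w. ennreal ?K * emeasure std_normal_distribution {t. along n \<rho> t w \<in> D} \<partial>\<gamma>')"
    unfolding em[OF E]
  proof (intro nn_integral_mono_AE)
    show "AE w in \<gamma>'. emeasure std_normal_distribution {t. along n \<rho> t w \<in> ?E}
      \<le> ennreal ?K * emeasure std_normal_distribution {t. along n \<rho> t w \<in> D}"
      using sp(3) AE_space
    proof eventually_elim
      case (elim w)
      let ?U = "{t. along n \<rho> t w \<in> D}"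
      have "{t. along n \<rho> t w \<in> ?E} = ?U \<inter> {a - \<epsilon><..a}"
        using elim j Cjj by (auto simp: along_def \<rho>_def space_Rp_meas)
      moreover have "measure std_normal_distribution (?U \<inter> {a - \<epsilon><..a}) \<le> ?K * measure std_normal_distribution ?U"
      proof (rule std_normal_strip_up_closed[OF _ _ eps])
        show "?U \<in> sets borel" by (rule slice[OF D elim(2)])
        fix t u assume "t \<in> ?U" "t \<le> u"
        then show "u \<in> ?U" using up[unfolded \<rho>', of "along n \<rho> t w" "u - t"] along_add[of "u - t" t w] by simp
      qed
      ultimately show ?case using K by (simp add: S.emeasure_eq_measure ennreal_mult[symmetric] ennreal_leI)
    qed
  qed
  also have "\<dots> = ennreal ?K * emeasure \<gamma> D"
  proof (subst nn_integral_cmult)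
    show "(\<lambda>w. emeasure std_normal_distribution {t. along n \<rho> t w \<in> D}) \<in> borel_measurable \<gamma>'"
    proof -
      have "(\<lambda>w. emeasure std_normal_distribution ((\<lambda>t. (t, w)) -` ((\<lambda>(t, w). along n \<rho> t w) -` D \<inter> space (std_normal_distribution \<Otimes>\<^sub>M \<gamma>')))) \<in> borel_measurable \<gamma>'"
        by (rule P.measurable_emeasure_Pair2[OF measurable_sets[OF ma D]])
      also have "?this \<longleftrightarrow> ?thesis"
        by (intro measurable_cong arg_cong2[where f=emeasure] refl) (auto simp: space_pair_measure)
      finally show ?thesis .
    qed
  qed (simp add: em[OF D])
  finally show ?thesis using K by (simp add: g.emeasure_eq_measure ennreal_mult[symmetric])
qed

section \<open>Boundary layers of orthants\<close>

definition orthant :: "nat \<Rightarrow> (nat \<Rightarrow> real) \<Rightarrow> (nat \<Rightarrow> real) set" where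
  "orthant n a = {x \<in> space (Rp_meas n). \<forall>j<n. x j \<le> a j}"

lemma orthant_sets: "orthant n a \<in> sets (Rp_meas n)"
proof -
  have [measurable]: "\<And>j. j \<in> {..<n} \<Longrightarrow> (\<lambda>x. x j) \<in> borel_measurable (Rp_meas n)"
    by (intro Rp_coordinate_measurable) auto
  have "{x \<in> space (Rp_meas n). \<forall>j\<in>{..<n}. x j \<le> a j} \<in> sets (Rp_meas n)" by measurable
  then show ?thesis by (simp add: orthant_def Ball_def)
qed

text \<open>\<open>L\<close> is any bound for \<open>sqrt (2 ln n)\<close>. Thresholds up to
  \<open>1 + L\<close> pay the hazard rate \<open>2 + L\<close> times the probabilities of disjoint
  events, which sum to at most 1; each of the at most \<open>n\<close> thresholds beyond pays at
  most \<open>\<epsilon> / n\<close>.\<close>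

lemma gaussian_orthant_unit:
  assumes g: "gaussian_law n \<gamma> C" and sym: "\<And>j k. C j k = C k j" and diag: "\<And>j. j < n \<Longrightarrow> C j j = 1"
    and L: "1 \<le> L" "real n \<le> exp (L\<^sup>2 / 2)" and eps: "0 \<le> \<epsilon>"
  shows "measure \<gamma> (orthant n a) - measure \<gamma> (orthant n (\<lambda>j. a j - \<epsilon>)) \<le> 20 * L * \<epsilon>"
proof (cases "\<epsilon> \<le> 1")
  case False
  interpret g: prob_space \<gamma> using gaussian_lawD[OF g] by simp
  have "1 * 1 \<le> L * \<epsilon>" using L False by (intro mult_mono) auto
  moreover have "measure \<gamma> (orthant n a) - measure \<gamma> (orthant n (\<lambda>j. a j - \<epsilon>)) \<le> 1"
    using g.prob_le_1[of "orthant n a"] measure_nonneg[of \<gamma> "orthant n (\<lambda>j. a j - \<epsilon>)"] by linarith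
  ultimately show ?thesis by linarith
next
  case True
  note G = gaussian_lawD[OF g]
  interpret g: prob_space \<gamma> by (rule G)
  have cm: "(\<lambda>x. x j) \<in> borel_measurable (Rp_meas n)" if "j < n" for j using that by (intro Rp_coordinate_measurable) auto
  \<comment> \<open>Ties in the largest excess go to the smallest index. This makes the sets
    disjoint, so that a factor of order \<open>L\<close> replaces the factor \<open>n\<close> of a
    plain union bound.\<close>
  define D where "D j = {x \<in> space (Rp_meas n). \<forall>k\<in>{..<n}. (k < j \<longrightarrow> x k - a k < x j - a j) \<and> x k - a k \<le> x j - a j}" for j
  define St where "St j = {x \<in> space (Rp_meas n). a j - \<epsilon> < x j \<and> x j \<le> a j}" for j
  have Dm: "D j \<in> sets \<gamma>" and Sm: "St j \<in> sets \<gamma>" if "j < n" for j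
  proof -
    show "D j \<in> sets \<gamma>" unfolding D_def G(2)
    proof (rule sets.sets_Collect_finite_All[OF _ finite_lessThan])
      fix k assume "k \<in> {..<n}"
      define q where "q i x = x i - a i" for i and x :: "nat \<Rightarrow> real"
      have qm: "q k \<in> borel_measurable (Rp_meas n)" "q j \<in> borel_measurable (Rp_meas n)"
        using cm \<open>k \<in> {..<n}\<close> that unfolding q_def by (auto intro!: borel_measurable_diff)
      have "{x \<in> space (Rp_meas n). (k < j \<longrightarrow> q k x < q j x) \<and> q k x \<le> q j x} \<in> sets (Rp_meas n)"
        using borel_measurable_less[OF qm] borel_measurable_le[OF qm]
        by (cases "k < j") (simp_all add: sets.sets_Collect_conj)
      then show "{x \<in> space (Rp_meas n). (k < j \<longrightarrow> x k - a k < x j - a j) \<and> x k - a k \<le> x j - a j} \<in> sets (Rp_meas n)"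
        unfolding q_def .
    qed
    show "St j \<in> sets \<gamma>" unfolding St_def G(2)
    proof (rule sets.sets_Collect_conj)
      show "{x \<in> space (Rp_meas n). a j - \<epsilon> < x j} \<in> sets (Rp_meas n)"
        by (rule borel_measurable_less[OF borel_measurable_const cm[OF that]])
      show "{x \<in> space (Rp_meas n). x j \<le> a j} \<in> sets (Rp_meas n)"
        by (rule borel_measurable_le[OF cm[OF that] borel_measurable_const])
    qed
  qed
  have disj: "disjoint_family_on D {..<n}"
    unfolding disjoint_family_on_def
  proof (intro ballI impI)
    fix i j assume ij: "i \<in> {..<n}" "j \<in> {..<n}" "i \<noteq> j"
    show "D i \<inter> D j = {}"
    proof (rule ccontr)
      assume "D i \<inter> D j \<noteq> {}"
      then obtain x where "x \<in> D i" "x \<in> D j" by auto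
      then have "x j - a j \<le> x i - a i" "x i - a i \<le> x j - a j"
        "i < j \<longrightarrow> x i - a i < x j - a j" "j < i \<longrightarrow> x j - a j < x i - a i"
        using ij by (auto simp: D_def)
      then show False using ij by (cases "i < j") auto
    qed
  qed
  \<comment> \<open>Correlations are at most 1 because the quadratic form is nonnegative. A move by
    \<open>r\<close> in the regression direction therefore raises coordinate \<open>j\<close> by
    \<open>r\<close> and every other coordinate by at most \<open>r\<close>: coordinate
    \<open>j\<close> keeps the largest excess and \<open>D j\<close> is up-closed.\<close>
  have C1: "C k j \<le> 1" if "k < n" "j < n" for k j
  proof -
    have "0 \<le> quad_form n C (\<lambda>i. basis_vec k i + (-1) * basis_vec j i)" by (rule gaussian_law_quad_form_nonneg[OF g])
    also have "\<dots> = 2 - 2 * C k j"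
      unfolding quad_form_polar[OF sym] bilinear_basis_right[OF that(2)] quad_form_basis[OF that(2)]
      using that diag quad_form_basis[OF that(1), of C 1] by (simp add: ip_basis_vec)
    finally show ?thesis by simp
  qed
  have strip: "measure \<gamma> (D j \<inter> St j) \<le> exp (3/2) * \<epsilon> * (2 + L) * measure \<gamma> (D j) + \<epsilon> * exp (- L\<^sup>2 / 2)" if j: "j < n" for j
  proof (cases "a j \<le> 1 + L")
    case True
    have "measure \<gamma> (D j \<inter> St j) \<le> exp (3/2) * \<epsilon> * (1 + max (a j) 0) * measure \<gamma> (D j)"
      unfolding St_def
    proof (rule gaussian_strip_up_closed[OF g sym j diag[OF j] _ _ eps])
      show "D j \<in> sets (Rp_meas n)" using Dm[OF j] G(2) by simp
      fix x r assume x: "x \<in> D j" "(0::real) \<le> r"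
      have "r * C k j \<le> r" if "k < n" for k using mult_left_mono[OF C1[OF that j] x(2)] by simp
      define y where "y = along n (\<lambda>k. C k j) r x"
      have y: "y k = x k + r * C k j" "y j = x j + r" if "k < n" for k
        using that j diag[OF j] by (simp_all add: y_def along_def)
      have "(k < j \<longrightarrow> y k - a k < y j - a j) \<and> y k - a k \<le> y j - a j" if k: "k < n" for k
      proof -
        have "(k < j \<longrightarrow> x k - a k < x j - a j) \<and> x k - a k \<le> x j - a j" using x(1) k by (auto simp: D_def)
        then show ?thesis using y[OF k] \<open>\<And>k. k < n \<Longrightarrow> r * C k j \<le> r\<close>[OF k] by (smt (verit))
      qed
      moreover have "y \<in> space (Rp_meas n)" by (simp add: y_def along_def space_Rp_meas)
      ultimately show "along n (\<lambda>k. C k j) r x \<in> D j" unfolding y_def[symmetric] D_def by auto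
    qed
    also have "\<dots> \<le> exp (3/2) * \<epsilon> * (2 + L) * measure \<gamma> (D j)"
      using True eps L by (intro mult_right_mono mult_left_mono) auto
    also have "\<dots> \<le> \<dots> + \<epsilon> * exp (- L\<^sup>2 / 2)" using eps by simp
    finally show ?thesis .
  next
    case False
    have "measure \<gamma> (D j \<inter> St j) \<le> measure \<gamma> (St j)" using Sm[OF j] by (intro g.finite_measure_mono) auto
    also have "measure \<gamma> (St j) = measure (distr \<gamma> borel (ip n (basis_vec j))) {a j - \<epsilon><..a j}"
      by (subst measure_distr[OF ip_measurable[OF G(2)]]) (auto simp: St_def G(3) ip_basis_vec[OF j] intro!: arg_cong[where f="measure \<gamma>"])
    also have "\<dots> = measure std_normal_distribution {a j - \<epsilon><..a j}"
      proof -
      have "sqrt (quad_form n C (basis_vec j)) = 1" using quad_form_basis[OF j, of C 1] diag[OF j] by simp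
      moreover have "((*) (1::real)) = (\<lambda>x. x)" by auto
      ultimately show ?thesis unfolding gaussian_law_marginal[OF g] by (simp add: distr_id2)
    qed
    also have "\<dots> \<le> \<epsilon> * exp (- L\<^sup>2 / 2)" using False \<open>\<epsilon> \<le> 1\<close> eps L by (intro std_normal_tail_strip) auto
    also have "\<dots> \<le> exp (3/2) * \<epsilon> * (2 + L) * measure \<gamma> (D j) + \<dots>" using eps L by simp
    finally show ?thesis .
  qed
  have sub: "orthant n a - orthant n (\<lambda>j. a j - \<epsilon>) \<subseteq> (\<Union>j<n. D j \<inter> St j)"
  proof
    fix x assume x: "x \<in> orthant n a - orthant n (\<lambda>j. a j - \<epsilon>)"
    then obtain i where i: "i < n" "a i - \<epsilon> < x i" by (force simp: orthant_def)
    define m where "m = Max ((\<lambda>k. x k - a k) ` {..<n})"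
    have mk: "x k - a k \<le> m" if "k < n" for k unfolding m_def using that by (intro Max_ge) auto
    have "m \<in> (\<lambda>k. x k - a k) ` {..<n}" unfolding m_def using i by (intro Max_in) auto
    then obtain k0 where k0: "k0 < n" "x k0 - a k0 = m" by auto
    define j where "j = (LEAST k. k < n \<and> x k - a k = m)"
    have j: "j < n" "x j - a j = m" using LeastI[of "\<lambda>k. k < n \<and> x k - a k = m" k0] k0 by (auto simp: j_def)
    have lt: "x k - a k < m" if "k < j" for k
      using not_less_Least[of k "\<lambda>k. k < n \<and> x k - a k = m"] that mk[of k] j(1) unfolding j_def[symmetric] by auto
    have "x \<in> D j" using x j mk lt by (auto simp: D_def orthant_def)
    moreover have "x \<in> St j" using x j mk[OF i(1)] i by (auto simp: St_def orthant_def)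
    ultimately show "x \<in> (\<Union>j<n. D j \<inter> St j)" using j by auto
  qed
  have om: "orthant n b \<in> sets \<gamma>" for b using orthant_sets G(2) by simp
  have "measure \<gamma> (orthant n a) - measure \<gamma> (orthant n (\<lambda>j. a j - \<epsilon>)) = measure \<gamma> (orthant n a - orthant n (\<lambda>j. a j - \<epsilon>))"
    by (rule g.finite_measure_Diff[symmetric, OF om om]) (use eps in \<open>force simp: orthant_def\<close>)
  also have "\<dots> \<le> measure \<gamma> (\<Union>j<n. D j \<inter> St j)"
    using sub Dm Sm by (intro g.finite_measure_mono) auto
  also have "\<dots> \<le> (\<Sum>j<n. measure \<gamma> (D j \<inter> St j))"
    using Dm Sm by (intro measure_UNION_le) auto
  also have "\<dots> \<le> (\<Sum>j<n. exp (3/2) * \<epsilon> * (2 + L) * measure \<gamma> (D j) + \<epsilon> * exp (- L\<^sup>2 / 2))"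
    using strip by (intro sum_mono) auto
  also have "\<dots> = exp (3/2) * \<epsilon> * (2 + L) * (\<Sum>j<n. measure \<gamma> (D j)) + real n * (\<epsilon> * exp (- L\<^sup>2 / 2))"
    by (simp add: sum.distrib sum_distrib_left)
  also have "(\<Sum>j<n. measure \<gamma> (D j)) = measure \<gamma> (\<Union>j<n. D j)"
    using Dm disj by (subst g.finite_measure_finite_Union) (auto simp: disjoint_family_on_def)
  also have "exp (3/2) * \<epsilon> * (2 + L) * measure \<gamma> (\<Union>j<n. D j) + real n * (\<epsilon> * exp (- L\<^sup>2 / 2))
      \<le> 6 * \<epsilon> * (2 + L) * 1 + exp (L\<^sup>2 / 2) * (\<epsilon> * exp (- L\<^sup>2 / 2))"
  proof (intro add_mono mult_mono)
    have "exp (3/2) ^ 2 = exp (1::real) ^ 3" by (simp add: exp_of_nat_mult[symmetric])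
    also have "\<dots> \<le> 3 ^ 3" using exp_le by (intro power_mono) auto
    also have "\<dots> \<le> (6::real) ^ 2" by simp
    finally show "exp (3/2) \<le> (6::real)" by (rule power2_le_imp_le) simp
  qed (use eps L g.prob_le_1 in auto)
  also have "\<dots> = 6 * \<epsilon> * (2 + L) + \<epsilon>" by (simp add: exp_minus field_simps)
  also have "\<dots> \<le> 20 * L * \<epsilon>"
  proof -
    have "1 * \<epsilon> \<le> L * \<epsilon>" using L eps by (intro mult_right_mono) auto
    moreover have "6 * \<epsilon> * (2 + L) + \<epsilon> = 13 * \<epsilon> + 6 * (L * \<epsilon>)" by (simp add: algebra_simps)
    moreover have "20 * L * \<epsilon> = 20 * (L * \<epsilon>)" by simp
    ultimately show ?thesis using eps by linarith
  qed
  finally show ?thesis .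
qed

text \<open>Scaling each coordinate to unit variance turns the margin \<open>\<epsilon>\<close> into
  margins of at most \<open>\<epsilon> / \<sigma>\<close>, because every standard deviation is at
  least \<open>\<sigma>\<close>.\<close>

theorem nazarov_anticoncentration:
  assumes g: "gaussian_law n \<gamma> C" and sym: "\<And>j k. C j k = C k j"
    and diag: "\<And>j. j < n \<Longrightarrow> \<sigma>\<^sup>2 \<le> C j j" and sig: "0 < \<sigma>"
    and L: "1 \<le> L" "real n \<le> exp (L\<^sup>2 / 2)" and eps: "0 \<le> \<epsilon>"
  shows "measure \<gamma> (orthant n a) - measure \<gamma> (orthant n (\<lambda>j. a j - \<epsilon>)) \<le> 20 * L * \<epsilon> / \<sigma>"
proof -
  note G = gaussian_lawD[OF g]
  interpret g: prob_space \<gamma> by (rule G)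
  define s where "s j = sqrt (C j j)" for j
  have s: "\<sigma> \<le> s j" if "j < n" for j
    using real_sqrt_le_mono[OF diag[OF that]] sig by (simp add: s_def)
  then have s0: "0 < s j" if "j < n" for j using that sig by (smt (verit))
  have s2: "C j j = s j * s j" if "j < n" for j
    using order_trans[OF zero_le_power2 diag[OF that]] by (simp add: s_def)
  define T where "T i = (\<lambda>k. 1 / s i * basis_vec i k)" for i
  have ipT: "ip n (T i) x = x i / s i" if "i < n" for i x
    using ip_basis_vec[OF that, of x] by (simp add: T_def ip_def sum_divide_distrib[symmetric])
  let ?\<gamma> = "distr \<gamma> (Rp_meas n) (lin_map n n T)" and ?C = "push_cov n T C"
  have g': "gaussian_law n ?\<gamma> ?C" by (rule gaussian_law_lin_map[OF g])
  have m: "lin_map n n T \<in> measurable \<gamma> (Rp_meas n)" by (rule lin_map_measurable[OF G(2)])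
  have sym': "?C j k = ?C k j" for j k
    unfolding push_cov_def by (subst sum.swap) (simp add: mult_ac sym[of j] sym)
  have diag': "?C j j = 1" if "j < n" for j
  proof -
    have "?C j j = quad_form n C (T j)" by (simp add: push_cov_def quad_form_def)
    also have "\<dots> = 1" unfolding T_def quad_form_basis[OF that] using s2[OF that] s0[OF that] by (simp add: power2_eq_square)
    finally show ?thesis .
  qed
  have pre: "measure ?\<gamma> (orthant n b) = measure \<gamma> (orthant n (\<lambda>j. s j * b j))" for b
  proof (subst measure_distr[OF m orthant_sets], rule arg_cong[where f="measure \<gamma>"])
    show "lin_map n n T -` orthant n b \<inter> space \<gamma> = orthant n (\<lambda>j. s j * b j)"
      using s0 by (auto simp: orthant_def lin_map_def space_Rp_meas G(3) ipT field_simps)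
  qed
  have "measure \<gamma> (orthant n (\<lambda>j. a j - s j * (\<epsilon> / \<sigma>))) \<le> measure \<gamma> (orthant n (\<lambda>j. a j - \<epsilon>))"
  proof (rule g.finite_measure_mono)
    have "\<epsilon> \<le> s j * (\<epsilon> / \<sigma>)" if "j < n" for j
      using mult_right_mono[OF s[OF that], of "\<epsilon> / \<sigma>"] sig eps by simp
    then show "orthant n (\<lambda>j. a j - s j * (\<epsilon> / \<sigma>)) \<subseteq> orthant n (\<lambda>j. a j - \<epsilon>)"
      by (force simp: orthant_def)
  qed (use orthant_sets G(2) in simp)
  moreover have "orthant n (\<lambda>j. s j * (a j / s j)) = orthant n a"
    "orthant n (\<lambda>j. s j * (a j / s j - \<epsilon> / \<sigma>)) = orthant n (\<lambda>j. a j - s j * (\<epsilon> / \<sigma>))"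
    using s0 by (auto simp: orthant_def right_diff_distrib less_imp_neq[THEN not_sym])
  ultimately show ?thesis
    using gaussian_orthant_unit[OF g' sym' diag' L, of "\<epsilon> / \<sigma>" "\<lambda>j. a j / s j"] eps sig
    unfolding pre by simp
qed

section \<open>Smoothed orthants\<close>

abbreviation exp1_dist :: "real measure" where
  "exp1_dist \<equiv> density lborel (exponential_density 1)"

lemma prob_space_exp1: "prob_space exp1_dist"
  by (rule prob_space_exponential_density) simp

lemma exp1_tail:
  assumes "0 \<le> s" shows "measure exp1_dist {s..} = exp (- s)"
proof -
  interpret prob_space exp1_dist by (rule prob_space_exp1)
  have "distributed exp1_dist lborel (\<lambda>x. x) (exponential_density 1)"
    unfolding distributed_def by (auto intro: measure_eqI simp: distr_id2)
  from exponential_distributedD_gt[OF this assms] have "measure exp1_dist {s<..} = exp (- s)"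
    by (simp add: greaterThan_def)
  moreover have "measure exp1_dist {s..} = measure exp1_dist {s<..}"
  proof (rule measure_eq_AE)
    have "AE x in lborel. x \<noteq> s" by (rule AE_lborel_singleton)
    then show "AE x in exp1_dist. (x \<in> {s..}) = (x \<in> {s<..})"
      by (subst AE_density) (auto elim!: eventually_mono)
  qed auto
  ultimately show ?thesis by simp
qed

text \<open>A smooth surrogate for the indicator of the orthant: it is the probability that independent
  standard exponential variables exceed the numbers \<open>exp (\<beta> (x\<^sub>j - a\<^sub>j))\<close>, hence a mixture of
  indicators of randomly shifted orthants.\<close>

definition soft_ind :: "nat \<Rightarrow> real \<Rightarrow> (nat \<Rightarrow> real) \<Rightarrow> (nat \<Rightarrow> real) \<Rightarrow> real" where
  "soft_ind n \<beta> a x = exp (- (\<Sum>j<n. exp (\<beta> * (x j - a j))))"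

definition noise :: "nat \<Rightarrow> (nat \<Rightarrow> real) measure" where
  "noise n = PiM {..<n} (\<lambda>_. exp1_dist)"

lemma prob_space_noise: "prob_space (noise n)"
  unfolding noise_def by (rule prob_space_PiM_lessThan) (rule prob_space_exp1)

lemma soft_ind_bounds: "0 \<le> soft_ind n \<beta> a x" "soft_ind n \<beta> a x \<le> 1"
  by (auto simp: soft_ind_def sum_nonneg)

lemma soft_ind_measurable:
  "sets M = sets (Rp_meas n) \<Longrightarrow> soft_ind n \<beta> a \<in> borel_measurable M"
  unfolding soft_ind_def[abs_def]
  using Rp_coordinate_measurable[of M n]
  by (intro borel_measurable_exp measurable_compose[OF _ borel_measurable_exp] borel_measurable_uminus borel_measurable_sum
      borel_measurable_times borel_measurable_diff borel_measurable_const) auto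

text \<open>The guard \<open>0 < y j\<close> keeps out the values of \<open>ln\<close> at
  nonpositive arguments, which mean nothing here.\<close>

definition shifted :: "real \<Rightarrow> (nat \<Rightarrow> real) \<Rightarrow> (nat \<Rightarrow> real) \<Rightarrow> (nat \<Rightarrow> real) \<Rightarrow> nat \<Rightarrow> bool" where
  "shifted \<beta> a x y j \<longleftrightarrow> 0 < y j \<and> x j \<le> a j + ln (y j) / \<beta>"

lemma soft_ind_mixture:
  assumes \<beta>: "0 < \<beta>"
  shows "soft_ind n \<beta> a x = (\<integral>y. (\<Prod>j<n. indicator {t. shifted \<beta> a x (\<lambda>_. t) j} (y j)) \<partial>noise n)"
proof -
  interpret E: prob_space exp1_dist by (rule prob_space_exp1)
  have eq: "{t. shifted \<beta> a x (\<lambda>_. t) j} = {exp (\<beta> * (x j - a j))..}" for j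
  proof (intro set_eqI, unfold mem_Collect_eq atLeast_iff)
    fix t
    show "shifted \<beta> a x (\<lambda>_. t) j \<longleftrightarrow> exp (\<beta> * (x j - a j)) \<le> t"
    proof (cases "0 < t")
      case True
      have "exp (\<beta> * (x j - a j)) \<le> t \<longleftrightarrow> \<beta> * (x j - a j) \<le> ln t" using True by (simp add: ln_ge_iff)
      also have "\<dots> \<longleftrightarrow> x j \<le> a j + ln t / \<beta>" using \<beta> by (simp add: field_simps)
      finally show ?thesis using True by (simp add: shifted_def)
    next
      case False
      then have "\<not> exp (\<beta> * (x j - a j)) \<le> t" using exp_gt_zero[of "\<beta> * (x j - a j)"] by linarith
      then show ?thesis using False by (simp add: shifted_def)
    qed
  qed
  have "(\<integral>y. (\<Prod>j<n. indicator {t. shifted \<beta> a x (\<lambda>_. t) j} (y j)) \<partial>noise n)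
    = (\<Prod>j<n. \<integral>t. (indicator {exp (\<beta> * (x j - a j))..} t :: real) \<partial>exp1_dist)"
    unfolding noise_def eq by (rule integral_PiM_prod) (auto intro: prob_space_exp1 intro!: integrable_real_indicator simp: E.emeasure_eq_measure)
  also have "\<dots> = (\<Prod>j<n. exp (- exp (\<beta> * (x j - a j))))"
    using exp1_tail by (intro prod.cong) auto
  also have "\<dots> = soft_ind n \<beta> a x" by (simp add: soft_ind_def exp_sum sum_negf[symmetric])
  finally show ?thesis by simp
qed

text \<open>For fixed noise \<open>y\<close> the mixture replaces \<open>soft_ind\<close> by the
  indicator of an orthant whose corner is moved by \<open>ln (y j) / \<beta>\<close>; Fubini
  exchanges the two averages.\<close>

lemma soft_ind_integral:
  assumes \<beta>: "0 < \<beta>" and p: "prob_space \<gamma>" and s: "sets \<gamma> = sets (Rp_meas n)"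
  defines "h \<equiv> \<lambda>a y. if \<forall>j<n. 0 < y j then measure \<gamma> (orthant n (\<lambda>j. a j + ln (y j) / \<beta>)) else 0"
  shows "(\<integral>x. soft_ind n \<beta> a x \<partial>\<gamma>) = (\<integral>y. h a y \<partial>noise n)" "integrable (noise n) (h a)"
proof -
  interpret g: prob_space \<gamma> by (rule p)
  interpret Y: prob_space "noise n" by (rule prob_space_noise)
  interpret P: pair_prob_space \<gamma> "noise n" ..
  have sY: "sets (noise n) = sets (Rp_meas n)"
    unfolding noise_def Rp_meas_def by (intro sets_PiM_cong) auto
  define F where "F x y = (\<Prod>j<n. indicator {t. shifted \<beta> a x (\<lambda>_. t) j} (y j) :: real)" for x y
  have Feq: "F x y = indicator {z. \<forall>j<n. shifted \<beta> a (fst z) (snd z) j} (x, y)" for x y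
    unfolding F_def by (auto simp: indicator_def shifted_def)
  have Fm: "case_prod F \<in> borel_measurable (\<gamma> \<Otimes>\<^sub>M noise n)"
  proof -
    have "(\<lambda>z. \<Prod>j<n. if 0 < snd z j \<and> fst z j \<le> a j + ln (snd z j) / \<beta> then 1 else 0 :: real) \<in> borel_measurable (\<gamma> \<Otimes>\<^sub>M noise n)"
    proof (rule borel_measurable_prod)
      fix j assume "j \<in> {..<n}"
      then have j: "j < n" by simp
      define u v where "u z = fst z j" and "v z = snd z j" for z :: "(nat \<Rightarrow> real) \<times> (nat \<Rightarrow> real)"
      have [measurable]: "u \<in> borel_measurable (\<gamma> \<Otimes>\<^sub>M noise n)"
        unfolding u_def[abs_def] by (rule measurable_compose[OF measurable_fst Rp_coordinate_measurable[OF s j]])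
      have [measurable]: "v \<in> borel_measurable (\<gamma> \<Otimes>\<^sub>M noise n)"
        unfolding v_def[abs_def] by (rule measurable_compose[OF measurable_snd Rp_coordinate_measurable[OF sY j]])
      have "(\<lambda>z. if 0 < v z \<and> u z \<le> a j + ln (v z) / \<beta> then 1 else 0 :: real) \<in> borel_measurable (\<gamma> \<Otimes>\<^sub>M noise n)"
        by measurable
      then show "(\<lambda>z. if 0 < snd z j \<and> fst z j \<le> a j + ln (snd z j) / \<beta> then 1 else 0 :: real) \<in> borel_measurable (\<gamma> \<Otimes>\<^sub>M noise n)"
        unfolding u_def v_def .
    qed
    moreover have "case_prod F = (\<lambda>z. \<Prod>j<n. if 0 < snd z j \<and> fst z j \<le> a j + ln (snd z j) / \<beta> then 1 else 0)"
      unfolding F_def split_def by (intro ext prod.cong) (auto simp: indicator_def shifted_def)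
    ultimately show ?thesis by simp
  qed
  have Fi: "integrable (\<gamma> \<Otimes>\<^sub>M noise n) (case_prod F)"
    using Fm by (intro P.integrable_const_bound[of _ 1]) (auto simp: Feq indicator_def)
  have in_h: "(\<integral>x. F x y \<partial>\<gamma>) = h a y" for y
  proof (cases "\<forall>j<n. 0 < y j")
    case True
    have "(\<integral>x. F x y \<partial>\<gamma>) = (\<integral>x. indicator (orthant n (\<lambda>j. a j + ln (y j) / \<beta>)) x \<partial>\<gamma>)"
      using True sets_eq_imp_space_eq[OF s]
      by (intro Bochner_Integration.integral_cong refl) (auto simp: Feq indicator_def shifted_def orthant_def)
    also have "\<dots> = h a y" using True sets_eq_imp_space_eq[OF s] unfolding h_def by (simp add: orthant_def Int_def conj_ac)
    finally show ?thesis .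
  next
    case False
    then have "F x y = 0" for x by (auto simp: Feq indicator_def shifted_def)
    then show ?thesis using False by (auto simp: h_def)
  qed
  have "(\<integral>x. soft_ind n \<beta> a x \<partial>\<gamma>) = (\<integral>x. \<integral>y. F x y \<partial>noise n \<partial>\<gamma>)"
    by (simp add: soft_ind_mixture[OF \<beta>] F_def)
  also have "\<dots> = (\<integral>y. \<integral>x. F x y \<partial>\<gamma> \<partial>noise n)"
    by (rule P.Fubini_integral[OF Fi, symmetric])
  finally show "(\<integral>x. soft_ind n \<beta> a x \<partial>\<gamma>) = (\<integral>y. h a y \<partial>noise n)" by (simp add: in_h)
  show "integrable (noise n) (h a)" using P.integrable_snd[OF Fi] by (simp add: in_h)
qed

text \<open>The orthant bound is uniform in the corner and so survives averaging over random
  corners; in particular it does not depend on \<open>\<beta>\<close>.\<close>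

lemma soft_anticoncentration:
  assumes g: "gaussian_law n \<gamma> C" and sym: "\<And>j k. C j k = C k j"
    and diag: "\<And>j. j < n \<Longrightarrow> \<sigma>\<^sup>2 \<le> C j j" and sig: "0 < \<sigma>"
    and L: "1 \<le> L" "real n \<le> exp (L\<^sup>2 / 2)" and h: "0 \<le> h" and \<beta>: "0 < \<beta>"
  shows "(\<integral>x. soft_ind n \<beta> (\<lambda>j. a j + h) x \<partial>\<gamma>) - (\<integral>x. soft_ind n \<beta> a x \<partial>\<gamma>) \<le> 20 * L * h / \<sigma>"
proof -
  note G = gaussian_lawD[OF g]
  interpret Y: prob_space "noise n" by (rule prob_space_noise)
  note I = soft_ind_integral[OF \<beta> G(1,2)]
  let ?H = "\<lambda>a y. if \<forall>j<n. 0 < y j then measure \<gamma> (orthant n (\<lambda>j. a j + ln (y j) / \<beta>)) else 0"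
  have "?H (\<lambda>j. a j + h) y - ?H a y \<le> 20 * L * h / \<sigma>" for y
  proof (cases "\<forall>j<n. 0 < y j")
    case True
    have "orthant n (\<lambda>j. a j + h + ln (y j) / \<beta> - h) = orthant n (\<lambda>j. a j + ln (y j) / \<beta>)" by simp
    then show ?thesis
      using nazarov_anticoncentration[OF g sym diag sig L h, of "\<lambda>j. a j + h + ln (y j) / \<beta>"] True by simp
  next
    case False
    show ?thesis unfolding if_not_P[OF False] using L h sig by simp
  qed
  then have "(\<integral>y. ?H (\<lambda>j. a j + h) y - ?H a y \<partial>noise n) \<le> (\<integral>y. 20 * L * h / \<sigma> \<partial>noise n)"
    using I(2) by (intro integral_mono Bochner_Integration.integrable_diff) auto
  then show ?thesis
    unfolding I(1) using I(2)[of "\<lambda>j. a j + h"] I(2)[of a] by (simp add: Y.prob_space)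
qed

section \<open>Gaussian comparison\<close>

lemma power_times_exp_minus_le: "0 \<le> (s::real) \<Longrightarrow> s ^ k * exp (- s) \<le> fact k"
proof -
  assume s: "0 \<le> s"
  have "s ^ k / fact k \<le> (\<Sum>n. s ^ n / fact n)"
    using s summable_exp[of s] by (intro sum_le_suminf[of _ "{k}", simplified]) (auto simp: field_simps)
  then have "s ^ k / fact k \<le> exp s" by (simp add: exp_def divide_inverse mult.commute)
  then show ?thesis by (simp add: exp_minus field_simps)
qed

section \<open>Taylor expansion of the smoothed indicator\<close>

definition wt :: "real \<Rightarrow> (nat \<Rightarrow> real) \<Rightarrow> (nat \<Rightarrow> real) \<Rightarrow> nat \<Rightarrow> real" where
  "wt \<beta> a w j = exp (\<beta> * (w j - a j))"

definition soft_hess :: "nat \<Rightarrow> real \<Rightarrow> (nat \<Rightarrow> real) \<Rightarrow> (nat \<Rightarrow> real) \<Rightarrow> nat \<Rightarrow> nat \<Rightarrow> real" where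
  "soft_hess n \<beta> a w j k = \<beta>\<^sup>2 * (wt \<beta> a w j * wt \<beta> a w k - (if j = k then wt \<beta> a w j else 0)) * soft_ind n \<beta> a w"

lemma soft_ind_wt: "soft_ind n \<beta> a w = exp (- (\<Sum>j<n. wt \<beta> a w j))"
  by (simp add: soft_ind_def wt_def)

text \<open>On the segment from \<open>w\<close> to \<open>w + y\<close> the derivatives are
  \<open>exp (- S 0)\<close> times polynomials in the weighted power sums \<open>S i\<close>, and
  \<open>S i\<close> is at most \<open>Y^i * S 0\<close> in modulus. As
  \<open>s^k * exp (- s)\<close> is bounded, the third derivative has a bound that depends neither
  on \<open>w\<close> nor on \<open>a\<close>; its factor 13, divided by 3!, is below 3.\<close>

lemma soft_ind_taylor:
  assumes \<beta>: "0 < \<beta>"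
  shows "\<bar>soft_ind n \<beta> a (\<lambda>j. w j + y j) - soft_ind n \<beta> a w + \<beta> * (\<Sum>j<n. y j * wt \<beta> a w j) * soft_ind n \<beta> a w
     - (\<Sum>j<n. \<Sum>k<n. y j * y k * soft_hess n \<beta> a w j k) / 2\<bar> \<le> 3 * \<beta> ^ 3 * (\<Sum>j<n. \<bar>y j\<bar>) ^ 3"
proof -
  define S where "S i t = (\<Sum>j<n. y j ^ i * wt \<beta> a (\<lambda>j. w j + t * y j) j)" for i t
  have dS: "(S i has_real_derivative \<beta> * S (Suc i) t) (at t)" for i t
    unfolding S_def wt_def
    by (auto intro!: derivative_eq_intros simp: sum_distrib_left mult_ac)
  define h0 h1 h2 h3 where "h0 t = exp (- S 0 t)"
    and "h1 t = - \<beta> * S 1 t * exp (- S 0 t)"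
    and "h2 t = \<beta>\<^sup>2 * ((S 1 t)\<^sup>2 - S 2 t) * exp (- S 0 t)"
    and "h3 t = \<beta> ^ 3 * (3 * S 1 t * S 2 t - S 3 t - (S 1 t) ^ 3) * exp (- S 0 t)" for t
  have d0: "(h0 has_real_derivative h1 t) (at t)" for t
    unfolding h0_def h1_def by (auto intro!: derivative_eq_intros dS)
  have d1: "(h1 has_real_derivative h2 t) (at t)" for t
    unfolding h1_def h2_def
    by (auto intro!: derivative_eq_intros dS simp: numeral_2_eq_2 algebra_simps power2_eq_square)
  have d2: "(h2 has_real_derivative h3 t) (at t)" for t
    unfolding h2_def h3_def
    by (auto intro!: derivative_eq_intros dS simp: numeral_2_eq_2 numeral_3_eq_3 algebra_simps)
  define diff where "diff m = (if m = 0 then h0 else if m = 1 then h1 else if m = 2 then h2 else h3)" for m :: nat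
  have "\<exists>t>0. t < 1 \<and> h0 1 = (\<Sum>m<3. diff m 0 / fact m * 1 ^ m) + diff 3 t / fact 3 * 1 ^ 3"
  proof (rule Maclaurin)
    show "\<forall>m t. m < 3 \<and> 0 \<le> t \<and> t \<le> 1 \<longrightarrow> (diff m has_real_derivative diff (Suc m) t) (at t)"
    proof (intro allI impI)
      fix m :: nat and t :: real assume "m < 3 \<and> 0 \<le> t \<and> t \<le> 1"
      then consider "m = 0" | "m = 1" | "m = 2" by linarith
      then show "(diff m has_real_derivative diff (Suc m) t) (at t)"
        by cases (simp_all add: diff_def d0 d1 d2)
    qed
  qed (auto simp: diff_def)
  then obtain t where t: "h0 1 = h0 0 + h1 0 + h2 0 / 2 + h3 t / 6"
    by (auto simp: diff_def numeral_3_eq_3 fact_numeral)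
  define Y where "Y = (\<Sum>j<n. \<bar>y j\<bar>)"
  have yY: "\<bar>y j\<bar> \<le> Y" if "j < n" for j unfolding Y_def using that by (intro member_le_sum) auto
  have Y0: "0 \<le> Y" unfolding Y_def by (intro sum_nonneg) auto
  have S0: "0 \<le> S 0 t" unfolding S_def wt_def by (auto intro!: sum_nonneg)
  have SY: "\<bar>S i t\<bar> \<le> Y ^ i * S 0 t" for i
  proof -
    have "\<bar>S i t\<bar> \<le> (\<Sum>j<n. \<bar>y j\<bar> ^ i * wt \<beta> a (\<lambda>j. w j + t * y j) j)"
      unfolding S_def by (intro order_trans[OF sum_abs] sum_mono) (auto simp: abs_mult power_abs wt_def)
    also have "\<dots> \<le> (\<Sum>j<n. Y ^ i * wt \<beta> a (\<lambda>j. w j + t * y j) j)"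
      using yY by (intro sum_mono mult_right_mono power_mono) (auto simp: wt_def)
    finally show ?thesis by (simp add: S_def sum_distrib_left)
  qed
  have b12: "\<bar>S 1 t * S 2 t\<bar> \<le> Y ^ 3 * (S 0 t) ^ 2"
    using mult_mono[OF SY[of 1] SY[of 2]] Y0 S0 by (simp add: abs_mult power2_eq_square power3_eq_cube mult_ac)
  have b111: "\<bar>(S 1 t) ^ 3\<bar> \<le> Y ^ 3 * (S 0 t) ^ 3"
    using power_mono[OF SY[of 1], of 3] by (simp add: power_abs power_mult_distrib)
  have "\<bar>3 * S 1 t * S 2 t - S 3 t - (S 1 t) ^ 3\<bar> \<le> Y ^ 3 * (3 * (S 0 t) ^ 2 + S 0 t + (S 0 t) ^ 3)"
    using b12 b111 SY[of 3] by (simp add: distrib_left abs_le_iff)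
  then have "\<bar>h3 t\<bar> \<le> \<beta> ^ 3 * (Y ^ 3 * (3 * (S 0 t) ^ 2 + S 0 t + (S 0 t) ^ 3)) * exp (- S 0 t)"
    unfolding h3_def abs_mult using \<beta> by (intro mult_mono) (auto simp: abs_mult)
  also have "\<dots> = \<beta> ^ 3 * Y ^ 3 * (3 * ((S 0 t) ^ 2 * exp (- S 0 t)) + (S 0 t) ^ 1 * exp (- S 0 t) + (S 0 t) ^ 3 * exp (- S 0 t))"
    by (simp add: algebra_simps)
  also have "\<dots> \<le> \<beta> ^ 3 * Y ^ 3 * (3 * 2 + 1 + 6)"
    using power_times_exp_minus_le[OF S0, of 1] power_times_exp_minus_le[OF S0, of 2] power_times_exp_minus_le[OF S0, of 3] \<beta> Y0
    by (intro mult_left_mono) (auto simp: fact_numeral)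
  finally have h3: "\<bar>h3 t\<bar> \<le> 13 * (\<beta> ^ 3 * Y ^ 3)" by simp
  have e0: "h0 1 = soft_ind n \<beta> a (\<lambda>j. w j + y j)" "h0 0 = soft_ind n \<beta> a w"
    unfolding h0_def S_def soft_ind_wt by (simp_all add: wt_def)
  have e1: "h1 0 = - \<beta> * (\<Sum>j<n. y j * wt \<beta> a w j) * soft_ind n \<beta> a w"
    unfolding h1_def S_def soft_ind_wt by (simp add: wt_def)
  have e2: "h2 0 = (\<Sum>j<n. \<Sum>k<n. y j * y k * soft_hess n \<beta> a w j k)"
  proof -
    have "(\<Sum>j<n. \<Sum>k<n. y j * y k * soft_hess n \<beta> a w j k)
      = (\<Sum>j<n. \<Sum>k<n. \<beta>\<^sup>2 * soft_ind n \<beta> a w * ((y j * wt \<beta> a w j) * (y k * wt \<beta> a w k)))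
       - (\<Sum>j<n. \<Sum>k<n. if k = j then \<beta>\<^sup>2 * soft_ind n \<beta> a w * (y j ^ 2 * wt \<beta> a w j) else 0)"
      unfolding soft_hess_def sum_subtractf[symmetric]
      by (intro sum.cong refl) (auto simp: algebra_simps power2_eq_square)
    also have "\<dots> = \<beta>\<^sup>2 * soft_ind n \<beta> a w * ((\<Sum>j<n. y j * wt \<beta> a w j) * (\<Sum>k<n. y k * wt \<beta> a w k))
        - \<beta>\<^sup>2 * soft_ind n \<beta> a w * (\<Sum>j<n. y j ^ 2 * wt \<beta> a w j)"
      unfolding sum_product by (simp add: sum_distrib_left)
    also have "\<dots> = h2 0"
      unfolding h2_def S_def soft_ind_wt by (simp add: wt_def power2_eq_square algebra_simps)
    finally show ?thesis by simp
  qed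
  have "soft_ind n \<beta> a (\<lambda>j. w j + y j) - soft_ind n \<beta> a w + \<beta> * (\<Sum>j<n. y j * wt \<beta> a w j) * soft_ind n \<beta> a w
     - (\<Sum>j<n. \<Sum>k<n. y j * y k * soft_hess n \<beta> a w j k) / 2 = h3 t / 6"
    using t unfolding e0 e1 e2 by simp
  then show ?thesis using h3 Y0 \<beta> unfolding Y_def[symmetric] by simp
qed

text \<open>Let \<open>s\<close> be the sum of the weights. The left side is at most
  \<open>\<beta>^2 * (s^2 + s) * exp (- s)\<close>. Moving the corner by
  \<open>ln 2 / \<beta>\<close> halves \<open>s\<close>, so the right side is a multiple of
  \<open>exp (- s / 2) - exp (- s)\<close>. The two are linked by
  \<open>s^2 + s <= 8 * (exp (s / 2) - 1)\<close>, a quadratic Taylor bound.\<close>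

lemma soft_hess_sum_le:
  assumes \<beta>: "0 < \<beta>"
  shows "(\<Sum>j<n. \<Sum>k<n. \<bar>soft_hess n \<beta> a w j k\<bar>)
    \<le> 8 * \<beta>\<^sup>2 * (soft_ind n \<beta> (\<lambda>j. a j + ln 2 / \<beta>) w - soft_ind n \<beta> a w)"
proof -
  define s where "s = (\<Sum>j<n. wt \<beta> a w j)"
  have w0: "0 \<le> wt \<beta> a w j" for j by (simp add: wt_def)
  have s0: "0 \<le> s" unfolding s_def using w0 by (intro sum_nonneg) auto
  have "\<bar>soft_hess n \<beta> a w j k\<bar> \<le> \<beta>\<^sup>2 * exp (- s) * (wt \<beta> a w j * wt \<beta> a w k + (if k = j then wt \<beta> a w j else 0))" for j k
  proof -
    have "0 \<le> wt \<beta> a w j * wt \<beta> a w k" "0 \<le> wt \<beta> a w j" using w0 by auto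
    then have "\<bar>wt \<beta> a w j * wt \<beta> a w k - (if j = k then wt \<beta> a w j else 0)\<bar>
       \<le> wt \<beta> a w j * wt \<beta> a w k + (if k = j then wt \<beta> a w j else 0)" by (auto simp: abs_le_iff)
    then have "\<beta>\<^sup>2 * exp (- s) * \<bar>wt \<beta> a w j * wt \<beta> a w k - (if j = k then wt \<beta> a w j else 0)\<bar>
       \<le> \<beta>\<^sup>2 * exp (- s) * (wt \<beta> a w j * wt \<beta> a w k + (if k = j then wt \<beta> a w j else 0))"
      by (intro mult_left_mono) auto
    then show ?thesis unfolding soft_hess_def soft_ind_wt s_def[symmetric] by (simp add: abs_mult mult_ac)
  qed
  then have "(\<Sum>j<n. \<Sum>k<n. \<bar>soft_hess n \<beta> a w j k\<bar>)
    \<le> (\<Sum>j<n. \<Sum>k<n. \<beta>\<^sup>2 * exp (- s) * (wt \<beta> a w j * wt \<beta> a w k + (if k = j then wt \<beta> a w j else 0)))"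
    by (intro sum_mono) auto
  also have "\<dots> = \<beta>\<^sup>2 * exp (- s) * (s * s + s)"
    unfolding s_def sum_product by (simp add: sum_distrib_left[symmetric] sum.distrib)
  also have "\<dots> \<le> \<beta>\<^sup>2 * (8 * (exp (- s / 2) - exp (- s)))"
  proof -
    have q: "1 + s / 2 + (s / 2)\<^sup>2 / 2 \<le> exp (s / 2)"
      using exp_lower_Taylor_quadratic[of "s/2"] s0 by simp
    have "exp (- s) * (s * s + s) \<le> exp (- s) * (8 * (exp (s / 2) - 1))"
      using q s0 by (intro mult_left_mono) (auto simp: power2_eq_square)
    also have "\<dots> = 8 * (exp (- s) * exp (s / 2) - exp (- s))" by (simp add: algebra_simps)
    also have "exp (- s) * exp (s / 2) = exp (- s / 2)" by (simp add: exp_add[symmetric])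
    finally show ?thesis by (simp add: mult.assoc mult_left_mono)
  qed
  also have "exp (- s / 2) = soft_ind n \<beta> (\<lambda>j. a j + ln 2 / \<beta>) w"
  proof -
    have w2: "wt \<beta> (\<lambda>j. a j + ln 2 / \<beta>) w j = wt \<beta> a w j / 2" for j
      using \<beta> by (simp add: wt_def algebra_simps exp_diff exp_add)
    show ?thesis unfolding soft_ind_wt s_def w2 sum_divide_distrib[symmetric] by simp
  qed
  also have "exp (- s) = soft_ind n \<beta> a w" unfolding soft_ind_wt s_def ..
  finally show ?thesis by (simp add: algebra_simps)
qed

lemma sum_abs_cube_le: "(\<Sum>j<n. \<bar>x j :: real\<bar>) ^ 3 \<le> real n ^ 3 * (\<Sum>j<n. \<bar>x j\<bar> ^ 3)"
proof (cases "n = 0")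
  case False
  define M where "M = Max ((\<lambda>j. \<bar>x j\<bar>) ` {..<n})"
  have "M \<in> (\<lambda>j. \<bar>x j\<bar>) ` {..<n}" unfolding M_def using False by (intro Max_in) auto
  then obtain k where k: "k < n" "M = \<bar>x k\<bar>" by auto
  have "\<bar>x j\<bar> \<le> M" if "j < n" for j unfolding M_def using that by (intro Max_ge) auto
  then have "(\<Sum>j<n. \<bar>x j\<bar>) \<le> (\<Sum>j<n. M)" by (intro sum_mono) auto
  then have "(\<Sum>j<n. \<bar>x j\<bar>) ^ 3 \<le> (real n * M) ^ 3" by (intro power_mono) (auto intro: sum_nonneg)
  also have "\<dots> = real n ^ 3 * \<bar>x k\<bar> ^ 3" by (simp add: power_mult_distrib k)
  also have "\<bar>x k\<bar> ^ 3 \<le> (\<Sum>j<n. \<bar>x j\<bar> ^ 3)" using k by (intro member_le_sum) auto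
  finally show ?thesis by (simp add: mult_left_mono)
qed simp

text \<open>Finiteness is all that matters, since this moment multiplies an error that tends to 0
  for fixed \<open>n\<close>; the crude factor \<open>n^3\<close> in the preceding bound does no
  harm.\<close>

lemma gaussian_third_moment:
  assumes g: "gaussian_law n \<gamma> C"
  shows "integrable \<gamma> (\<lambda>x. (\<Sum>j<n. \<bar>x j\<bar>) ^ 3)"
proof (rule Bochner_Integration.integrable_bound)
  show "integrable \<gamma> (\<lambda>x. real n ^ 3 * (\<Sum>j<n. \<bar>x j\<bar> ^ 3))"
  proof (intro integrable_mult_right Bochner_Integration.integrable_sum)
    fix j assume "j \<in> {..<n}"
    then show "integrable \<gamma> (\<lambda>x. \<bar>x j\<bar> ^ 3)"
      using gaussian_law_moments(1)[OF g, of "basis_vec j" 3] by (simp add: ip_basis_vec)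
  qed
  show "(\<lambda>x. (\<Sum>j<n. \<bar>x j\<bar>) ^ 3) \<in> borel_measurable \<gamma>"
    using Rp_coordinate_measurable[OF gaussian_lawD(2)[OF g]]
    by (intro borel_measurable_power borel_measurable_sum borel_measurable_abs) auto
  show "AE x in \<gamma>. norm ((\<Sum>j<n. \<bar>x j\<bar>) ^ 3) \<le> norm (real n ^ 3 * (\<Sum>j<n. \<bar>x j\<bar> ^ 3))"
    using sum_abs_cube_le[of _ n] by (auto simp: sum_nonneg power_abs)
qed

lemma soft_ind_restrict: "soft_ind n \<beta> a (restrict x {..<n}) = soft_ind n \<beta> a x"
  by (simp add: soft_ind_def)

text \<open>The linear term has mean 0 and the quadratic term turns into the covariance, so
  \<open>C\<close> enters only at order \<open>\<delta>^2\<close>.\<close>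

lemma soft_ind_gaussian_expansion:
  assumes g: "gaussian_law n \<gamma> C" and sym: "\<And>j k. C j k = C k j" and \<beta>: "0 < \<beta>" and \<delta>: "0 \<le> \<delta>"
  shows "\<bar>(\<integral>x. soft_ind n \<beta> a (\<lambda>j. w j + \<delta> * x j) \<partial>\<gamma>) - soft_ind n \<beta> a w
     - \<delta>\<^sup>2 / 2 * (\<Sum>j<n. \<Sum>k<n. C j k * soft_hess n \<beta> a w j k)\<bar>
     \<le> 3 * \<beta> ^ 3 * \<delta> ^ 3 * (\<integral>x. (\<Sum>j<n. \<bar>x j\<bar>) ^ 3 \<partial>\<gamma>)"
proof -
  note G = gaussian_lawD[OF g]
  interpret g: prob_space \<gamma> by (rule G)
  define f where "f x = soft_ind n \<beta> a (\<lambda>j. w j + \<delta> * x j)" for x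
  define l where "l x = \<beta> * (\<Sum>j<n. (\<delta> * x j) * wt \<beta> a w j) * soft_ind n \<beta> a w" for x
  define q where "q x = (\<Sum>j<n. \<Sum>k<n. (\<delta> * x j) * (\<delta> * x k) * soft_hess n \<beta> a w j k)" for x
  have fm: "f \<in> borel_measurable \<gamma>"
    unfolding f_def[abs_def] soft_ind_def using Rp_coordinate_measurable[OF G(2)]
    by (intro borel_measurable_exp measurable_compose[OF _ borel_measurable_exp] borel_measurable_uminus borel_measurable_sum
      borel_measurable_times borel_measurable_diff borel_measurable_add borel_measurable_const) auto
  have fi: "integrable \<gamma> f"
    using fm soft_ind_bounds by (intro g.integrable_const_bound[of _ 1]) (auto simp: f_def)
  have x1: "integrable \<gamma> (\<lambda>x. x j)" "(\<integral>x. x j \<partial>\<gamma>) = 0" if "j < n" for j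
    using gaussian_law_moments(2)[OF g, of "basis_vec j" 1] gaussian_law_moments(3)[OF g, of "basis_vec j"] that
    by (simp_all add: ip_basis_vec)
  have li: "integrable \<gamma> l" "(\<integral>x. l x \<partial>\<gamma>) = 0"
    unfolding l_def using x1 by (auto intro!: Bochner_Integration.integrable_sum sum.neutral simp: Bochner_Integration.integral_sum)
  have x2: "integrable \<gamma> (\<lambda>x. (\<delta> * x j) * (\<delta> * x k) * c)" "(\<integral>x. (\<delta> * x j) * (\<delta> * x k) * c \<partial>\<gamma>) = \<delta>\<^sup>2 * (C j k * c)"
    if "j < n" "k < n" for j k c
  proof -
    have e: "(\<lambda>x. (\<delta> * x j) * (\<delta> * x k) * c) = (\<lambda>x. (\<delta>\<^sup>2 * c) * (x j * x k))"
      by (simp add: fun_eq_iff power2_eq_square mult_ac)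
    show "integrable \<gamma> (\<lambda>x. (\<delta> * x j) * (\<delta> * x k) * c)" "(\<integral>x. (\<delta> * x j) * (\<delta> * x k) * c \<partial>\<gamma>) = \<delta>\<^sup>2 * (C j k * c)"
      unfolding e integral_mult_right_zero using gaussian_law_covariance[OF g sym that]
      by (auto intro!: integrable_mult_right)
  qed
  have qi: "integrable \<gamma> q" unfolding q_def using x2 by (intro Bochner_Integration.integrable_sum) auto
  have qv: "(\<integral>x. q x \<partial>\<gamma>) = \<delta>\<^sup>2 * (\<Sum>j<n. \<Sum>k<n. C j k * soft_hess n \<beta> a w j k)"
  proof -
    have "(\<integral>x. q x \<partial>\<gamma>) = (\<Sum>j<n. \<integral>x. (\<Sum>k<n. (\<delta> * x j) * (\<delta> * x k) * soft_hess n \<beta> a w j k) \<partial>\<gamma>)"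
      unfolding q_def using x2(1) by (intro Bochner_Integration.integral_sum Bochner_Integration.integrable_sum) auto
    also have "\<dots> = (\<Sum>j<n. \<Sum>k<n. \<integral>x. (\<delta> * x j) * (\<delta> * x k) * soft_hess n \<beta> a w j k \<partial>\<gamma>)"
      using x2(1) by (intro sum.cong refl Bochner_Integration.integral_sum) auto
    also have "\<dots> = (\<Sum>j<n. \<Sum>k<n. \<delta>\<^sup>2 * (C j k * soft_hess n \<beta> a w j k))"
      using x2(2) by (intro sum.cong refl) auto
    finally show ?thesis by (simp add: sum_distrib_left)
  qed
  have "\<bar>\<integral>x. f x - soft_ind n \<beta> a w + l x - q x / 2 \<partial>\<gamma>\<bar> \<le> (\<integral>x. \<bar>f x - soft_ind n \<beta> a w + l x - q x / 2\<bar> \<partial>\<gamma>)"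
    by (rule integral_abs_bound)
  also have "\<dots> \<le> (\<integral>x. 3 * \<beta> ^ 3 * \<delta> ^ 3 * (\<Sum>j<n. \<bar>x j\<bar>) ^ 3 \<partial>\<gamma>)"
  proof (rule integral_mono)
    show "integrable \<gamma> (\<lambda>x. \<bar>f x - soft_ind n \<beta> a w + l x - q x / 2\<bar>)"
      using fi li(1) qi by (intro integrable_abs Bochner_Integration.integrable_add Bochner_Integration.integrable_diff) auto
    show "integrable \<gamma> (\<lambda>x. 3 * \<beta> ^ 3 * \<delta> ^ 3 * (\<Sum>j<n. \<bar>x j\<bar>) ^ 3)"
      using gaussian_third_moment[OF g] by simp
    fix x
    have "(\<Sum>j<n. \<bar>\<delta> * x j\<bar>) ^ 3 = \<delta> ^ 3 * (\<Sum>j<n. \<bar>x j\<bar>) ^ 3"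
      using \<delta> by (simp add: abs_mult sum_distrib_left[symmetric] power_mult_distrib)
    then show "\<bar>f x - soft_ind n \<beta> a w + l x - q x / 2\<bar> \<le> 3 * \<beta> ^ 3 * \<delta> ^ 3 * (\<Sum>j<n. \<bar>x j\<bar>) ^ 3"
      using soft_ind_taylor[OF \<beta>, of n a w "\<lambda>j. \<delta> * x j"] unfolding f_def l_def q_def by simp
  qed
  also have "\<dots> = 3 * \<beta> ^ 3 * \<delta> ^ 3 * (\<integral>x. (\<Sum>j<n. \<bar>x j\<bar>) ^ 3 \<partial>\<gamma>)" by simp
  also have "(\<integral>x. f x - soft_ind n \<beta> a w + l x - q x / 2 \<partial>\<gamma>) = (\<integral>x. f x \<partial>\<gamma>) - soft_ind n \<beta> a w + 0 - (\<integral>x. q x \<partial>\<gamma>) / 2"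
    using fi li qi by (simp add: g.prob_space)
  finally show ?thesis unfolding qv f_def by simp
qed

section \<open>Exchange of two Gaussian laws in small increments\<close>

lemma lindeberg_swap_pointwise:
  assumes g: "gaussian_law n \<gamma> C" "gaussian_law n \<gamma>' C'" and sym: "\<And>j k. C j k = C k j" "\<And>j k. C' j k = C' k j"
    and \<beta>: "0 < \<beta>" and \<delta>: "0 \<le> \<delta>" and \<Delta>: "\<And>j k. j < n \<Longrightarrow> k < n \<Longrightarrow> \<bar>C j k - C' j k\<bar> \<le> \<Delta>"
  shows "\<bar>(\<integral>x. soft_ind n \<beta> a (\<lambda>j. w j + \<delta> * x j) \<partial>\<gamma>) - (\<integral>x. soft_ind n \<beta> a (\<lambda>j. w j + \<delta> * x j) \<partial>\<gamma>')\<bar>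
     \<le> 4 * \<delta>\<^sup>2 * \<Delta> * \<beta>\<^sup>2 * (soft_ind n \<beta> (\<lambda>j. a j + ln 2 / \<beta>) w - soft_ind n \<beta> a w)
       + 3 * \<beta> ^ 3 * \<delta> ^ 3 * ((\<integral>x. (\<Sum>j<n. \<bar>x j\<bar>) ^ 3 \<partial>\<gamma>) + (\<integral>x. (\<Sum>j<n. \<bar>x j\<bar>) ^ 3 \<partial>\<gamma>'))"
proof (cases "n = 0")
  case True
  then show ?thesis using gaussian_lawD(1)[OF g(1)] gaussian_lawD(1)[OF g(2)]
    by (simp add: soft_ind_def prob_space.prob_space)
next
  case False
  \<comment> \<open>Read off at the indices 0 and 0, which is why dimension 0 is treated
    apart.\<close>
  then have \<Delta>0: "0 \<le> \<Delta>" using \<Delta>[of 0 0] by linarith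
  define H where "H D = (\<Sum>j<n. \<Sum>k<n. D j k * soft_hess n \<beta> a w j k)" for D
  \<comment> \<open>The terms of order 0 and 1 agree for both increments. What is left pairs
    \<open>C - C'\<close> with the Hessian: the largest entry of the first times the absolute sum of
    the second.\<close>
  have "\<bar>H C - H C'\<bar> = \<bar>\<Sum>j<n. \<Sum>k<n. (C j k - C' j k) * soft_hess n \<beta> a w j k\<bar>"
    unfolding H_def by (simp add: sum_subtractf[symmetric] left_diff_distrib)
  also have "\<dots> \<le> (\<Sum>j<n. \<Sum>k<n. \<Delta> * \<bar>soft_hess n \<beta> a w j k\<bar>)"
    using \<Delta> by (intro order_trans[OF sum_abs] sum_mono order_trans[OF sum_abs]) (auto simp: abs_mult intro!: mult_right_mono)
  also have "\<dots> = \<Delta> * (\<Sum>j<n. \<Sum>k<n. \<bar>soft_hess n \<beta> a w j k\<bar>)" by (simp add: sum_distrib_left)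
  also have "\<dots> \<le> \<Delta> * (8 * \<beta>\<^sup>2 * (soft_ind n \<beta> (\<lambda>j. a j + ln 2 / \<beta>) w - soft_ind n \<beta> a w))"
    by (rule mult_left_mono[OF soft_hess_sum_le[OF \<beta>] \<Delta>0])
  finally have "\<delta>\<^sup>2 / 2 * \<bar>H C - H C'\<bar> \<le> \<delta>\<^sup>2 / 2 * (\<Delta> * (8 * \<beta>\<^sup>2 * (soft_ind n \<beta> (\<lambda>j. a j + ln 2 / \<beta>) w - soft_ind n \<beta> a w)))"
    by (intro mult_left_mono) auto
  moreover have "\<delta>\<^sup>2 / 2 * \<bar>H C - H C'\<bar> = \<bar>\<delta>\<^sup>2 / 2 * H C - \<delta>\<^sup>2 / 2 * H C'\<bar>"
  proof -
    have "\<delta>\<^sup>2 / 2 * H C - \<delta>\<^sup>2 / 2 * H C' = \<delta>\<^sup>2 / 2 * (H C - H C')" by (simp only: right_diff_distrib)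
    then show ?thesis by (simp only: abs_mult) simp
  qed
  ultimately have "\<bar>\<delta>\<^sup>2 / 2 * H C - \<delta>\<^sup>2 / 2 * H C'\<bar> \<le> 4 * \<delta>\<^sup>2 * \<Delta> * \<beta>\<^sup>2 * (soft_ind n \<beta> (\<lambda>j. a j + ln 2 / \<beta>) w - soft_ind n \<beta> a w)"
    by (simp add: mult_ac)
  then show ?thesis
    using soft_ind_gaussian_expansion[OF g(1) sym(1) \<beta> \<delta>, of a w] soft_ind_gaussian_expansion[OF g(2) sym(2) \<beta> \<delta>, of a w]
    unfolding H_def[symmetric] distrib_left by linarith
qed

lemma integral_gaussian_lin_comb:
  assumes g: "gaussian_law n \<gamma> C" "gaussian_law n \<gamma>' C'" "gaussian_law n \<eta> D"
    and eq: "\<And>v. quad_form n D v = c\<^sup>2 * quad_form n C v + d\<^sup>2 * quad_form n C' v"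
  shows "(\<integral>x. soft_ind n \<beta> a x \<partial>\<eta>) = (\<integral>x. \<integral>y. soft_ind n \<beta> a (\<lambda>j. c * x j + d * y j) \<partial>\<gamma>' \<partial>\<gamma>)"
    "integrable \<gamma> (\<lambda>x. \<integral>y. soft_ind n \<beta> a (\<lambda>j. c * x j + d * y j) \<partial>\<gamma>')"
proof -
  note G = gaussian_lawD[OF g(1)] and G' = gaussian_lawD[OF g(2)]
  interpret g: prob_space \<gamma> by (rule G)
  interpret g': prob_space \<gamma>' by (rule G')
  interpret P: pair_prob_space \<gamma> \<gamma>' ..
  have m: "(\<lambda>(x, y). lin_comb n c d x y) \<in> measurable (\<gamma> \<Otimes>\<^sub>M \<gamma>') (Rp_meas n)"
    by (rule lin_comb_measurable[OF G(2) G'(2)])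
  have sm: "soft_ind n \<beta> a \<in> borel_measurable (Rp_meas n)" by (rule soft_ind_measurable) simp
  have e: "soft_ind n \<beta> a (lin_comb n c d x y) = soft_ind n \<beta> a (\<lambda>j. c * x j + d * y j)" for x y
    unfolding lin_comb_def by (rule soft_ind_restrict)
  have i: "integrable (\<gamma> \<Otimes>\<^sub>M \<gamma>') (\<lambda>(x, y). soft_ind n \<beta> a (\<lambda>j. c * x j + d * y j))"
  proof (rule P.integrable_const_bound[of _ 1])
    show "(\<lambda>(x, y). soft_ind n \<beta> a (\<lambda>j. c * x j + d * y j)) \<in> borel_measurable (\<gamma> \<Otimes>\<^sub>M \<gamma>')"
      using measurable_compose[OF m sm] by (simp add: split_def e)
  qed (auto simp: soft_ind_bounds)
  have "\<eta> = distr (\<gamma> \<Otimes>\<^sub>M \<gamma>') (Rp_meas n) (\<lambda>(x, y). lin_comb n c d x y)"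
  proof (rule gaussian_law_unique[OF g(3) gaussian_law_lin_comb[OF g(1,2)]])
    fix v show "quad_form n D v = quad_form n (\<lambda>j k. c\<^sup>2 * C j k + d\<^sup>2 * C' j k) v"
      unfolding eq unfolding quad_form_def by (simp add: sum_distrib_left sum.distrib[symmetric] algebra_simps)
  qed
  then have "(\<integral>x. soft_ind n \<beta> a x \<partial>\<eta>) = (\<integral>z. (\<lambda>(x, y). soft_ind n \<beta> a (\<lambda>j. c * x j + d * y j)) z \<partial>(\<gamma> \<Otimes>\<^sub>M \<gamma>'))"
    using m sm by (simp add: integral_distr split_def e)
  also have "\<dots> = (\<integral>x. \<integral>y. soft_ind n \<beta> a (\<lambda>j. c * x j + d * y j) \<partial>\<gamma>' \<partial>\<gamma>)"
    by (rule P.integral_fst[OF i, symmetric])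
  finally show "(\<integral>x. soft_ind n \<beta> a x \<partial>\<eta>) = (\<integral>x. \<integral>y. soft_ind n \<beta> a (\<lambda>j. c * x j + d * y j) \<partial>\<gamma>' \<partial>\<gamma>)" .
  show "integrable \<gamma> (\<lambda>x. \<integral>y. soft_ind n \<beta> a (\<lambda>j. c * x j + d * y j) \<partial>\<gamma>')"
    by (rule P.integrable_fst[OF i])
qed

text \<open>Absorbs two factors of the next proof: \<open>ln 2\<close> from the shift
  \<open>ln 2 / \<beta>\<close>, and \<open>sqrt 2\<close> from the lower bound
  \<open>\<sigma> / sqrt 2\<close> for the standard deviations of the intermediate laws.\<close>

lemma sqrt2_ln2: "sqrt 2 * ln 2 \<le> (1::real)"
proof -
  have "sqrt 2 \<le> sqrt ((36/25)\<^sup>2 :: real)" by (intro real_sqrt_le_mono) (simp add: power2_eq_square)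
  then have "sqrt 2 * ln 2 \<le> 36 / 25 * (25 / 36 :: real)" using ln2_le_25_over_36 by (intro mult_mono) auto
  then show ?thesis by simp
qed

theorem soft_ind_comparison:
  assumes g: "gaussian_law n \<gamma> C" "gaussian_law n \<gamma>' C'" and sym: "\<And>j k. C j k = C k j" "\<And>j k. C' j k = C' k j"
    and diag: "\<And>j. j < n \<Longrightarrow> \<sigma>\<^sup>2 \<le> C j j" "\<And>j. j < n \<Longrightarrow> \<sigma>\<^sup>2 \<le> C' j j" and sig: "0 < \<sigma>"
    and L: "1 \<le> L" "real n \<le> exp (L\<^sup>2 / 2)" and \<beta>: "0 < \<beta>"
    and \<Delta>: "\<And>j k. j < n \<Longrightarrow> k < n \<Longrightarrow> \<bar>C j k - C' j k\<bar> \<le> \<Delta>" "0 \<le> \<Delta>"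
  shows "\<bar>(\<integral>x. soft_ind n \<beta> a x \<partial>\<gamma>) - (\<integral>x. soft_ind n \<beta> a x \<partial>\<gamma>')\<bar> \<le> 80 * \<Delta> * \<beta> * L / \<sigma>"
proof -
  define M where "M = (\<integral>x. (\<Sum>j<n. \<bar>x j\<bar>) ^ 3 \<partial>\<gamma>) + (\<integral>x. (\<Sum>j<n. \<bar>x j\<bar>) ^ 3 \<partial>\<gamma>')"
  \<comment> \<open>Here \<open>N\<close> counts the increments into which the laws are divided, a
    free parameter unrelated to the sample size. The last summand, the only one that contains the
    third moments, vanishes as \<open>N\<close> grows.\<close>
  have main: "\<bar>(\<integral>x. soft_ind n \<beta> a x \<partial>\<gamma>) - (\<integral>x. soft_ind n \<beta> a x \<partial>\<gamma>')\<bar> \<le> 80 * \<Delta> * \<beta> * L / \<sigma> + 3 * \<beta> ^ 3 * M / sqrt (real N)"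
    if N: "2 \<le> N" for N
  proof -
    have N0: "0 < real N" using N by simp
    define cov where "cov s t = (\<lambda>j k. (sqrt s)\<^sup>2 * C j k + (sqrt t)\<^sup>2 * C' j k)" for s t
    define law where "law s t = distr (\<gamma> \<Otimes>\<^sub>M \<gamma>') (Rp_meas n) (\<lambda>(x, y). lin_comb n (sqrt s) (sqrt t) x y)" for s t
    have gl: "gaussian_law n (law s t) (cov s t)" for s t
      unfolding law_def cov_def by (rule gaussian_law_lin_comb[OF g])
    have qc: "quad_form n (cov s t) v = s * quad_form n C v + t * quad_form n C' v" if "0 \<le> s" "0 \<le> t" for s t v
      unfolding quad_form_def cov_def using that by (simp add: sum_distrib_left sum.distrib[symmetric] algebra_simps)
    \<comment> \<open>Stage \<open>k\<close> consists of \<open>k\<close> increments of the first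
      law and \<open>N - k\<close> of the second. The increments themselves need not be constructed,
      since a Gaussian law is determined by its covariance.\<close>
    define \<phi> where "\<phi> k = (\<integral>x. soft_ind n \<beta> a x \<partial>law (real k / real N) (real (N - k) / real N))" for k
    define \<delta> where "\<delta> = 1 / sqrt (real N)"
    have \<delta>2: "\<delta>\<^sup>2 = 1 / real N" using N0 by (simp add: \<delta>_def power_divide)
    have \<delta>0: "0 \<le> \<delta>" by (simp add: \<delta>_def)
    define E where "E = 80 * \<Delta> * \<beta> * L / \<sigma> / real N + 3 * \<beta> ^ 3 * \<delta> ^ 3 * M"
    have step: "\<bar>\<phi> (Suc k) - \<phi> k\<bar> \<le> E" if k: "k < N" for k
    proof -
      \<comment> \<open>The common part of the stages \<open>k\<close> and \<open>k + 1\<close>: it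
        has one increment less, and adding one of either kind gives the two stages.\<close>
      define W where "W = law (real k / real N) (real (N - Suc k) / real N)"
      define CW where "CW = cov (real k / real N) (real (N - Suc k) / real N)"
      have gW: "gaussian_law n W CW" unfolding W_def CW_def by (rule gl)
      interpret W: prob_space W using gaussian_lawD(1)[OF gW] .
      have s: "real (Suc k) / real N = real k / real N + 1 / real N" "real (N - k) / real N = real (N - Suc k) / real N + 1 / real N"
        using k by (simp_all add: add_divide_distrib of_nat_diff diff_divide_distrib)
      have qW: "quad_form n CW v = real k / real N * quad_form n C v + real (N - Suc k) / real N * quad_form n C' v" for v
        unfolding CW_def by (rule qc) auto
      have q1: "quad_form n (cov (real (Suc k) / real N) (real (N - Suc k) / real N)) v = 1\<^sup>2 * quad_form n CW v + \<delta>\<^sup>2 * quad_form n C v" for v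
      proof -
        have "quad_form n (cov (real (Suc k) / real N) (real (N - Suc k) / real N)) v
          = real (Suc k) / real N * quad_form n C v + real (N - Suc k) / real N * quad_form n C' v" by (rule qc) auto
        then show ?thesis unfolding qW s \<delta>2 by (simp add: distrib_right)
      qed
      have q2: "quad_form n (cov (real k / real N) (real (N - k) / real N)) v = 1\<^sup>2 * quad_form n CW v + \<delta>\<^sup>2 * quad_form n C' v" for v
      proof -
        have "quad_form n (cov (real k / real N) (real (N - k) / real N)) v
          = real k / real N * quad_form n C v + real (N - k) / real N * quad_form n C' v" by (rule qc) auto
        then show ?thesis unfolding qW s \<delta>2 by (simp add: distrib_right)
      qed
      note A1 = integral_gaussian_lin_comb[OF gW g(1) gl q1] and A2 = integral_gaussian_lin_comb[OF gW g(2) gl q2]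
      have e1: "\<phi> (Suc k) = (\<integral>w. \<integral>x. soft_ind n \<beta> a (\<lambda>j. 1 * w j + \<delta> * x j) \<partial>\<gamma> \<partial>W)"
        unfolding \<phi>_def by (rule A1(1))
      have e2: "\<phi> k = (\<integral>w. \<integral>x. soft_ind n \<beta> a (\<lambda>j. 1 * w j + \<delta> * x j) \<partial>\<gamma>' \<partial>W)"
        unfolding \<phi>_def by (rule A2(1))
      note i1 = A1(2)[of \<beta> a] and i2 = A2(2)[of \<beta> a]
      have si: "integrable W (soft_ind n \<beta> b)" for b
        using soft_ind_measurable[OF gaussian_lawD(2)[OF gW]] soft_ind_bounds
        by (intro W.integrable_const_bound[of _ 1]) auto
      define B where "B w = 4 * \<delta>\<^sup>2 * \<Delta> * \<beta>\<^sup>2 * (soft_ind n \<beta> (\<lambda>j. a j + ln 2 / \<beta>) w - soft_ind n \<beta> a w)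
         + 3 * \<beta> ^ 3 * \<delta> ^ 3 * M" for w
      have Bi: "integrable W B" unfolding B_def using si by auto
      have "\<bar>\<phi> (Suc k) - \<phi> k\<bar> = \<bar>\<integral>w. (\<integral>x. soft_ind n \<beta> a (\<lambda>j. 1 * w j + \<delta> * x j) \<partial>\<gamma>) - (\<integral>x. soft_ind n \<beta> a (\<lambda>j. 1 * w j + \<delta> * x j) \<partial>\<gamma>') \<partial>W\<bar>"
        unfolding e1 e2 using i1 i2 by simp
      also have "\<dots> \<le> (\<integral>w. \<bar>(\<integral>x. soft_ind n \<beta> a (\<lambda>j. 1 * w j + \<delta> * x j) \<partial>\<gamma>) - (\<integral>x. soft_ind n \<beta> a (\<lambda>j. 1 * w j + \<delta> * x j) \<partial>\<gamma>')\<bar> \<partial>W)"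
        by (rule integral_abs_bound)
      also have "\<dots> \<le> (\<integral>w. B w \<partial>W)"
      proof (rule integral_mono[OF _ Bi])
        show "integrable W (\<lambda>w. \<bar>(\<integral>x. soft_ind n \<beta> a (\<lambda>j. 1 * w j + \<delta> * x j) \<partial>\<gamma>) - (\<integral>x. soft_ind n \<beta> a (\<lambda>j. 1 * w j + \<delta> * x j) \<partial>\<gamma>')\<bar>)"
          using i1 i2 by (intro integrable_abs Bochner_Integration.integrable_diff)
      qed (use lindeberg_swap_pointwise[OF g sym \<beta> \<delta>0 \<Delta>(1)] in \<open>simp add: B_def M_def\<close>)
      also have "\<dots> = 4 * \<delta>\<^sup>2 * \<Delta> * \<beta>\<^sup>2 * ((\<integral>w. soft_ind n \<beta> (\<lambda>j. a j + ln 2 / \<beta>) w \<partial>W) - (\<integral>w. soft_ind n \<beta> a w \<partial>W)) + 3 * \<beta> ^ 3 * \<delta> ^ 3 * M"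
        unfolding B_def using si by (simp add: W.prob_space)
      also have "\<dots> \<le> 4 * \<delta>\<^sup>2 * \<Delta> * \<beta>\<^sup>2 * (20 * L * (ln 2 / \<beta>) / (\<sigma> / sqrt 2)) + 3 * \<beta> ^ 3 * \<delta> ^ 3 * M"
      proof (intro add_right_mono mult_left_mono soft_anticoncentration[OF gW _ _ _ L _ \<beta>])
        show "CW j k = CW k j" for j k unfolding CW_def cov_def using sym(1)[of j k] sym(2)[of j k] by simp
        \<comment> \<open>The weights in \<open>W\<close> sum to \<open>(N - 1) / N\<close>, which
          is at least 1/2 by \<open>2 <= N\<close>, so the variances stay above
          \<open>\<sigma>^2 / 2\<close> at every stage.\<close>
        fix j assume j: "j < n"
        have "(\<sigma> / sqrt 2)\<^sup>2 = \<sigma>\<^sup>2 / 2" by (simp add: power_divide)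
        also have "\<dots> \<le> \<sigma>\<^sup>2 * ((real N - 1) / real N)"
          using N mult_right_mono[of 2 "real N" "\<sigma>\<^sup>2"] by (simp add: field_simps)
        also have "(real N - 1) / real N = real k / real N + real (N - Suc k) / real N"
          using k by (simp add: of_nat_diff field_simps)
        also have "\<sigma>\<^sup>2 * (real k / real N + real (N - Suc k) / real N) \<le> CW j j"
          unfolding CW_def cov_def distrib_left using diag[OF j]
          by (intro add_mono) (auto simp: mult.commute[of "\<sigma>\<^sup>2"] intro!: mult_left_mono divide_right_mono)
        finally show "(\<sigma> / sqrt 2)\<^sup>2 \<le> CW j j" .
      qed (use sig \<Delta>(2) \<beta> in auto)
      also have "\<dots> = (sqrt 2 * ln 2) * (80 * \<Delta> * \<beta> * L / \<sigma> / real N) + 3 * \<beta> ^ 3 * \<delta> ^ 3 * M"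
        using \<beta> sig unfolding \<delta>2 by (simp add: field_simps power2_eq_square)
      also have "\<dots> \<le> 1 * (80 * \<Delta> * \<beta> * L / \<sigma> / real N) + 3 * \<beta> ^ 3 * \<delta> ^ 3 * M"
        using sqrt2_ln2 \<Delta>(2) \<beta> L sig by (intro add_right_mono mult_right_mono) auto
      finally show ?thesis by (simp add: E_def)
    qed
    have "\<bar>\<phi> N - \<phi> 0\<bar> = \<bar>\<Sum>k<N. \<phi> (Suc k) - \<phi> k\<bar>" by (simp add: sum_lessThan_telescope)
    also have "\<dots> \<le> (\<Sum>k<N. E)" using step by (intro order_trans[OF sum_abs] sum_mono) auto
    also have "\<dots> = 80 * \<Delta> * \<beta> * L / \<sigma> + 3 * \<beta> ^ 3 * M * (real N * \<delta> ^ 3)"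
      using N0 by (simp add: E_def distrib_left mult_ac)
    also have "real N * \<delta> ^ 3 = 1 / sqrt (real N)"
    proof -
      have "\<delta> ^ 3 = \<delta>\<^sup>2 * \<delta>" by (simp add: power3_eq_cube power2_eq_square)
      then show ?thesis using N0 unfolding \<delta>2 by (simp add: \<delta>_def)
    qed
    also have "\<phi> N = (\<integral>x. soft_ind n \<beta> a x \<partial>\<gamma>)"
    proof -
      have "law (real N / real N) (real (N - N) / real N) = \<gamma>"
        using N0 by (intro gaussian_law_unique[OF gl g(1)]) (simp add: qc)
      then show ?thesis by (simp add: \<phi>_def)
    qed
    also have "\<phi> 0 = (\<integral>x. soft_ind n \<beta> a x \<partial>\<gamma>')"
    proof -
      have "law (real 0 / real N) (real (N - 0) / real N) = \<gamma>'"
        using N0 by (intro gaussian_law_unique[OF gl g(2)]) (simp add: qc)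
      then show ?thesis by (simp add: \<phi>_def)
    qed
    finally show ?thesis by simp
  qed
  have "(\<lambda>N. 80 * \<Delta> * \<beta> * L / \<sigma> + 3 * \<beta> ^ 3 * M / sqrt (real N)) \<longlonglongrightarrow> 80 * \<Delta> * \<beta> * L / \<sigma> + 0"
    by (intro tendsto_add tendsto_const tendsto_divide_0[OF tendsto_const] filterlim_at_top_imp_at_infinity
        filterlim_compose[OF sqrt_at_top filterlim_real_sequentially])
  then show ?thesis
    by (intro LIMSEQ_le_const[of _ "80 * \<Delta> * \<beta> * L / \<sigma>"]) (auto intro!: exI[of _ 2] main)
qed

text \<open>Take the corner \<open>a + u\<close> with \<open>u = L^2 / \<beta>\<close>. The soft
  indicator is then close to 1 on the orthant of \<open>a\<close> and close to 0 off the orthant of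
  \<open>a + 2 u\<close>, up to \<open>exp (- L^2 / 2)\<close> in both cases. Anti-concentration
  under \<open>\<gamma>'\<close> pays for the way from \<open>a + 2 u\<close> down to
  \<open>a - \<epsilon>\<close>; the margin \<open>\<epsilon>\<close> is reserved for the gap
  between inner and outer polytope.\<close>

theorem orthant_comparison:
  assumes g: "gaussian_law n \<gamma> C" "gaussian_law n \<gamma>' C'" and sym: "\<And>j k. C j k = C k j" "\<And>j k. C' j k = C' k j"
    and diag: "\<And>j. j < n \<Longrightarrow> \<sigma>\<^sup>2 \<le> C j j" "\<And>j. j < n \<Longrightarrow> \<sigma>\<^sup>2 \<le> C' j j" and sig: "0 < \<sigma>"
    and L: "1 \<le> L" "real n \<le> exp (L\<^sup>2 / 2)" and \<beta>: "0 < \<beta>"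
    and \<Delta>: "\<And>j k. j < n \<Longrightarrow> k < n \<Longrightarrow> \<bar>C j k - C' j k\<bar> \<le> \<Delta>" "0 \<le> \<Delta>" and \<epsilon>: "0 \<le> \<epsilon>"
  shows "measure \<gamma> (orthant n a) \<le> measure \<gamma>' (orthant n (\<lambda>j. a j - \<epsilon>))
    + 80 * \<Delta> * \<beta> * L / \<sigma> + 20 * L * (\<epsilon> + 2 * L\<^sup>2 / \<beta>) / \<sigma> + 2 * exp (- L\<^sup>2 / 2)"
proof -
  note G = gaussian_lawD[OF g(1)] and G' = gaussian_lawD[OF g(2)]
  interpret g: prob_space \<gamma> by (rule G)
  interpret g': prob_space \<gamma>' by (rule G')
  define u where "u = L\<^sup>2 / \<beta>"
  have u0: "0 \<le> u" using \<beta> by (simp add: u_def)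
  let ?a = "\<lambda>j. a j + u"
  have om: "orthant n b \<in> sets \<gamma>" "orthant n b \<in> sets \<gamma>'" for b using orthant_sets G(2) G'(2) by simp_all
  have si: "integrable \<gamma> (soft_ind n \<beta> b)" "integrable \<gamma>' (soft_ind n \<beta> b)" for b
    using soft_ind_measurable[OF G(2)] soft_ind_measurable[OF G'(2)] soft_ind_bounds
    by (auto intro!: g.integrable_const_bound[of _ 1] g'.integrable_const_bound[of _ 1])
  have lower: "indicator (orthant n a) x \<le> soft_ind n \<beta> ?a x + exp (- L\<^sup>2 / 2)" for x
  proof (cases "x \<in> orthant n a")
    case True
    have "(\<Sum>j<n. exp (\<beta> * (x j - (a j + u)))) \<le> (\<Sum>j<n. exp (- L\<^sup>2))"
    proof (intro sum_mono)
      fix j assume "j \<in> {..<n}"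
      then have "\<beta> * (x j - (a j + u)) \<le> \<beta> * (- u)" using True \<beta> by (intro mult_left_mono) (auto simp: orthant_def)
      then show "exp (\<beta> * (x j - (a j + u))) \<le> exp (- L\<^sup>2)" using \<beta> by (simp add: u_def)
    qed
    also have "\<dots> \<le> exp (L\<^sup>2 / 2) * exp (- L\<^sup>2)" using L by simp
    also have "\<dots> = exp (- L\<^sup>2 / 2)" by (simp add: exp_add[symmetric])
    finally have "exp (- exp (- L\<^sup>2 / 2)) \<le> soft_ind n \<beta> ?a x" by (simp add: soft_ind_def)
    moreover have "1 + - exp (- L\<^sup>2 / 2) \<le> exp (- exp (- L\<^sup>2 / 2))" by (rule exp_ge_add_one_self)
    ultimately show ?thesis using True by simp
  qed (simp add: soft_ind_bounds add_nonneg_nonneg)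
  have upper: "soft_ind n \<beta> ?a x \<le> indicator (orthant n (\<lambda>j. a j + 2 * u)) x + exp (- L\<^sup>2 / 2)" if "x \<in> space (Rp_meas n)" for x
  proof (cases "x \<in> orthant n (\<lambda>j. a j + 2 * u)")
    case True
    then show ?thesis using soft_ind_bounds(2)[of n \<beta> ?a x] by (simp add: add_increasing2)
  next
    case False
    then have "\<not> (\<forall>j<n. x j \<le> a j + 2 * u)" using that by (simp add: orthant_def)
    then obtain j where j: "j < n" "a j + 2 * u < x j" by (auto simp: not_le)
    have "\<beta> * u \<le> \<beta> * (x j - (a j + u))" using j \<beta> by (intro mult_left_mono) auto
    then have "L\<^sup>2 \<le> \<beta> * (x j - (a j + u))" using \<beta> by (simp add: u_def)
    moreover have "1 + \<beta> * (x j - (a j + u)) \<le> exp (\<beta> * (x j - (a j + u)))" by (rule exp_ge_add_one_self)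
    moreover have "exp (\<beta> * (x j - (a j + u))) \<le> (\<Sum>j<n. exp (\<beta> * (x j - (a j + u))))"
      using j by (intro member_le_sum) auto
    moreover have "0 \<le> L\<^sup>2" by simp
    ultimately have "L\<^sup>2 / 2 \<le> (\<Sum>j<n. exp (\<beta> * (x j - (a j + u))))" by linarith
    then show ?thesis by (simp add: soft_ind_def add_increasing)
  qed
  have "measure \<gamma> (orthant n a) = (\<integral>x. indicator (orthant n a) x \<partial>\<gamma>)"
    using G(3) by (simp add: orthant_def Int_def conj_ac)
  also have "\<dots> \<le> (\<integral>x. soft_ind n \<beta> ?a x + exp (- L\<^sup>2 / 2) \<partial>\<gamma>)"
    using lower om si by (intro integral_mono) (auto simp: g.emeasure_eq_measure)
  also have "\<dots> = (\<integral>x. soft_ind n \<beta> ?a x \<partial>\<gamma>) + exp (- L\<^sup>2 / 2)" using si by (simp add: g.prob_space)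
  also have "(\<integral>x. soft_ind n \<beta> ?a x \<partial>\<gamma>) \<le> (\<integral>x. soft_ind n \<beta> ?a x \<partial>\<gamma>') + 80 * \<Delta> * \<beta> * L / \<sigma>"
    using soft_ind_comparison[OF g sym diag sig L \<beta> \<Delta>, of ?a] by linarith
  also have "(\<integral>x. soft_ind n \<beta> ?a x \<partial>\<gamma>') \<le> (\<integral>x. indicator (orthant n (\<lambda>j. a j + 2 * u)) x + exp (- L\<^sup>2 / 2) \<partial>\<gamma>')"
    using upper om si G'(3) by (intro integral_mono) (auto simp: g'.emeasure_eq_measure)
  also have "\<dots> = (\<integral>x. indicator (orthant n (\<lambda>j. a j + 2 * u)) x \<partial>\<gamma>') + exp (- L\<^sup>2 / 2)"
    using om by (subst Bochner_Integration.integral_add) (auto simp: g'.emeasure_eq_measure g'.prob_space)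
  also have "(\<integral>x. indicator (orthant n (\<lambda>j. a j + 2 * u)) x \<partial>\<gamma>') = measure \<gamma>' (orthant n (\<lambda>j. a j + 2 * u))"
    using G'(3) by (simp add: orthant_def Int_def conj_ac)
  also have "\<dots> \<le> measure \<gamma>' (orthant n (\<lambda>j. a j - \<epsilon>)) + 20 * L * (\<epsilon> + 2 * u) / \<sigma>"
    using nazarov_anticoncentration[OF g(2) sym(2) diag(2) sig L, of "\<epsilon> + 2 * u" "\<lambda>j. a j + 2 * u"] \<epsilon> u0
    by (simp add: algebra_simps)
  finally show ?thesis by (simp add: u_def)
qed

section \<open>Finite nets for sparse convex sets\<close>

lemma compact_simplex: "compact {w :: nat \<Rightarrow> real. (\<forall>i. w i \<in> (if i < n then {0..1} else {0})) \<and> (\<Sum>i<n. w i) = 1}"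
proof -
  \<comment> \<open>Coordinates from \<open>n\<close> on are pinned at 0, because the compactness
    comes from Tychonoff's theorem in the space of all functions on the naturals.\<close>
  define B where "B i = (if i < n then {0..1} else {0::real})" for i
  have "compactin (product_topology (\<lambda>_. euclidean) UNIV) (PiE UNIV B)"
    unfolding compactin_PiE by (auto simp: B_def)
  then have "compact (PiE UNIV B)" by (simp add: euclidean_product_topology)
  moreover have "closed {w :: nat \<Rightarrow> real. (\<Sum>i<n. w i) = 1}"
    by (intro closed_Collect_eq continuous_on_sum continuous_on_const continuous_on_product_coordinates)
  ultimately have "compact (PiE UNIV B \<inter> {w. (\<Sum>i<n. w i) = 1})" by (rule compact_Int_closed)
  moreover have "PiE UNIV B \<inter> {w. (\<Sum>i<n. w i) = 1} = {w. (\<forall>i. w i \<in> B i) \<and> (\<Sum>i<n. w i) = 1}" by auto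
  ultimately show ?thesis by (simp add: B_def)
qed

text \<open>The normal of the separating hyperplane is the difference between the point and its nearest
  point in the convex hull.\<close>

lemma finite_hull_separation:
  fixes y :: "nat \<Rightarrow> nat \<Rightarrow> real" and x :: "nat \<Rightarrow> real"
  assumes n: "0 < n" and fin: "finite J"
    and out: "\<And>w. (\<And>i. i < n \<Longrightarrow> 0 \<le> w i) \<Longrightarrow> (\<Sum>i<n. w i) = 1 \<Longrightarrow> \<exists>j\<in>J. x j \<noteq> (\<Sum>i<n. w i * y i j)"
  shows "\<exists>u. (\<forall>j. j \<notin> J \<longrightarrow> u j = 0) \<and> (\<Sum>j\<in>J. (u j)\<^sup>2) = 1 \<and> (\<forall>i<n. (\<Sum>j\<in>J. u j * y i j) \<le> (\<Sum>j\<in>J. u j * x j))"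
proof -
  define K where "K = {w :: nat \<Rightarrow> real. (\<forall>i. w i \<in> (if i < n then {0..1} else {0})) \<and> (\<Sum>i<n. w i) = 1}"
  define z where "z w j = x j - (\<Sum>i<n. w i * y i j)" for w :: "nat \<Rightarrow> real" and j
  define Q where "Q w = (\<Sum>j\<in>J. (z w j)\<^sup>2)" for w
  have K1: "(\<lambda>k. if k = i then 1 else 0) \<in> K" if "i < n" for i
    using that by (auto simp: K_def)
  have "continuous_on K Q"
    unfolding Q_def z_def
    by (intro continuous_on_sum continuous_on_power continuous_on_diff continuous_on_const continuous_on_mult
        continuous_on_subset[OF continuous_on_product_coordinates]) auto
  moreover have "K \<noteq> {}" using K1[OF n] by auto
  ultimately obtain w where w: "w \<in> K" "\<And>w'. w' \<in> K \<Longrightarrow> Q w \<le> Q w'"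
    using continuous_attains_inf[of K Q] compact_simplex[of n] unfolding K_def[symmetric] by auto
  have "\<exists>j\<in>J. z w j \<noteq> 0" using out[of w] w(1) by (auto simp: K_def z_def split: if_splits)
  then have Qpos: "0 < Q w" unfolding Q_def using fin by (metis (no_types, lifting) sum_nonneg_eq_0_iff zero_le_power2 power_eq_0_iff less_le sum_nonneg)
  define c where "c i = (\<Sum>j\<in>J. z w j * ((\<Sum>k<n. w k * y k j) - y i j))" for i
  have c0: "0 \<le> c i" if i: "i < n" for i
  proof (rule ccontr)
    assume neg: "\<not> 0 \<le> c i"
    define d where "d = (\<Sum>j\<in>J. ((\<Sum>k<n. w k * y k j) - y i j)\<^sup>2)"
    have d0: "0 \<le> d" unfolding d_def by (intro sum_nonneg) auto
    \<comment> \<open>Moving the minimiser \<open>w\<close> by \<open>t\<close> towards the vertex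
      \<open>i\<close> of the simplex stays in \<open>K\<close> and changes the squared distance by
      this quadratic, which therefore cannot be negative.\<close>
    have ineq: "0 \<le> 2 * t * c i + t\<^sup>2 * d" if t: "0 \<le> t" "t \<le> 1" for t
    proof -
      define w' where "w' k = (1 - t) * w k + t * (if k = i then 1 else 0)" for k
      have s: "(\<Sum>k<n. w' k * a k) = (1 - t) * (\<Sum>k<n. w k * a k) + t * a i" for a :: "nat \<Rightarrow> real"
        using i by (simp add: w'_def distrib_right sum.distrib mult.assoc sum_distrib_left[symmetric] if_distrib[of "\<lambda>c. c * _"] cong: if_cong)
      have "w' \<in> K"
      proof -
        have "w' k \<in> (if k < n then {0..1} else {0})" for k
          using w(1) t i convex_bound_le[of "w k" 1 "if k = i then 1 else 0" "1 - t" t]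
          by (auto simp: K_def w'_def split: if_splits)
        moreover have "(\<Sum>k<n. w' k) = 1" using s[of "\<lambda>_. 1"] w(1) by (simp add: K_def)
        ultimately show ?thesis by (simp add: K_def)
      qed
      then have "Q w \<le> Q w'" by (rule w(2))
      also have "z w' j = z w j + t * ((\<Sum>k<n. w k * y k j) - y i j)" for j
        unfolding z_def s by (simp add: algebra_simps)
      then have "Q w' = Q w + 2 * t * c i + t\<^sup>2 * d"
      proof -
        define D where "D j = (\<Sum>k<n. w k * y k j) - y i j" for j
        assume e: "\<And>j. z w' j = z w j + t * ((\<Sum>k<n. w k * y k j) - y i j)"
        have "(z w' j)\<^sup>2 = (z w j)\<^sup>2 + 2 * t * (z w j * D j) + t\<^sup>2 * (D j)\<^sup>2" for j
          unfolding e[of j, folded D_def] by (simp add: power2_eq_square algebra_simps)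
        then have "Q w' = (\<Sum>j\<in>J. (z w j)\<^sup>2 + 2 * t * (z w j * D j) + t\<^sup>2 * (D j)\<^sup>2)"
          unfolding Q_def by simp
        then show ?thesis
          unfolding Q_def c_def d_def D_def[symmetric] by (simp add: sum.distrib sum_distrib_left)
      qed
      finally show ?thesis by simp
    qed
    \<comment> \<open>So small that the linear term beats \<open>t^2 * d\<close>; the
      \<open>+ 1\<close> makes the denominator positive.\<close>
    define t where "t = min 1 (- c i / (d + 1))"
    have "t \<le> - c i / (d + 1)" by (simp add: t_def)
    then have t3: "t * (d + 1) \<le> - c i" using d0 by (subst (asm) pos_le_divide_eq) auto
    have "0 < - c i / (d + 1)" using neg d0 by (intro divide_pos_pos) auto
    then have t: "0 < t" "t \<le> 1" "t * (d + 1) \<le> - c i" using t3 by (auto simp: t_def)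
    have "0 \<le> t * (2 * c i + t * d)" using ineq[of t] t by (simp add: power2_eq_square algebra_simps)
    then have "0 \<le> 2 * c i + t * d" using t(1) by (simp add: zero_le_mult_iff)
    then show False using t neg by (simp add: distrib_left)
  qed
  define u where "u j = (if j \<in> J then z w j / sqrt (Q w) else 0)" for j
  have sQ: "0 < sqrt (Q w)" using Qpos by simp
  have "(\<Sum>j\<in>J. (u j)\<^sup>2) = Q w / Q w"
  proof -
    have "(\<Sum>j\<in>J. (u j)\<^sup>2) = (\<Sum>j\<in>J. (z w j)\<^sup>2 / Q w)" using Qpos by (simp add: u_def power_divide)
    also have "\<dots> = (\<Sum>j\<in>J. (z w j)\<^sup>2) / Q w" by (rule sum_divide_distrib[symmetric])
    finally show ?thesis by (simp add: Q_def)
  qed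
  moreover have "(\<Sum>j\<in>J. u j * y i j) \<le> (\<Sum>j\<in>J. u j * x j)" if i: "i < n" for i
  proof -
    \<comment> \<open>On \<open>J\<close>, \<open>x - y i\<close> is \<open>z w\<close> plus the
      difference between the nearest point and \<open>y i\<close>; pairing with \<open>z w\<close>
      gives \<open>Q w\<close> and \<open>c i\<close>.\<close>
    have "(\<Sum>j\<in>J. z w j * x j) - (\<Sum>j\<in>J. z w j * y i j) = c i + Q w"
      unfolding c_def Q_def sum_subtractf[symmetric] sum.distrib[symmetric]
      by (intro sum.cong) (auto simp: z_def power2_eq_square algebra_simps)
    then have "(\<Sum>j\<in>J. z w j * y i j) \<le> (\<Sum>j\<in>J. z w j * x j)" using c0[OF i] Qpos by linarith
    then have "(\<Sum>j\<in>J. z w j * y i j) / sqrt (Q w) \<le> (\<Sum>j\<in>J. z w j * x j) / sqrt (Q w)"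
      using sQ by (intro divide_right_mono) auto
    then show ?thesis by (simp add: u_def sum_divide_distrib)
  qed
  ultimately show ?thesis using Qpos by (intro exI[of _ u]) (auto simp: u_def)
qed

text \<open>\<open>ind_supp\<close> compares only points that differ in a single coordinate. The
  hybrids \<open>h k\<close> lead from \<open>x\<close> to \<open>x'\<close> by one coordinate at a
  time: a coordinate in the support does not change at all, and a change in any other one does not
  affect membership.\<close>

lemma ind_supp_cong:
  assumes x: "x \<in> space (Rp_meas p)" "x' \<in> space (Rp_meas p)" and eq: "\<And>j. j \<in> ind_supp p A \<Longrightarrow> x j = x' j"
  shows "x \<in> A \<longleftrightarrow> x' \<in> A"
proof -
  define h where "h k j = (if j < k then x' j else x j)" for k j
  have hs: "h k \<in> space (Rp_meas p)" for k
    using x by (auto simp: h_def space_Rp_meas PiE_iff extensional_def)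
  have "h k \<in> A \<longleftrightarrow> x \<in> A" if "k \<le> p" for k using that
  proof (induction k)
    case 0 have "h 0 = x" by (simp add: h_def fun_eq_iff)
    then show ?case by simp
  next
    case (Suc k)
    have d: "h (Suc k) j = h k j" if "j \<noteq> k" for j using that by (auto simp: h_def)
    have "h (Suc k) \<in> A \<longleftrightarrow> h k \<in> A"
    proof (cases "k \<in> ind_supp p A")
      case True
      then have "h (Suc k) = h k" using eq[OF True] by (auto simp: h_def fun_eq_iff less_Suc_eq)
      then show ?thesis by simp
    next
      case False
      moreover have "k \<in> {..<p}" using Suc.prems by simp
      ultimately have "\<forall>w\<in>space (Rp_meas p). \<forall>w'\<in>space (Rp_meas p). (\<forall>j\<in>{..<p}. j \<noteq> k \<longrightarrow> w j = w' j) \<longrightarrow> (w \<in> A) = (w' \<in> A)"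
        unfolding ind_supp_def by blast
      then show ?thesis using hs[of k] hs[of "Suc k"] d by blast
    qed
    then show ?case using Suc by simp
  qed
  from this[of p] have "h p \<in> A \<longleftrightarrow> x \<in> A" by simp
  moreover have "h p = x'" using x by (auto simp: h_def fun_eq_iff space_Rp_meas PiE_iff extensional_def)
  ultimately show ?thesis by simp
qed

lemma convex_p_combination:
  fixes n :: nat
  assumes c: "convex_p p A"
  shows "\<lbrakk>\<And>i. i < n \<Longrightarrow> y i \<in> A; \<And>i. i < n \<Longrightarrow> 0 \<le> w i; (\<Sum>i<n. w i) = (1::real)\<rbrakk>
    \<Longrightarrow> restrict (\<lambda>j. \<Sum>i<n. w i * y i j) {..<p} \<in> A"
proof (induction n arbitrary: w)
  case 0 then show ?case by simp
next
  case (Suc n)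
  have sp: "y n \<in> space (Rp_meas p)" using c Suc.prems(1)[of n] by (auto simp: convex_p_def)
  have s: "(\<Sum>i<n. w i) = 1 - w n" using Suc.prems(3) by simp
  have wn: "0 \<le> w n" "w n \<le> 1" using Suc.prems(2) s sum_nonneg[of "{..<n}" w] by (auto simp: less_Suc_eq)
  show ?case
  proof (cases "w n = 1")
    case True
    then have "\<forall>i\<in>{..<n}. w i = 0" using s Suc.prems(2) by (subst sum_nonneg_eq_0_iff[symmetric]) auto
    then have "(\<lambda>j. \<Sum>i<Suc n. w i * y i j) = y n" using True by (simp add: fun_eq_iff)
    moreover have "restrict (y n) {..<p} = y n"
      using sp by (auto simp: space_Rp_meas PiE_iff extensional_def fun_eq_iff)
    ultimately show ?thesis using Suc.prems(1)[of n] by simp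
  next
    case False
    then have t: "0 < 1 - w n" using wn by simp
    define v where "v = restrict (\<lambda>j. \<Sum>i<n. (w i / (1 - w n)) * y i j) {..<p}"
    have "v \<in> A" unfolding v_def
      using Suc.prems t s by (intro Suc.IH) (auto simp: sum_divide_distrib[symmetric])
    then have "restrict (\<lambda>j. (1 - w n) * v j + w n * y n j) {..<p} \<in> A"
      using c Suc.prems(1)[of n] wn unfolding convex_p_def by auto
    moreover have "(1 - w n) * v j = (\<Sum>i<n. w i * y i j)" if "j < p" for j
      using that t by (simp add: v_def sum_distrib_left)
    then have "restrict (\<lambda>j. (1 - w n) * v j + w n * y n j) {..<p} = restrict (\<lambda>j. \<Sum>i<Suc n. w i * y i j) {..<p}"
      by (auto simp: fun_eq_iff restrict_def)
    ultimately show ?thesis by (simp only:)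
  qed
qed

text \<open>Grid points have half-integer coordinates on \<open>J\<close>, so that the support of a net vector is
  exactly \<open>J\<close>; the moment hypotheses are only available for such vectors.\<close>

definition grid_pt :: "nat \<Rightarrow> (nat \<Rightarrow> int) \<Rightarrow> nat \<Rightarrow> real" where
  "grid_pt M k j = (real_of_int (k j) + 1 / 2) / real M"

definition net_vec :: "nat \<Rightarrow> nat \<Rightarrow> nat set \<Rightarrow> (nat \<Rightarrow> int) \<Rightarrow> nat \<Rightarrow> real" where
  "net_vec p M J k = restrict (\<lambda>j. if j \<in> J then grid_pt M k j / L2_set (grid_pt M k) J else 0) {..<p}"

text \<open>The empty support is left out because it carries no unit vector. The range of the
  integers contains the floor of \<open>M * u\<close> for every \<open>u\<close> in
  \<open>[-1, 1]\<close>.\<close>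

definition net :: "nat \<Rightarrow> nat \<Rightarrow> nat set set \<Rightarrow> (nat \<Rightarrow> real) set" where
  "net p M I = (\<Union>J\<in>I - {{}}. net_vec p M J ` (J \<rightarrow>\<^sub>E {- int M..int M}))"

lemma grid_pt_nonzero: "0 < M \<Longrightarrow> grid_pt M k j \<noteq> 0"
proof -
  assume "0 < M"
  have "2 * k j + 1 \<noteq> 0" by presburger
  then have "real_of_int (2 * k j + 1) \<noteq> 0" by linarith
  then show ?thesis using \<open>0 < M\<close> by (simp add: grid_pt_def)
qed

lemma L2_grid_pos: "0 < M \<Longrightarrow> finite J \<Longrightarrow> J \<noteq> {} \<Longrightarrow> 0 < L2_set (grid_pt M k) J"
  using grid_pt_nonzero[of M k] by (metis L2_set_eq_0_iff L2_set_nonneg all_not_in_conv less_le)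

lemma net_unit_sphere:
  assumes M: "0 < M" and I: "\<And>J. J \<in> I \<Longrightarrow> J \<subseteq> {..<p}" and v: "v \<in> net p M I"
  shows "v \<in> unit_sphere p" "vsupp p v \<in> I"
proof -
  obtain J k where J: "J \<in> I" "J \<noteq> {}" "v = net_vec p M J k" using v by (auto simp: net_def)
  have fin: "finite J" using I[OF J(1)] finite_subset by blast
  have pos: "0 < L2_set (grid_pt M k) J" by (rule L2_grid_pos[OF M fin J(2)])
  have "vsupp p v = J" using I[OF J(1)] grid_pt_nonzero[OF M] pos
    by (auto simp: vsupp_def J(3) net_vec_def)
  then show "vsupp p v \<in> I" using J by simp
  have sq: "(L2_set (grid_pt M k) J)\<^sup>2 = (\<Sum>j\<in>J. (grid_pt M k j)\<^sup>2)"
    unfolding L2_set_def by (simp add: sum_nonneg)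
  have "ip p v v = (\<Sum>j\<in>{..<p}. if j \<in> J then (grid_pt M k j)\<^sup>2 / (L2_set (grid_pt M k) J)\<^sup>2 else 0)"
    unfolding ip_def J(3) net_vec_def by (intro sum.cong) (auto simp: power2_eq_square)
  also have "\<dots> = (\<Sum>j\<in>J. (grid_pt M k j)\<^sup>2 / (L2_set (grid_pt M k) J)\<^sup>2)"
    using I[OF J(1)] by (subst sum.inter_restrict[symmetric]) (auto simp: Int_absorb1)
  also have "\<dots> = 1" using pos by (simp add: sum_divide_distrib[symmetric] sq[symmetric])
  finally have "ip p v v = 1" .
  then show "v \<in> unit_sphere p" by (simp add: unit_sphere_def space_Rp_meas J(3) net_vec_def)
qed

text \<open>On a singleton, normalising a positive number gives exactly 1. Through these members the
  hypotheses about net vectors reach single coordinates, in particular their variances.\<close>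

lemma basis_vec_net:
  assumes "j < p" "{j} \<in> I" "0 < M"
  shows "restrict (basis_vec j) {..<p} \<in> net p M I"
proof -
  let ?k = "restrict (\<lambda>_. 0) {j} :: nat \<Rightarrow> int"
  have "0 < grid_pt M ?k j" using assms by (simp add: grid_pt_def)
  then have "restrict (basis_vec j) {..<p} = net_vec p M {j} ?k"
    using assms by (auto simp: net_vec_def fun_eq_iff basis_vec_def L2_set_def)
  moreover have "?k \<in> {j} \<rightarrow>\<^sub>E {- int M..int M}" by auto
  ultimately show ?thesis using assms unfolding net_def by blast
qed

text \<open>A nonempty set of at most \<open>s\<close> indices is the image of a function from
  \<open>{..<s}\<close> to \<open>{..<p}\<close>, so there are at most \<open>p^s\<close> supports;
  on each of them a coordinate has \<open>2 * M + 1\<close> possible values.\<close>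

lemma net_finite_card:
  assumes I: "\<And>J. J \<in> I \<Longrightarrow> J \<subseteq> {..<p} \<and> card J \<le> s" and s: "1 \<le> s"
  shows "finite (net p M I)" "card (net p M I) \<le> (p * (2 * M + 1)) ^ s"
proof -
  have sub: "I - {{}} \<subseteq> (\<lambda>f. f ` {..<s}) ` ({..<s} \<rightarrow>\<^sub>E {..<p})"
  proof
    fix J assume J: "J \<in> I - {{}}"
    then have f: "finite J" "J \<subseteq> {..<p}" "card J \<le> s" "J \<noteq> {}" using I[of J] finite_subset by blast+
    obtain e where e: "bij_betw e {0..<card J} J" using ex_bij_betw_nat_finite[OF f(1)] by blast
    obtain j0 where j0: "j0 \<in> J" using f by auto
    \<comment> \<open>Surplus arguments are sent to \<open>j0\<close>, so that sets with fewer than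
      \<open>s\<close> elements are reached too.\<close>
    define g where "g = restrict (\<lambda>i. if i < card J then e i else j0) {..<s}"
    have ei: "e i \<in> J" if "i < card J" for i using e that by (auto simp: bij_betw_def)
    have "g ` {..<s} = J"
    proof
      show "g ` {..<s} \<subseteq> J" using ei j0 by (auto simp: g_def)
      show "J \<subseteq> g ` {..<s}"
      proof
        fix j assume "j \<in> J"
        then have "j \<in> e ` {0..<card J}" using e by (simp add: bij_betw_def)
        then obtain i where "i < card J" "j = e i" by auto
        then show "j \<in> g ` {..<s}" using f(3) by (intro image_eqI[of _ _ i]) (auto simp: g_def)
      qed
    qed
    moreover have "g \<in> {..<s} \<rightarrow>\<^sub>E {..<p}"
      unfolding g_def using subsetD[OF f(2) j0] subsetD[OF f(2) ei] by auto
    ultimately show "J \<in> (\<lambda>f. f ` {..<s}) ` ({..<s} \<rightarrow>\<^sub>E {..<p})" by blast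
  qed
  have finE: "finite ({..<s} \<rightarrow>\<^sub>E {..<p})" by (intro finite_PiE) auto
  have finI: "finite (I - {{}})" using sub finE finite_surj by blast
  have "card (I - {{}}) \<le> card ({..<s} \<rightarrow>\<^sub>E {..<p})"
    by (rule order_trans[OF card_mono[OF finite_imageI[OF finE] sub] card_image_le[OF finE]])
  then have cI: "card (I - {{}}) \<le> p ^ s" by (simp add: card_PiE)
  have J: "finite J \<and> finite (J \<rightarrow>\<^sub>E {- int M..int M}) \<and> card (J \<rightarrow>\<^sub>E {- int M..int M}) \<le> (2 * M + 1) ^ s" if "J \<in> I" for J
  proof -
    have f: "finite J" using I[OF that] finite_subset by blast
    have "card (J \<rightarrow>\<^sub>E {- int M..int M}) = (2 * M + 1) ^ card J" using f by (simp add: card_PiE nat_add_distrib nat_mult_distrib)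
    also have "\<dots> \<le> (2 * M + 1) ^ s" using I[OF that] by (intro power_increasing) auto
    finally show ?thesis using f by (auto intro: finite_PiE)
  qed
  show "finite (net p M I)" unfolding net_def using finI J by auto
  have "card (net p M I) \<le> (\<Sum>J\<in>I - {{}}. card (net_vec p M J ` (J \<rightarrow>\<^sub>E {- int M..int M})))"
    unfolding net_def using finI by (rule card_UN_le)
  also have "\<dots> \<le> (\<Sum>J\<in>I - {{}}. (2 * M + 1) ^ s)"
    using J by (intro sum_mono order_trans[OF card_image_le]) auto
  also have "\<dots> \<le> p ^ s * (2 * M + 1) ^ s" using cI by simp
  finally show "card (net p M I) \<le> (p * (2 * M + 1)) ^ s" by (simp only: power_mult_distrib)
qed

text \<open>Rounding to the grid costs at most \<open>1 / (2 M)\<close> per coordinate. So the norm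
  of the rounded vector differs from 1 by at most \<open>s / (2 M)\<close>, hence is at least 1/2 by
  \<open>s <= M\<close>, and dividing by it at most doubles the error \<open>s / M\<close>.\<close>

lemma net_approx:
  assumes J: "J \<in> I" "J \<subseteq> {..<p}" "card J \<le> s" "J \<noteq> {}" and M: "s \<le> M"
    and u: "(\<Sum>j\<in>J. (u j)\<^sup>2) = 1"
  shows "\<exists>v\<in>net p M I. (\<forall>j<p. j \<notin> J \<longrightarrow> v j = 0) \<and> (\<forall>j\<in>J. \<bar>v j - u j\<bar> \<le> 2 * real s / real M)"
proof -
  have fin: "finite J" using J(2) finite_subset by blast
  have "0 < card J" using fin J(4) by (simp add: card_gt_0_iff)
  then have s0: "0 < s" and M0: "0 < M" using J(3) M by auto
  have u1: "\<bar>u j\<bar> \<le> 1" if "j \<in> J" for j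
  proof -
    have "(u j)\<^sup>2 \<le> 1" using member_le_sum[of j J "\<lambda>j. (u j)\<^sup>2"] that fin u by auto
    then show ?thesis by (simp add: abs_square_le_1)
  qed
  define k where "k = restrict (\<lambda>j. \<lfloor>real M * u j\<rfloor>) J"
  have "k \<in> J \<rightarrow>\<^sub>E {- int M..int M}"
  proof -
    have "- int M \<le> \<lfloor>real M * u j\<rfloor> \<and> \<lfloor>real M * u j\<rfloor> \<le> int M" if "j \<in> J" for j
    proof -
      have "\<bar>real M * u j\<bar> \<le> real M" using u1[OF that] by (simp add: abs_mult mult_left_le)
      then have "- real M \<le> real M * u j" "real M * u j \<le> real M" by (simp_all add: abs_le_iff)
      then show ?thesis by (simp add: le_floor_iff floor_le_iff)
    qed
    then show ?thesis by (auto simp: k_def)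
  qed
  then have vn: "net_vec p M J k \<in> net p M I" using J unfolding net_def by blast
  define g where "g = grid_pt M k"
  have gu: "\<bar>g j - u j\<bar> \<le> 1 / (2 * real M)" if "j \<in> J" for j
  proof -
    have "g j - u j = (real_of_int \<lfloor>real M * u j\<rfloor> + 1 / 2 - real M * u j) / real M"
      using M0 that by (simp add: g_def grid_pt_def k_def field_simps)
    moreover have "\<bar>real_of_int \<lfloor>real M * u j\<rfloor> + 1 / 2 - real M * u j\<bar> \<le> 1 / 2" by linarith
    ultimately have "\<bar>g j - u j\<bar> \<le> (1 / 2) / real M" by (simp only: abs_divide abs_of_nat) (rule divide_right_mono, auto)
    then show ?thesis by simp
  qed
  define Nn where "Nn = L2_set g J"
  have Lu: "L2_set u J = 1" unfolding L2_set_def u by simp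
  have "L2_set (\<lambda>j. g j - u j) J \<le> (\<Sum>j\<in>J. \<bar>g j - u j\<bar>)" by (rule L2_set_le_sum_abs)
  also have "\<dots> \<le> (\<Sum>j\<in>J. 1 / (2 * real M))" using gu by (intro sum_mono) auto
  also have "\<dots> \<le> real s / (2 * real M)" using J(3) by (simp add: divide_right_mono)
  finally have D: "L2_set (\<lambda>j. g j - u j) J \<le> real s / (2 * real M)" .
  have "L2_set (\<lambda>j. u j + (g j - u j)) J \<le> L2_set u J + L2_set (\<lambda>j. g j - u j) J" by (rule L2_set_triangle_ineq)
  then have N1: "Nn \<le> 1 + real s / (2 * real M)" using D Lu by (simp add: Nn_def)
  have "L2_set (\<lambda>j. g j + (u j - g j)) J \<le> L2_set g J + L2_set (\<lambda>j. u j - g j) J" by (rule L2_set_triangle_ineq)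
  moreover have "L2_set (\<lambda>j. u j - g j) J = L2_set (\<lambda>j. g j - u j) J"
    unfolding L2_set_def by (simp add: power2_commute)
  ultimately have N2: "1 - real s / (2 * real M) \<le> Nn" using D Lu by (simp add: Nn_def)
  have sM: "real s / (2 * real M) \<le> 1 / 2" using M M0 by (simp add: field_simps)
  have Nh: "1 / 2 \<le> Nn" using N2 sM by simp
  have "\<bar>net_vec p M J k j - u j\<bar> \<le> 2 * real s / real M" if j: "j \<in> J" for j
  proof -
    have "net_vec p M J k j - u j = (g j - Nn * u j) / Nn"
      using j J(2) Nh by (auto simp: net_vec_def g_def Nn_def field_simps)
    moreover have "\<bar>g j - Nn * u j\<bar> \<le> real s / real M"
    proof -
      have "\<bar>g j - Nn * u j\<bar> = \<bar>(g j - u j) + (1 - Nn) * u j\<bar>" by (simp add: algebra_simps)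
      also have "\<dots> \<le> \<bar>g j - u j\<bar> + \<bar>1 - Nn\<bar> * \<bar>u j\<bar>" by (metis abs_triangle_ineq abs_mult)
      also have "\<dots> \<le> 1 / (2 * real M) + real s / (2 * real M) * 1"
        using gu[OF j] u1[OF j] N1 N2 by (intro add_mono mult_mono) auto
      also have "\<dots> \<le> real s / real M" using s0 M0 by (simp add: field_simps)
      finally show ?thesis .
    qed
    ultimately have "\<bar>net_vec p M J k j - u j\<bar> \<le> (real s / real M) / (1 / 2)"
      using Nh by (simp only: abs_divide) (intro frac_le, auto)
    then show ?thesis by (simp add: mult.commute)
  qed
  moreover have "\<forall>j<p. j \<notin> J \<longrightarrow> net_vec p M J k j = 0" by (auto simp: net_vec_def)
  ultimately show ?thesis using vn by blast
qed

definition cube :: "nat \<Rightarrow> real \<Rightarrow> (nat \<Rightarrow> real) set" where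
  "cube p R = {x \<in> space (Rp_meas p). \<forall>j<p. \<bar>x j\<bar> \<le> R}"

text \<open>Only finitely many points of \<open>A\<close> are separated from \<open>x\<close>, so none of the convex sets has to be closed.\<close>

lemma sparse_convex_inner:
  assumes A: "A \<in> sparse_convex_class p s I" and I: "\<And>J. J \<in> I \<Longrightarrow> J \<subseteq> {..<p} \<and> card J \<le> s"
    and s: "1 \<le> s" and M: "s \<le> M" and x: "x \<in> cube p R" and y0: "y0 \<in> A \<inter> cube p R"
    and far: "\<And>v. v \<in> net p M I \<Longrightarrow> \<exists>y\<in>A \<inter> cube p R. ip p v x + 4 * (real s)\<^sup>2 * R / real M < ip p v y"
  shows "x \<in> A"
proof (rule ccontr)
  assume xA: "x \<notin> A"
  obtain Q As where Q: "Q > (0::nat)" "\<And>q. q < Q \<Longrightarrow> convex_p p (As q)" "\<And>q. q < Q \<Longrightarrow> ind_supp p (As q) \<in> I"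
    "A = (\<Inter>q<Q. As q)" using A unfolding sparse_convex_class_def by blast
  obtain q where q: "q < Q" "x \<notin> As q" using xA Q(4) by auto
  define J where "J = ind_supp p (As q)"
  have J: "J \<in> I" "J \<subseteq> {..<p}" "card J \<le> s" using Q(3)[OF q(1)] I unfolding J_def by auto
  have finJ: "finite J" using J(2) finite_subset by blast
  obtain Y where Y: "\<And>v. v \<in> net p M I \<Longrightarrow> Y v \<in> A \<inter> cube p R \<and> ip p v x + 4 * (real s)\<^sup>2 * R / real M < ip p v (Y v)"
    using far by metis
  \<comment> \<open>One point of \<open>A\<close> beyond \<open>x\<close> in each net direction;
    \<open>y0\<close> provides a vertex of the hull in any case.\<close>
  define F where "F = insert y0 (Y ` net p M I)"
  have finF: "finite F" unfolding F_def using net_finite_card(1)[OF I s] by simp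
  have FA: "F \<subseteq> A \<inter> cube p R" using y0 Y by (auto simp: F_def)
  define n where "n = card F"
  have n: "0 < n" using finF by (auto simp: n_def F_def card_gt_0_iff)
  obtain y where y: "bij_betw y {0..<n} F" using ex_bij_betw_nat_finite[OF finF] unfolding n_def by blast
  have yF: "y i \<in> F" if "i < n" for i using y that by (auto simp: bij_betw_def)
  have yA: "y i \<in> As q" if "i < n" for i using yF[OF that] FA Q(4) q(1) by auto
  have xs: "x \<in> space (Rp_meas p)" using x by (simp add: cube_def)
  \<comment> \<open>Only the support \<open>J\<close> of the violated convex set counts: a convex
    combination of points of \<open>F\<close> that agrees with \<open>x\<close> on \<open>J\<close>
    would put \<open>x\<close> into that set.\<close>
  have "\<exists>j\<in>J. x j \<noteq> (\<Sum>i<n. w i * y i j)" if w: "\<And>i. i < n \<Longrightarrow> 0 \<le> w i" "(\<Sum>i<n. w i) = 1" for w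
  proof (rule ccontr)
    assume "\<not> (\<exists>j\<in>J. x j \<noteq> (\<Sum>i<n. w i * y i j))"
    then have e: "x j = restrict (\<lambda>j. \<Sum>i<n. w i * y i j) {..<p} j" if "j \<in> ind_supp p (As q)" for j
      using that J(2) unfolding J_def by auto
    have "restrict (\<lambda>j. \<Sum>i<n. w i * y i j) {..<p} \<in> As q"
      using convex_p_combination[OF Q(2)[OF q(1)], of n y w] yA w by blast
    then have "x \<in> As q" using ind_supp_cong[of x p "restrict (\<lambda>j. \<Sum>i<n. w i * y i j) {..<p}" "As q"] xs e
      by (simp add: space_Rp_meas)
    then show False using q(2) by simp
  qed
  from finite_hull_separation[OF n finJ this]
  obtain u where u: "\<And>j. j \<notin> J \<Longrightarrow> u j = 0" "(\<Sum>j\<in>J. (u j)\<^sup>2) = 1"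
    "\<And>i. i < n \<Longrightarrow> (\<Sum>j\<in>J. u j * y i j) \<le> (\<Sum>j\<in>J. u j * x j)" by blast
  have "J \<noteq> {}" using u(2) by auto
  then obtain v where v: "v \<in> net p M I" "\<And>j. j < p \<Longrightarrow> j \<notin> J \<Longrightarrow> v j = 0" "\<And>j. j \<in> J \<Longrightarrow> \<bar>v j - u j\<bar> \<le> 2 * real s / real M"
    using net_approx[OF J _ M u(2)] by blast
  have "Y v \<in> F" using v(1) by (simp add: F_def)
  then obtain i where i: "i < n" "y i = Y v" using y by (auto simp: bij_betw_def)
  have ipJ: "ip p v z = (\<Sum>j\<in>J. v j * z j)" for z
    unfolding ip_def using J(2) v(2) by (intro sum.mono_neutral_right) auto
  have R0: "\<bar>Y v j - x j\<bar> \<le> 2 * R" if "j < p" for j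
  proof -
    have "\<bar>Y v j\<bar> \<le> R" "\<bar>x j\<bar> \<le> R" using Y[OF v(1)] x that by (auto simp: cube_def)
    then show ?thesis by linarith
  qed
  \<comment> \<open>Replacing the separating normal \<open>u\<close> by its net neighbour
    \<open>v\<close> costs at most \<open>s\<close> terms of size \<open>(2 s / M) * (2 R)\<close>,
    which is the margin in \<open>far\<close>.\<close>
  have "ip p v (Y v) - ip p v x = (\<Sum>j\<in>J. u j * Y v j) - (\<Sum>j\<in>J. u j * x j) + (\<Sum>j\<in>J. (v j - u j) * (Y v j - x j))"
    unfolding ipJ by (simp add: sum_subtractf[symmetric] sum.distrib[symmetric] algebra_simps)
  also have "\<dots> \<le> 0 + (\<Sum>j\<in>J. 2 * real s / real M * (2 * R))"
  proof (intro add_mono sum_mono)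
    show "(\<Sum>j\<in>J. u j * Y v j) - (\<Sum>j\<in>J. u j * x j) \<le> 0" using u(3)[OF i(1)] i(2) by simp
    fix j assume j: "j \<in> J"
    have "(v j - u j) * (Y v j - x j) \<le> \<bar>v j - u j\<bar> * \<bar>Y v j - x j\<bar>" by (metis abs_ge_self abs_mult)
    also have "\<dots> \<le> 2 * real s / real M * (2 * R)"
      using v(3)[OF j] R0[of j] j J(2) by (intro mult_mono) auto
    finally show "(v j - u j) * (Y v j - x j) \<le> 2 * real s / real M * (2 * R)" .
  qed
  also have "\<dots> = real (card J) * (4 * real s * R / real M)" by simp
  also have "\<dots> \<le> real s * (4 * real s * R / real M)"
  proof (rule mult_right_mono)
    have "0 \<le> R"
    proof -
      obtain j where "j \<in> J" using \<open>J \<noteq> {}\<close> by auto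
      then show ?thesis using R0[of j] J(2) by fastforce
    qed
    then show "0 \<le> 4 * real s * R / real M" by simp
  qed (use J in simp)
  also have "\<dots> = 4 * (real s)\<^sup>2 * R / real M" by (simp add: power2_eq_square)
  finally show False using Y[OF v(1)] by linarith
qed

section \<open>Concentration of empirical covariances\<close>

lemma exp_le_quadratic:
  fixes x :: real assumes "\<bar>x\<bar> \<le> 1" shows "exp x \<le> 1 + x + x\<^sup>2"
proof (cases "0 \<le> x")
  case True then show ?thesis using assms by (intro exp_bound) auto
next
  case False
  define y where "y = - x"
  have y: "0 \<le> y" "y \<le> 1" using False assms by (auto simp: y_def)
  have e: "1 + y + y\<^sup>2 / 2 \<le> exp y" by (rule exp_lower_Taylor_quadratic[OF y(1)])
  have q: "0 \<le> 1 - y + y\<^sup>2" using y by (simp add: add_increasing2)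
  \<comment> \<open>Multiplied by \<open>exp y\<close>, the claim follows once the quadratic Taylor
    bound of \<open>exp y\<close> times \<open>1 - y + y^2\<close> is at least 1.\<close>
  have "1 \<le> (1 + y + y\<^sup>2 / 2) * (1 - y + y\<^sup>2)"
  proof -
    have "(1 + y + y\<^sup>2 / 2) * (1 - y + y\<^sup>2) = 1 + (y\<^sup>2 + y ^ 3 + y ^ 4) / 2"
      by (simp add: power2_eq_square power3_eq_cube power4_eq_xxxx field_simps)
    then show ?thesis using y by simp
  qed
  also have "\<dots> \<le> exp y * (1 - y + y\<^sup>2)" using e q by (rule mult_right_mono)
  finally have "exp (- y) \<le> 1 - y + y\<^sup>2" by (simp add: exp_minus field_simps)
  then show ?thesis by (simp add: y_def)
qed

text \<open>Chernoff's bound with the parameter \<open>\<kappa>\<close> left open. The inequality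
  \<open>exp x <= 1 + x + x^2\<close> lets uncentered second moments take the place of variances, so
  truncated variables need no recentering.\<close>

lemma bernstein_PiM:
  fixes f :: "nat \<Rightarrow> 'a \<Rightarrow> real"
  assumes p: "\<And>i. i < N \<Longrightarrow> prob_space (\<mu> i)" and f: "\<And>i. i < N \<Longrightarrow> f i \<in> borel_measurable (\<mu> i)"
    and K: "\<And>i x. i < N \<Longrightarrow> \<bar>f i x\<bar> \<le> K" and V: "(\<Sum>i<N. \<integral>x. (f i x)\<^sup>2 \<partial>\<mu> i) \<le> real N * V"
    and lam: "0 < \<kappa>" "\<kappa> * K \<le> 1"
  shows "measure (PiM {..<N} \<mu>) {z \<in> space (PiM {..<N} \<mu>). real N * \<kappa> * V + t / \<kappa> \<le> (\<Sum>i<N. f i (z i)) - (\<Sum>i<N. \<integral>x. f i x \<partial>\<mu> i)} \<le> exp (- t)"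
proof -
  let ?P = "PiM {..<N} \<mu>"
  interpret P: prob_space ?P by (intro prob_space_PiM_lessThan p)
  have fi: "integrable (\<mu> i) (f i)" "integrable (\<mu> i) (\<lambda>x. (f i x)\<^sup>2)" "integrable (\<mu> i) (\<lambda>x. exp (\<kappa> * f i x))" if i: "i < N" for i
  proof -
    interpret m: prob_space "\<mu> i" by (rule p[OF i])
    note [measurable] = f[OF i]
    have K0: "0 \<le> K" using K[OF i, of undefined] by linarith
    show "integrable (\<mu> i) (f i)" using K[OF i] by (intro m.integrable_const_bound[of _ K]) auto
    have "(f i x)\<^sup>2 \<le> K\<^sup>2" for x using K[OF i, of x] K0 abs_le_square_iff[of "f i x" K] by simp
    then show "integrable (\<mu> i) (\<lambda>x. (f i x)\<^sup>2)" by (intro m.integrable_const_bound[of _ "K\<^sup>2"]) auto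
    have "\<kappa> * f i x \<le> \<kappa> * K" for x using K[OF i, of x] lam by (intro mult_left_mono) auto
    then show "integrable (\<mu> i) (\<lambda>x. exp (\<kappa> * f i x))"
      by (intro m.integrable_const_bound[of _ "exp (\<kappa> * K)"]) auto
  qed
  have ei: "(\<integral>x. exp (\<kappa> * f i x) \<partial>\<mu> i) \<le> exp (\<kappa> * (\<integral>x. f i x \<partial>\<mu> i) + \<kappa>\<^sup>2 * (\<integral>x. (f i x)\<^sup>2 \<partial>\<mu> i))" if i: "i < N" for i
  proof -
    interpret m: prob_space "\<mu> i" by (rule p[OF i])
    have "(\<integral>x. exp (\<kappa> * f i x) \<partial>\<mu> i) \<le> (\<integral>x. 1 + \<kappa> * f i x + \<kappa>\<^sup>2 * (f i x)\<^sup>2 \<partial>\<mu> i)"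
    proof (rule integral_mono)
      show "integrable (\<mu> i) (\<lambda>x. 1 + \<kappa> * f i x + \<kappa>\<^sup>2 * (f i x)\<^sup>2)" using fi[OF i] by auto
      fix x
      have "\<bar>\<kappa> * f i x\<bar> \<le> \<kappa> * K" using K[OF i, of x] lam by (simp add: abs_mult)
      then show "exp (\<kappa> * f i x) \<le> 1 + \<kappa> * f i x + \<kappa>\<^sup>2 * (f i x)\<^sup>2"
        using exp_le_quadratic[of "\<kappa> * f i x"] lam by (simp add: power_mult_distrib)
    qed (rule fi[OF i])
    also have "\<dots> = 1 + (\<kappa> * (\<integral>x. f i x \<partial>\<mu> i) + \<kappa>\<^sup>2 * (\<integral>x. (f i x)\<^sup>2 \<partial>\<mu> i))"
      using fi[OF i] by (simp add: m.prob_space)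
    also have "\<dots> \<le> exp (\<kappa> * (\<integral>x. f i x \<partial>\<mu> i) + \<kappa>\<^sup>2 * (\<integral>x. (f i x)\<^sup>2 \<partial>\<mu> i))" by (rule exp_ge_add_one_self)
    finally show ?thesis .
  qed
  define m where "m = (\<Sum>i<N. \<integral>x. f i x \<partial>\<mu> i)"
  define c where "c = exp (\<kappa> * m + \<kappa>\<^sup>2 * (real N * V) + t)"
  define G where "G z = (\<Prod>i<N. exp (\<kappa> * f i (z i)))" for z
  have Geq: "G z = exp (\<kappa> * (\<Sum>i<N. f i (z i)))" for z by (simp add: G_def exp_sum sum_distrib_left)
  have fz: "(\<lambda>z. f i (z i)) \<in> borel_measurable ?P" if "i < N" for i
    using that by (intro measurable_PiM_component_rev f) auto
  have Gm: "G \<in> borel_measurable ?P"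
    unfolding G_def[abs_def] using fz by (intro borel_measurable_prod borel_measurable_exp measurable_compose[OF _ borel_measurable_exp] borel_measurable_times borel_measurable_const) auto
  have Gi: "integrable ?P G"
  proof (rule P.integrable_const_bound[OF _ Gm])
    have "(\<Sum>i<N. f i (z i)) \<le> real N * K" for z
      using sum_mono[of "{..<N}" "\<lambda>i. f i (z i)" "\<lambda>_. K"] K by (force simp: abs_le_iff)
    then have "G z \<le> exp (\<kappa> * (real N * K))" for z
      unfolding Geq using lam by (simp add: mult_left_mono)
    then show "AE z in ?P. norm (G z) \<le> exp (\<kappa> * (real N * K))" by (simp add: Geq)
  qed
  have "(\<integral>z. G z \<partial>?P) = (\<Prod>i<N. \<integral>x. exp (\<kappa> * f i x) \<partial>\<mu> i)"
    unfolding G_def by (rule integral_PiM_prod[OF p]) (use fi in auto)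
  also have "\<dots> \<le> (\<Prod>i<N. exp (\<kappa> * (\<integral>x. f i x \<partial>\<mu> i) + \<kappa>\<^sup>2 * (\<integral>x. (f i x)\<^sup>2 \<partial>\<mu> i)))"
    using ei by (intro prod_mono) (auto intro!: Bochner_Integration.integral_nonneg)
  also have "\<dots> = exp (\<kappa> * m + \<kappa>\<^sup>2 * (\<Sum>i<N. \<integral>x. (f i x)\<^sup>2 \<partial>\<mu> i))"
    by (simp add: exp_sum[symmetric] sum.distrib sum_distrib_left m_def)
  also have "\<dots> \<le> exp (\<kappa> * m + \<kappa>\<^sup>2 * (real N * V))" using V by (simp add: mult_left_mono)
  finally have EG: "(\<integral>z. G z \<partial>?P) \<le> exp (\<kappa> * m + \<kappa>\<^sup>2 * (real N * V))" .
  have "{z \<in> space ?P. real N * \<kappa> * V + t / \<kappa> \<le> (\<Sum>i<N. f i (z i)) - m} = {z \<in> space ?P. c \<le> G z}"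
  proof -
    have "real N * \<kappa> * V + t / \<kappa> \<le> s - m \<longleftrightarrow> c \<le> exp (\<kappa> * s)" for s
    proof -
      have "real N * \<kappa> * V + t / \<kappa> \<le> s - m \<longleftrightarrow> \<kappa> * (real N * \<kappa> * V + t / \<kappa>) \<le> \<kappa> * (s - m)" using lam by simp
      also have "\<dots> \<longleftrightarrow> \<kappa> * m + \<kappa>\<^sup>2 * (real N * V) + t \<le> \<kappa> * s"
        using lam by (simp add: algebra_simps power2_eq_square)
      finally show ?thesis by (simp add: c_def)
    qed
    then show ?thesis by (simp add: Geq)
  qed
  then have "measure ?P {z \<in> space ?P. real N * \<kappa> * V + t / \<kappa> \<le> (\<Sum>i<N. f i (z i)) - m} = measure ?P {z \<in> space ?P. c \<le> G z}" by simp
  also have "\<dots> \<le> (\<integral>z. G z \<partial>?P) / c"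
    by (rule integral_Markov_inequality_measure[OF Gi sets.top]) (auto simp: Geq c_def)
  also have "\<dots> \<le> exp (\<kappa> * m + \<kappa>\<^sup>2 * (real N * V)) / c" using EG by (intro divide_right_mono) (auto simp: c_def)
  also have "\<dots> = exp (- t)" by (simp add: c_def exp_add exp_minus field_simps)
  finally show ?thesis unfolding m_def .
qed

text \<open>All parts rest on \<open>|X|^k <= k! * B^k * exp (|X| / B)\<close> or Markov's
  inequality. For the moments beyond \<open>\<tau>\<close> the exponent is shared: one half, at
  scale \<open>2 B\<close>, bounds the power, the other half yields
  \<open>exp (- \<tau> / (2 B))\<close>.\<close>

lemma subexp_moments:
  fixes X :: "'a \<Rightarrow> real"
  assumes p: "prob_space M" and X[measurable]: "X \<in> borel_measurable M" and B: "0 < B"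
    and e: "(\<integral>\<^sup>+x. ennreal (exp (\<bar>X x\<bar> / B)) \<partial>M) \<le> 2"
  shows "integrable M (\<lambda>x. X x ^ k)" "integrable M (\<lambda>x. \<bar>X x\<bar> ^ k)"
    "(\<integral>x. (X x)\<^sup>2 \<partial>M) \<le> 4 * B\<^sup>2"
    "measure M {x \<in> space M. \<tau> < \<bar>X x\<bar>} \<le> 2 * exp (- \<tau> / B)"
    "(\<integral>x. (X x)\<^sup>2 * indicator {y. \<tau> < \<bar>y\<bar>} (X x) \<partial>M) \<le> 16 * B\<^sup>2 * exp (- \<tau> / (2 * B))"
    "(\<integral>x. \<bar>X x\<bar> * indicator {y. \<tau> < \<bar>y\<bar>} (X x) \<partial>M) \<le> 4 * B * exp (- \<tau> / (2 * B))"
proof -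
  interpret prob_space M by fact
  define F where "F x = exp (\<bar>X x\<bar> / B)" for x
  have [measurable]: "F \<in> borel_measurable M" unfolding F_def[abs_def] by measurable
  have F0: "0 \<le> F x" for x by (simp add: F_def)
  have Fi: "integrable M F"
  proof (rule integrableI_bounded)
    have "(\<integral>\<^sup>+x. ennreal (norm (F x)) \<partial>M) \<le> 2" using e by (simp add: F_def)
    also have "\<dots> < \<infinity>" by simp
    finally show "(\<integral>\<^sup>+x. ennreal (norm (F x)) \<partial>M) < \<infinity>" .
  qed simp
  have "ennreal (\<integral>x. F x \<partial>M) \<le> 2"
    using e[folded F_def] nn_integral_eq_integral[OF Fi] F0 by simp
  then have F2: "(\<integral>x. F x \<partial>M) \<le> 2"
    by (subst (asm) ennreal_numeral[symmetric]) (simp del: ennreal_numeral)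
  have pw: "(\<bar>X x\<bar> / (c * B)) ^ k \<le> fact k * exp (\<bar>X x\<bar> / (c * B))" if "0 < c" for x k and c :: real
  proof -
    have "0 \<le> \<bar>X x\<bar> / (c * B)" using that B by simp
    from mult_right_mono[OF power_times_exp_minus_le[OF this, of k], of "exp (\<bar>X x\<bar> / (c * B))"]
    show ?thesis by (simp add: mult.assoc exp_add[symmetric])
  qed
  have pk: "\<bar>X x\<bar> ^ k \<le> fact k * B ^ k * F x" for x k
    using pw[of 1 x k] B by (simp add: F_def power_divide field_simps)
  show ik: "integrable M (\<lambda>x. \<bar>X x\<bar> ^ k)" for k
    by (rule Bochner_Integration.integrable_bound[where f="\<lambda>x. fact k * B ^ k * F x"])
       (use Fi pk F0 B in \<open>auto simp: abs_mult\<close>)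
  show "integrable M (\<lambda>x. X x ^ k)"
    by (rule Bochner_Integration.integrable_bound[OF ik[of k]]) (auto simp: power_abs)
  have "(\<integral>x. (X x)\<^sup>2 \<partial>M) \<le> (\<integral>x. 2 * B\<^sup>2 * F x \<partial>M)"
    using Fi pk[of _ 2] ik[of 2] by (intro integral_mono) auto
  also have "\<dots> \<le> 2 * B\<^sup>2 * 2" using mult_left_mono[OF F2, of "2 * B\<^sup>2"] by simp
  finally show "(\<integral>x. (X x)\<^sup>2 \<partial>M) \<le> 4 * B\<^sup>2" by simp
  have "{x \<in> space M. \<tau> < \<bar>X x\<bar>} \<subseteq> {x \<in> space M. exp (\<tau> / B) \<le> F x}"
    using B by (auto simp: F_def divide_right_mono)
  then have "measure M {x \<in> space M. \<tau> < \<bar>X x\<bar>} \<le> measure M {x \<in> space M. exp (\<tau> / B) \<le> F x}"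
    by (intro finite_measure_mono) auto
  also have "\<dots> \<le> (\<integral>x. F x \<partial>M) / exp (\<tau> / B)"
    by (rule integral_Markov_inequality_measure[OF Fi sets.top]) (auto simp: F0)
  also have "\<dots> \<le> 2 / exp (\<tau> / B)" using F2 by (intro divide_right_mono) auto
  finally show "measure M {x \<in> space M. \<tau> < \<bar>X x\<bar>} \<le> 2 * exp (- \<tau> / B)" by (simp add: exp_minus field_simps)
  have half: "exp (\<bar>X x\<bar> / (2 * B)) * indicator {y. \<tau> < \<bar>y\<bar>} (X x) \<le> exp (- \<tau> / (2 * B)) * F x" for x
  proof (cases "\<tau> < \<bar>X x\<bar>")
    case True
    have "\<bar>X x\<bar> / (2 * B) \<le> - \<tau> / (2 * B) + \<bar>X x\<bar> / B" using True B by (simp add: field_simps)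
    then show ?thesis using True by (simp add: F_def exp_add[symmetric])
  qed (simp add: F0)
  have tr: "(\<integral>x. \<bar>X x\<bar> ^ k * indicator {y. \<tau> < \<bar>y\<bar>} (X x) \<partial>M) \<le> fact k * (2 * B) ^ k * (exp (- \<tau> / (2 * B)) * 2)" for k
  proof -
    have "(\<integral>x. \<bar>X x\<bar> ^ k * indicator {y. \<tau> < \<bar>y\<bar>} (X x) \<partial>M) \<le> (\<integral>x. fact k * (2 * B) ^ k * (exp (- \<tau> / (2 * B)) * F x) \<partial>M)"
    proof (rule integral_mono)
      show "integrable M (\<lambda>x. \<bar>X x\<bar> ^ k * indicator {y. \<tau> < \<bar>y\<bar>} (X x))"
        by (rule Bochner_Integration.integrable_bound[OF ik[of k]]) (auto simp: indicator_def)
      fix x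
      have "\<bar>X x\<bar> ^ k \<le> fact k * (2 * B) ^ k * exp (\<bar>X x\<bar> / (2 * B))"
        using pw[of 2 x k] B by (simp add: power_divide field_simps)
      then have "\<bar>X x\<bar> ^ k * indicator {y. \<tau> < \<bar>y\<bar>} (X x) \<le> fact k * (2 * B) ^ k * exp (\<bar>X x\<bar> / (2 * B)) * indicator {y. \<tau> < \<bar>y\<bar>} (X x)"
        by (rule mult_right_mono) auto
      also have "\<dots> \<le> fact k * (2 * B) ^ k * (exp (- \<tau> / (2 * B)) * F x)"
        unfolding mult.assoc[of "fact k * (2 * B) ^ k"] using half[of x] B by (intro mult_left_mono) auto
      finally show "\<bar>X x\<bar> ^ k * indicator {y. \<tau> < \<bar>y\<bar>} (X x) \<le> fact k * (2 * B) ^ k * (exp (- \<tau> / (2 * B)) * F x)" .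
    qed (use Fi in auto)
    also have "\<dots> \<le> fact k * (2 * B) ^ k * (exp (- \<tau> / (2 * B)) * 2)" using F2 B by simp
    finally show ?thesis .
  qed
  show "(\<integral>x. (X x)\<^sup>2 * indicator {y. \<tau> < \<bar>y\<bar>} (X x) \<partial>M) \<le> 16 * B\<^sup>2 * exp (- \<tau> / (2 * B))"
    using tr[of 2] by (simp add: power_mult_distrib)
  show "(\<integral>x. \<bar>X x\<bar> * indicator {y. \<tau> < \<bar>y\<bar>} (X x) \<partial>M) \<le> 4 * B * exp (- \<tau> / (2 * B))"
    using tr[of 1] by simp
qed

section \<open>Truncation, its bias, and the union bound over the net\<close>

definition trunc :: "real \<Rightarrow> real \<Rightarrow> real" where
  "trunc \<tau> x = (if \<bar>x\<bar> \<le> \<tau> then x else 0)"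

lemma trunc_measurable[measurable]: "trunc \<tau> \<in> borel_measurable borel"
  unfolding trunc_def[abs_def] by measurable

lemma trunc_bounds: "\<bar>trunc \<tau> x\<bar> \<le> \<bar>x\<bar>" "0 \<le> \<tau> \<Longrightarrow> \<bar>trunc \<tau> x\<bar> \<le> \<tau>"
  by (auto simp: trunc_def)

lemma trunc_product_bias:
  fixes X Y :: "'a \<Rightarrow> real"
  assumes p: "prob_space M" and X[measurable]: "X \<in> borel_measurable M" and Y[measurable]: "Y \<in> borel_measurable M" and B: "0 < B"
    and eX: "(\<integral>\<^sup>+x. ennreal (exp (\<bar>X x\<bar> / B)) \<partial>M) \<le> 2" and eY: "(\<integral>\<^sup>+x. ennreal (exp (\<bar>Y x\<bar> / B)) \<partial>M) \<le> 2"
    and \<tau>: "0 \<le> \<tau>"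
  shows "integrable M (\<lambda>x. X x * Y x)" "integrable M (\<lambda>x. trunc \<tau> (X x) * trunc \<tau> (Y x))"
    "\<bar>(\<integral>x. X x * Y x \<partial>M) - (\<integral>x. trunc \<tau> (X x) * trunc \<tau> (Y x) \<partial>M)\<bar> \<le> 32 * B\<^sup>2 * exp (- \<tau> / (2 * B))"
    "(\<integral>x. (trunc \<tau> (X x) * trunc \<tau> (Y x))\<^sup>2 \<partial>M) \<le> ((\<integral>x. X x ^ 4 \<partial>M) + (\<integral>x. Y x ^ 4 \<partial>M)) / 2"
    "integrable M (\<lambda>x. trunc \<tau> (X x))"
    "\<bar>(\<integral>x. X x \<partial>M) - (\<integral>x. trunc \<tau> (X x) \<partial>M)\<bar> \<le> 4 * B * exp (- \<tau> / (2 * B))"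
    "(\<integral>x. (trunc \<tau> (X x))\<^sup>2 \<partial>M) \<le> 4 * B\<^sup>2"
proof -
  interpret prob_space M by fact
  note SX = subexp_moments[OF p X B eX] and SY = subexp_moments[OF p Y B eY]
  have ab: "\<bar>a * b\<bar> \<le> (a\<^sup>2 + b\<^sup>2) / 2" for a b :: real
  proof -
    have "0 \<le> (\<bar>a\<bar> - \<bar>b\<bar>)\<^sup>2" by simp
    also have "\<dots> = a\<^sup>2 + b\<^sup>2 - 2 * (\<bar>a\<bar> * \<bar>b\<bar>)" by (simp add: power2_diff)
    finally show ?thesis by (simp add: abs_mult)
  qed
  have i2: "integrable M (\<lambda>x. ((X x)\<^sup>2 + (Y x)\<^sup>2) / 2)" using SX(1)[of 2] SY(1)[of 2] by auto
  show XY: "integrable M (\<lambda>x. X x * Y x)"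
    by (rule Bochner_Integration.integrable_bound[OF i2]) (use ab in auto)
  show TT: "integrable M (\<lambda>x. trunc \<tau> (X x) * trunc \<tau> (Y x))"
    by (rule Bochner_Integration.integrable_bound[OF XY])
       (auto simp: abs_mult intro!: mult_mono trunc_bounds)
  show T1: "integrable M (\<lambda>x. trunc \<tau> (X x))"
    by (rule Bochner_Integration.integrable_bound[OF SX(1)[of 1]]) (auto intro!: trunc_bounds)
  have iX: "integrable M (\<lambda>x. (X x)\<^sup>2 * indicator {y. \<tau> < \<bar>y\<bar>} (X x))"
    by (rule Bochner_Integration.integrable_bound[OF SX(1)[of 2]]) (auto simp: indicator_def)
  have iY: "integrable M (\<lambda>x. (Y x)\<^sup>2 * indicator {y. \<tau> < \<bar>y\<bar>} (Y x))"
    by (rule Bochner_Integration.integrable_bound[OF SY(1)[of 2]]) (auto simp: indicator_def)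
  have iX1: "integrable M (\<lambda>x. \<bar>X x\<bar> * indicator {y. \<tau> < \<bar>y\<bar>} (X x))"
    by (rule Bochner_Integration.integrable_bound[OF SX(1)[of 1]]) (auto simp: indicator_def)
  \<comment> \<open>If truncation changes the product, then the factor of larger modulus exceeds
    \<open>\<tau>\<close>, and its square dominates the product. So the tails of the single
    variables suffice.\<close>
  have diff: "\<bar>a * b - trunc \<tau> a * trunc \<tau> b\<bar> \<le> a\<^sup>2 * indicator {y. \<tau> < \<bar>y\<bar>} a + b\<^sup>2 * indicator {y. \<tau> < \<bar>y\<bar>} b" for a b
  proof -
    have k: "\<bar>a * b\<bar> \<le> a\<^sup>2" if "\<bar>b\<bar> \<le> \<bar>a\<bar>" for a b :: real
      using mult_left_mono[OF that, of "\<bar>a\<bar>"] by (simp add: abs_mult power2_eq_square)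
    show ?thesis
      using k[of a b] k[of b a] ab[of a b] by (cases "\<bar>b\<bar> \<le> \<bar>a\<bar>") (auto simp: trunc_def indicator_def mult.commute)
  qed
  have "\<bar>\<integral>x. X x * Y x - trunc \<tau> (X x) * trunc \<tau> (Y x) \<partial>M\<bar> \<le> (\<integral>x. \<bar>X x * Y x - trunc \<tau> (X x) * trunc \<tau> (Y x)\<bar> \<partial>M)"
    by (rule integral_abs_bound)
  also have "\<dots> \<le> (\<integral>x. (X x)\<^sup>2 * indicator {y. \<tau> < \<bar>y\<bar>} (X x) + (Y x)\<^sup>2 * indicator {y. \<tau> < \<bar>y\<bar>} (Y x) \<partial>M)"
    using XY TT iX iY diff by (intro integral_mono integrable_abs Bochner_Integration.integrable_diff Bochner_Integration.integrable_add) auto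
  also have "\<dots> \<le> 32 * B\<^sup>2 * exp (- \<tau> / (2 * B))" using iX iY SX(5)[of \<tau>] SY(5)[of \<tau>] by simp
  finally show "\<bar>(\<integral>x. X x * Y x \<partial>M) - (\<integral>x. trunc \<tau> (X x) * trunc \<tau> (Y x) \<partial>M)\<bar> \<le> 32 * B\<^sup>2 * exp (- \<tau> / (2 * B))"
    using XY TT by simp
  have "\<bar>\<integral>x. X x - trunc \<tau> (X x) \<partial>M\<bar> \<le> (\<integral>x. \<bar>X x - trunc \<tau> (X x)\<bar> \<partial>M)" by (rule integral_abs_bound)
  also have "\<dots> = (\<integral>x. \<bar>X x\<bar> * indicator {y. \<tau> < \<bar>y\<bar>} (X x) \<partial>M)"
    by (intro Bochner_Integration.integral_cong) (auto simp: trunc_def indicator_def)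
  also have "\<dots> \<le> 4 * B * exp (- \<tau> / (2 * B))" by (rule SX(6))
  finally show "\<bar>(\<integral>x. X x \<partial>M) - (\<integral>x. trunc \<tau> (X x) \<partial>M)\<bar> \<le> 4 * B * exp (- \<tau> / (2 * B))"
    using T1 SX(1)[of 1] by simp
  have t2: "(trunc \<tau> x)\<^sup>2 \<le> x\<^sup>2" for x by (auto simp: trunc_def)
  have "(\<integral>x. (trunc \<tau> (X x))\<^sup>2 \<partial>M) \<le> (\<integral>x. (X x)\<^sup>2 \<partial>M)"
    using SX(1)[of 2] t2 by (intro integral_mono Bochner_Integration.integrable_bound[OF SX(1)[of 2]]) auto
  also have "\<dots> \<le> 4 * B\<^sup>2" by (rule SX(3))
  finally show "(\<integral>x. (trunc \<tau> (X x))\<^sup>2 \<partial>M) \<le> 4 * B\<^sup>2" .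
  have i4: "integrable M (\<lambda>x. (X x ^ 4 + Y x ^ 4) / 2)" using SX(1)[of 4] SY(1)[of 4] by auto
  have q: "(trunc \<tau> a * trunc \<tau> b)\<^sup>2 \<le> (a ^ 4 + b ^ 4) / 2" for a b
  proof -
    have "(trunc \<tau> a * trunc \<tau> b)\<^sup>2 \<le> a\<^sup>2 * b\<^sup>2"
      unfolding power_mult_distrib using t2 by (intro mult_mono) auto
    also have "\<dots> \<le> \<bar>a\<^sup>2 * b\<^sup>2\<bar>" by simp
    also have "\<dots> \<le> ((a\<^sup>2)\<^sup>2 + (b\<^sup>2)\<^sup>2) / 2" by (rule ab)
    finally show ?thesis by simp
  qed
  have "(\<integral>x. (trunc \<tau> (X x) * trunc \<tau> (Y x))\<^sup>2 \<partial>M) \<le> (\<integral>x. (X x ^ 4 + Y x ^ 4) / 2 \<partial>M)"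
    using q i4 by (intro integral_mono Bochner_Integration.integrable_bound[OF i4]) auto
  also have "\<dots> = ((\<integral>x. X x ^ 4 \<partial>M) + (\<integral>x. Y x ^ 4 \<partial>M)) / 2" using SX(1)[of 4] SY(1)[of 4] by simp
  finally show "(\<integral>x. (trunc \<tau> (X x) * trunc \<tau> (Y x))\<^sup>2 \<partial>M) \<le> ((\<integral>x. X x ^ 4 \<partial>M) + (\<integral>x. Y x ^ 4 \<partial>M)) / 2" .
qed

lemma bernstein_PiM_two_sided:
  fixes f :: "nat \<Rightarrow> 'a \<Rightarrow> real" and t :: real
  assumes p: "\<And>i. i < N \<Longrightarrow> prob_space (\<mu> i)" and f: "\<And>i. i < N \<Longrightarrow> f i \<in> borel_measurable (\<mu> i)"
    and K: "\<And>i x. i < N \<Longrightarrow> \<bar>f i x\<bar> \<le> K" and V: "(\<Sum>i<N. \<integral>x. (f i x)\<^sup>2 \<partial>\<mu> i) \<le> real N * V"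
    and lam: "0 < \<kappa>" "\<kappa> * K \<le> 1"
  defines "S \<equiv> {z \<in> space (PiM {..<N} \<mu>). real N * \<kappa> * V + t / \<kappa> \<le> \<bar>(\<Sum>i<N. f i (z i)) - (\<Sum>i<N. \<integral>x. f i x \<partial>\<mu> i)\<bar>}"
  shows "S \<in> sets (PiM {..<N} \<mu>)" "measure (PiM {..<N} \<mu>) S \<le> 2 * exp (- t)"
proof -
  let ?P = "PiM {..<N} \<mu>"
  interpret P: prob_space ?P by (intro prob_space_PiM_lessThan p)
  define g where "g z = (\<Sum>i<N. f i (z i)) - (\<Sum>i<N. \<integral>x. f i x \<partial>\<mu> i)" for z
  have gm[measurable]: "g \<in> borel_measurable ?P"
    unfolding g_def[abs_def]
    by (intro borel_measurable_diff borel_measurable_sum borel_measurable_const measurable_PiM_component_rev f) auto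
  define D where "D = real N * \<kappa> * V + t / \<kappa>"
  have S: "S = {z \<in> space ?P. D \<le> g z} \<union> {z \<in> space ?P. D \<le> - g z}"
    unfolding S_def g_def D_def by (auto simp: abs_if)
  show "S \<in> sets ?P" unfolding S by measurable
  have "measure ?P S \<le> measure ?P {z \<in> space ?P. D \<le> g z} + measure ?P {z \<in> space ?P. D \<le> - g z}"
    unfolding S by (intro measure_Un_le) measurable
  also have "measure ?P {z \<in> space ?P. D \<le> g z} \<le> exp (- t)"
    unfolding D_def g_def by (rule bernstein_PiM[OF p f K V lam])
  also have "measure ?P {z \<in> space ?P. D \<le> - g z} \<le> exp (- t)"
    using bernstein_PiM[of N \<mu> "\<lambda>i x. - f i x", OF p _ _ _ lam, of V t] f K V
    unfolding D_def g_def by (simp add: sum_negf)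
  finally show "measure ?P S \<le> 2 * exp (- t)" by simp
qed

lemma measure_finite_union_le:
  assumes "finite S" "\<And>a. a \<in> S \<Longrightarrow> F a \<in> sets M" "\<And>a. a \<in> S \<Longrightarrow> measure M (F a) \<le> c" "real (card S) \<le> n" "0 \<le> c"
  shows "measure M (\<Union>a\<in>S. F a) \<le> n * c"
proof -
  have "measure M (\<Union>a\<in>S. F a) \<le> (\<Sum>a\<in>S. measure M (F a))" using assms(1,2) by (intro measure_UNION_le) auto
  also have "\<dots> \<le> (\<Sum>a\<in>S. c)" using assms(3) by (rule sum_mono)
  also have "\<dots> = real (card S) * c" by simp
  also have "\<dots> \<le> n * c" using assms(4,5) by (intro mult_right_mono) auto
  finally show ?thesis .
qed

text \<open>The at most \<open>exp (16 l)\<close> pairs of net vectors are paid for by Bernstein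
  tails \<open>2 * exp (- 20 l)\<close>, the at most \<open>exp (9 l)\<close> events on which a
  truncation takes effect by \<open>2 * exp (- 13 l)\<close>. In total
  \<open>6 * exp (- 4 l)\<close> remains, which is below \<open>1 / N\<close>. The averages are
  controlled too, because the bootstrap centers at the sample mean.\<close>

theorem covariance_concentration:
  fixes \<mu> :: "nat \<Rightarrow> 'a measure" and X :: "'v \<Rightarrow> 'a \<Rightarrow> real"
  assumes p: "\<And>i. i < N \<Longrightarrow> prob_space (\<mu> i)"
    and X: "\<And>v i. v \<in> V \<Longrightarrow> i < N \<Longrightarrow> X v \<in> borel_measurable (\<mu> i)"
    and e: "\<And>v i. v \<in> V \<Longrightarrow> i < N \<Longrightarrow> (\<integral>\<^sup>+x. ennreal (exp (\<bar>X v x\<bar> / B)) \<partial>\<mu> i) \<le> 2"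
    and mean: "\<And>v i. v \<in> V \<Longrightarrow> i < N \<Longrightarrow> (\<integral>x. X v x \<partial>\<mu> i) = 0"
    and fourth: "\<And>v. v \<in> V \<Longrightarrow> (\<Sum>i<N. \<integral>x. X v x ^ 4 \<partial>\<mu> i) \<le> real N * (B\<^sup>2 * b\<^sup>2)"
    and V: "finite V" "real (card V) \<le> exp (8 * l)"
    and l: "2 / 3 \<le> l" "real N \<le> exp l" and N: "2 \<le> N" and B: "1 \<le> B" and b: "0 < b"
    and reg: "B * l\<^sup>2 * sqrt l \<le> \<rho> * sqrt (real N)" "169 * \<rho> \<le> b" "30 * \<rho> \<le> 1"
  defines "\<theta> \<equiv> sqrt l / sqrt (real N)"
  shows "\<exists>E\<in>sets (PiM {..<N} \<mu>). 1 - 1 / real N \<le> measure (PiM {..<N} \<mu>) E \<and>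
    (\<forall>z\<in>E. \<forall>v\<in>V. \<forall>w\<in>V.
      \<bar>(1 / real N) * (\<Sum>i<N. X v (z i) * X w (z i)) - (1 / real N) * (\<Sum>i<N. \<integral>x. X v x * X w x \<partial>\<mu> i)\<bar> \<le> (21 * b + 40) * (B * \<theta>)
      \<and> \<bar>(1 / real N) * (\<Sum>i<N. X v (z i))\<bar> \<le> 29 * (B * \<theta>))"
proof -
  let ?P = "PiM {..<N} \<mu>"
  interpret P: prob_space ?P by (intro prob_space_PiM_lessThan p)
  have N0: "0 < real N" and B0: "0 < B" and l0: "0 < l" using N B l by auto
  have \<theta>0: "0 < \<theta>" using N0 l0 by (simp add: \<theta>_def)
  have \<theta>2: "\<theta> * \<theta> = l / real N" using N0 l0 by (simp add: \<theta>_def)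
  have Bl: "B * l\<^sup>2 * \<theta> \<le> \<rho>"
    using reg(1) N0 by (simp add: \<theta>_def field_simps)
  have l2: "4 / 9 \<le> l\<^sup>2" using power_mono[OF l(1), of 2] by (simp add: power2_eq_square)
  have B\<theta>: "B * \<theta> \<le> 1"
  proof -
    have "4 / 9 * (B * \<theta>) \<le> l\<^sup>2 * (B * \<theta>)" using l2 B0 \<theta>0 by (intro mult_right_mono) auto
    also have "\<dots> \<le> \<rho>" using Bl by (simp add: mult_ac)
    finally show ?thesis using reg(3) by simp
  qed
  \<comment> \<open>Chosen for the tail \<open>2 * exp (- 13 l)\<close>; the bias factor
    \<open>exp (- \<tau> / (2 B))\<close> is then below \<open>exp (- l)\<close>.\<close>
  define \<tau> where "\<tau> = 13 * B * l"
  have \<tau>0: "0 \<le> \<tau>" using B0 l0 by (simp add: \<tau>_def)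
  have expl: "exp (- l) \<le> 1 / real N" using l(2) N0 by (simp add: exp_minus field_simps)
  have bias: "exp (- \<tau> / (2 * B)) \<le> 1 / real N"
  proof -
    have "- \<tau> / (2 * B) \<le> - l" using B0 l0 by (simp add: \<tau>_def field_simps)
    then show ?thesis using expl by (meson exp_le_cancel_iff order_trans)
  qed
  \<comment> \<open>The constants 4/5 and 5/4 below stem from \<open>2 / 3 <= l\<close>, as 16/25 is
    below 2/3.\<close>
  have sl: "4 / 5 \<le> sqrt l"
  proof -
    have "sqrt ((4/5)\<^sup>2) \<le> sqrt l" using l(1) by (intro real_sqrt_le_mono) (simp add: power2_eq_square)
    then show ?thesis by simp
  qed
  have sN: "1 \<le> sqrt (real N)" using N by simp
  have invN: "1 / real N \<le> 5 / 4 * \<theta> / sqrt (real N)"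
  proof -
    have "real N = sqrt (real N) * sqrt (real N)" using N0 by simp
    then have "5 / 4 * \<theta> / sqrt (real N) = 5 / 4 * sqrt l / real N" using N0 by (simp add: \<theta>_def)
    moreover have "1 / real N \<le> 5 / 4 * sqrt l / real N" using sl N0 by (intro divide_right_mono) auto
    ultimately show ?thesis by simp
  qed
  have BN: "B / sqrt (real N) \<le> 1"
  proof -
    have "B * (4 / 5) \<le> B * sqrt l" using sl B0 by (intro mult_left_mono) auto
    then have "B * (4 / 5) / sqrt (real N) \<le> B * sqrt l / sqrt (real N)" using N0 by (intro divide_right_mono) auto
    then have "B * (4 / 5) / sqrt (real N) \<le> B * \<theta>" by (simp add: \<theta>_def)
    moreover have "B * \<theta> \<le> 9 / 4 * \<rho>"
    proof -
      have "4 / 9 * (B * \<theta>) \<le> l\<^sup>2 * (B * \<theta>)" using l2 B0 \<theta>0 by (intro mult_right_mono) auto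
      then show ?thesis using Bl by (simp add: mult_ac)
    qed
    ultimately show ?thesis using reg(3) by simp
  qed
  \<comment> \<open>The bias is of order \<open>B^2 / N\<close>. A factor \<open>B / sqrt N\<close>
    is at most 1, and a multiple of \<open>B \<theta>\<close> is left.\<close>
  have bias2: "32 * B\<^sup>2 * exp (- \<tau> / (2 * B)) \<le> 40 * (B * \<theta>)"
  proof -
    have "32 * B\<^sup>2 * exp (- \<tau> / (2 * B)) \<le> 32 * B\<^sup>2 * (5 / 4 * \<theta> / sqrt (real N))"
      using bias invN by (intro mult_left_mono) auto
    also have "\<dots> = 40 * (B * \<theta>) * (B / sqrt (real N))" by (simp add: power2_eq_square)
    also have "\<dots> \<le> 40 * (B * \<theta>) * 1" using BN B0 \<theta>0 by (intro mult_left_mono) auto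
    finally show ?thesis by simp
  qed
  have bias1: "4 * B * exp (- \<tau> / (2 * B)) \<le> 5 * (B * \<theta>)"
  proof -
    have "4 * B * exp (- \<tau> / (2 * B)) \<le> 4 * B * (5 / 4 * \<theta> / sqrt (real N))"
      using bias invN B0 by (intro mult_left_mono) auto
    also have "\<dots> = 5 * (B * \<theta>) / sqrt (real N)" by simp
    also have "\<dots> \<le> 5 * (B * \<theta>) / 1" using sN B0 \<theta>0 by (intro divide_left_mono) auto
    finally show ?thesis by simp
  qed
  define U1 where "U1 a = {z \<in> space ?P. \<tau> < \<bar>X (fst a) (z (snd a))\<bar>}" for a
  \<comment> \<open>Bernstein with \<open>\<kappa> = \<theta> / (B b)\<close> and
    \<open>t = 20 l\<close>. As \<open>\<theta>^2 = l / N\<close>, the two parts of the deviation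
    are \<open>N B b \<theta>\<close> and \<open>20 N B b \<theta>\<close>, together the 21 of the
    conclusion. The condition \<open>\<kappa> \<tau>^2 <= 1\<close> is the source of
    \<open>169 = 13^2\<close> and of the smallness of \<open>\<rho>\<close>.\<close>
  define U2 where "U2 a = {z \<in> space ?P. real N * (\<theta> / (B * b)) * (B\<^sup>2 * b\<^sup>2) + (20 * l) / (\<theta> / (B * b))
      \<le> \<bar>(\<Sum>i<N. trunc \<tau> (X (fst a) (z i)) * trunc \<tau> (X (snd a) (z i)))
        - (\<Sum>i<N. \<integral>x. trunc \<tau> (X (fst a) x) * trunc \<tau> (X (snd a) x) \<partial>\<mu> i)\<bar>}" for a
  \<comment> \<open>The same with \<open>\<kappa> = \<theta> / B\<close> and second moments
    \<open>4 B^2\<close>: 4 + 20 = 24, and the truncation bias adds 5, which makes 29.\<close>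
  define U3 where "U3 v = {z \<in> space ?P. real N * (\<theta> / B) * (4 * B\<^sup>2) + (20 * l) / (\<theta> / B)
      \<le> \<bar>(\<Sum>i<N. trunc \<tau> (X v (z i))) - (\<Sum>i<N. \<integral>x. trunc \<tau> (X v x) \<partial>\<mu> i)\<bar>}" for v
  have U1: "U1 a \<in> sets ?P \<and> measure ?P (U1 a) \<le> 2 * exp (- (13 * l))" if a: "a \<in> V \<times> {..<N}" for a
  proof -
    obtain v i where vi: "a = (v, i)" "v \<in> V" "i < N" using a by auto
    note [measurable] = X[OF vi(2,3)]
    have "{x \<in> space (\<mu> i). \<tau> < \<bar>X v x\<bar>} \<in> sets (\<mu> i)" by measurable
    moreover have "U1 a = (\<lambda>z. z i) -` {x \<in> space (\<mu> i). \<tau> < \<bar>X v x\<bar>} \<inter> space ?P"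
    proof -
      have "z i \<in> space (\<mu> i)" if "z \<in> space ?P" for z using vi that by (auto simp: space_PiM PiE_iff)
      then show ?thesis unfolding U1_def vi(1) fst_conv snd_conv by blast
    qed
    moreover have c: "(\<lambda>z. z i) \<in> measurable ?P (\<mu> i)" using vi by (intro measurable_component_singleton) auto
    ultimately have s: "U1 a \<in> sets ?P" and "measure ?P (U1 a) = measure (distr ?P (\<mu> i) (\<lambda>z. z i)) {x \<in> space (\<mu> i). \<tau> < \<bar>X v x\<bar>}"
      by (auto simp: measure_distr measurable_sets)
    moreover have "distr ?P (\<mu> i) (\<lambda>z. z i) = \<mu> i" using vi p by (intro distr_PiM_component) auto
    moreover have "measure (\<mu> i) {x \<in> space (\<mu> i). \<tau> < \<bar>X v x\<bar>} \<le> 2 * exp (- \<tau> / B)"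
      by (rule subexp_moments(4)[OF p[OF vi(3)] X[OF vi(2,3)] B0 e[OF vi(2,3)]])
    moreover have "- \<tau> / B = - (13 * l)" using B0 by (simp add: \<tau>_def)
    ultimately show ?thesis by simp
  qed
  have tb: "\<bar>trunc \<tau> x * trunc \<tau> y\<bar> \<le> \<tau> * \<tau>" for x y
    unfolding abs_mult using trunc_bounds(2)[OF \<tau>0] \<tau>0 by (intro mult_mono) auto
  have U2: "U2 a \<in> sets ?P \<and> measure ?P (U2 a) \<le> 2 * exp (- (20 * l))" if a: "a \<in> V \<times> V" for a
  proof -
    obtain v w where vw: "a = (v, w)" "v \<in> V" "w \<in> V" using a by auto
    note TB = trunc_product_bias[OF p X[OF vw(2)] X[OF vw(3)] B0 e[OF vw(2)] e[OF vw(3)] \<tau>0]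
    have m: "(\<lambda>x. trunc \<tau> (X v x) * trunc \<tau> (X w x)) \<in> borel_measurable (\<mu> i)" if "i < N" for i
      using X[OF vw(2) that] X[OF vw(3) that] by measurable
    have "(\<Sum>i<N. \<integral>x. (trunc \<tau> (X v x) * trunc \<tau> (X w x))\<^sup>2 \<partial>\<mu> i) \<le> (\<Sum>i<N. ((\<integral>x. X v x ^ 4 \<partial>\<mu> i) + (\<integral>x. X w x ^ 4 \<partial>\<mu> i)) / 2)"
      by (intro sum_mono TB(4)) auto
    also have "\<dots> = ((\<Sum>i<N. \<integral>x. X v x ^ 4 \<partial>\<mu> i) + (\<Sum>i<N. \<integral>x. X w x ^ 4 \<partial>\<mu> i)) / 2"
      by (simp add: sum.distrib sum_divide_distrib[symmetric])
    also have "\<dots> \<le> real N * (B\<^sup>2 * b\<^sup>2)" using fourth[OF vw(2)] fourth[OF vw(3)] by simp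
    finally have V2: "(\<Sum>i<N. \<integral>x. (trunc \<tau> (X v x) * trunc \<tau> (X w x))\<^sup>2 \<partial>\<mu> i) \<le> real N * (B\<^sup>2 * b\<^sup>2)" .
    have "\<theta> / (B * b) * (\<tau> * \<tau>) = 169 * (B * l\<^sup>2 * \<theta>) / b"
      using B0 b by (simp add: \<tau>_def power2_eq_square field_simps)
    also have "\<dots> \<le> 1" using Bl reg(2) b by (simp add: field_simps)
    finally have lamK: "\<theta> / (B * b) * (\<tau> * \<tau>) \<le> 1" .
    have lam0: "0 < \<theta> / (B * b)" using \<theta>0 B0 b by simp
    show ?thesis unfolding U2_def vw(1) fst_conv snd_conv
      by (intro conjI bernstein_PiM_two_sided[where f="\<lambda>i x. trunc \<tau> (X v x) * trunc \<tau> (X w x)" and K="\<tau> * \<tau>"])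
         (rule p m tb V2 lam0 lamK | assumption)+
  qed
  have U3: "U3 v \<in> sets ?P \<and> measure ?P (U3 v) \<le> 2 * exp (- (20 * l))" if v: "v \<in> V" for v
  proof -
    note TB = trunc_product_bias[OF p X[OF v] X[OF v] B0 e[OF v] e[OF v] \<tau>0]
    have m: "(\<lambda>x. trunc \<tau> (X v x)) \<in> borel_measurable (\<mu> i)" if "i < N" for i
      using X[OF v that] by measurable
    have "(\<Sum>i<N. \<integral>x. (trunc \<tau> (X v x))\<^sup>2 \<partial>\<mu> i) \<le> (\<Sum>i<N. 4 * B\<^sup>2)" by (intro sum_mono TB(7)) auto
    then have V3: "(\<Sum>i<N. \<integral>x. (trunc \<tau> (X v x))\<^sup>2 \<partial>\<mu> i) \<le> real N * (4 * B\<^sup>2)" by simp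
    have "\<theta> / B * \<tau> = 13 * (l * \<theta>)" using B0 by (simp add: \<tau>_def)
    also have "\<dots> \<le> 13 * (3 / 2 * \<rho>)"
    proof -
      have "(2 / 3) * (l * \<theta>) \<le> l * (l * \<theta>)" using l l0 \<theta>0 by (intro mult_right_mono) auto
      also have "\<dots> \<le> B * (l * (l * \<theta>))" using mult_right_mono[OF B, of "l * (l * \<theta>)"] l0 \<theta>0 by simp
      also have "\<dots> \<le> \<rho>" using Bl by (simp add: power2_eq_square mult_ac)
      finally show ?thesis by (simp add: mult.commute)
    qed
    also have "\<dots> \<le> 1" using reg(3) by simp
    finally have lamK: "\<theta> / B * \<tau> \<le> 1" .
    have lam0: "0 < \<theta> / B" using \<theta>0 B0 by simp
    note tb1 = trunc_bounds(2)[OF \<tau>0]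
    show ?thesis unfolding U3_def
      by (intro conjI bernstein_PiM_two_sided[where f="\<lambda>i x. trunc \<tau> (X v x)" and K=\<tau>])
         (rule p m tb1 V3 lam0 lamK | assumption)+
  qed
  define W1 W2 W3 where "W1 = (\<Union>a\<in>V \<times> {..<N}. U1 a)" and "W2 = (\<Union>a\<in>V \<times> V. U2 a)" and "W3 = (\<Union>v\<in>V. U3 v)"
  have Ws: "W1 \<in> sets ?P" "W2 \<in> sets ?P" "W3 \<in> sets ?P"
    unfolding W1_def W2_def W3_def using V U1 U2 U3 by (auto intro!: sets.finite_UN)
  have "real (card (V \<times> {..<N})) \<le> exp (8 * l) * exp l"
    using V l by (simp add: card_cartesian_product mult_mono)
  then have "measure ?P W1 \<le> (exp (8 * l) * exp l) * (2 * exp (- (13 * l)))"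
    unfolding W1_def using V U1 by (intro measure_finite_union_le) auto
  also have "\<dots> = 2 * exp (- (4 * l))" by (simp add: exp_add[symmetric])
  finally have m1: "measure ?P W1 \<le> 2 * exp (- (4 * l))" .
  have "real (card (V \<times> V)) \<le> exp (8 * l) * exp (8 * l)"
    using V by (simp add: card_cartesian_product mult_mono)
  then have "measure ?P W2 \<le> (exp (8 * l) * exp (8 * l)) * (2 * exp (- (20 * l)))"
    unfolding W2_def using V U2 by (intro measure_finite_union_le) auto
  also have "\<dots> = 2 * exp (- (4 * l))" by (simp add: exp_add[symmetric])
  finally have m2: "measure ?P W2 \<le> 2 * exp (- (4 * l))" .
  have "measure ?P W3 \<le> exp (8 * l) * (2 * exp (- (20 * l)))"
    unfolding W3_def using V U3 by (intro measure_finite_union_le) auto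
  also have "\<dots> = 2 * exp (- (12 * l))" by (simp add: exp_add[symmetric])
  also have "\<dots> \<le> 2 * exp (- (4 * l))" using l0 by simp
  finally have m3: "measure ?P W3 \<le> 2 * exp (- (4 * l))" .
  have "measure ?P (W1 \<union> W2 \<union> W3) \<le> 6 * exp (- (4 * l))"
    using m1 m2 m3 measure_Un_le[of W1 ?P W2] measure_Un_le[of "W1 \<union> W2" ?P W3] Ws by auto
  also have "exp (- (4 * l)) = exp (- l) ^ 3 * exp (- l)" by (simp add: exp_of_nat_mult[symmetric] exp_add[symmetric])
  also have "6 * (exp (- l) ^ 3 * exp (- l)) \<le> 6 * ((1 / 2) ^ 3 * (1 / real N))"
  proof -
    have "1 / real N \<le> 1 / 2" using N by (intro divide_left_mono) auto
    then have "exp (- l) \<le> 1 / 2" using expl by linarith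
    then show ?thesis using expl by (intro mult_left_mono mult_mono power_mono) auto
  qed
  also have "\<dots> \<le> 1 / real N"
  proof -
    have "3 / 4 * (1 / real N) \<le> 1 * (1 / real N)" by (rule mult_right_mono) auto
    then show ?thesis by (simp add: power3_eq_cube)
  qed
  finally have mW: "measure ?P (W1 \<union> W2 \<union> W3) \<le> 1 / real N" .
  define E where "E = space ?P - (W1 \<union> W2 \<union> W3)"
  have Es: "E \<in> sets ?P" unfolding E_def using Ws by auto
  have "measure ?P E = 1 - measure ?P (W1 \<union> W2 \<union> W3)" unfolding E_def using Ws by (intro P.prob_compl) auto
  then have mE: "1 - 1 / real N \<le> measure ?P E" using mW by simp
  have main: "\<bar>(1 / real N) * (\<Sum>i<N. X v (z i) * X w (z i)) - (1 / real N) * (\<Sum>i<N. \<integral>x. X v x * X w x \<partial>\<mu> i)\<bar> \<le> (21 * b + 40) * (B * \<theta>)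
      \<and> \<bar>(1 / real N) * (\<Sum>i<N. X v (z i))\<bar> \<le> 29 * (B * \<theta>)" if z: "z \<in> E" and v: "v \<in> V" and w: "w \<in> V" for z v w
  proof -
    have zs: "z \<in> space ?P" and zn: "z \<notin> W1" "z \<notin> W2" "z \<notin> W3" using z by (auto simp: E_def)
    \<comment> \<open>On \<open>E\<close> no truncation takes effect, so the sums in the Bernstein
      events are the original ones.\<close>
    have t: "trunc \<tau> (X u (z i)) = X u (z i)" if "u \<in> V" "i < N" for u i
      using zn(1) zs that unfolding W1_def U1_def by (force simp: trunc_def)
    note TB = trunc_product_bias[OF p X[OF v] X[OF w] B0 e[OF v] e[OF w] \<tau>0]
    have "real N * (\<theta> / (B * b)) * (B\<^sup>2 * b\<^sup>2) + (20 * l) / (\<theta> / (B * b)) = real N * (21 * b * (B * \<theta>))"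
    proof -
      have "(20 * l) / (\<theta> / (B * b)) = 20 * B * b * (real N * (\<theta> * \<theta>)) / \<theta>" unfolding \<theta>2 using N0 by simp
      also have "\<dots> = real N * (20 * b * (B * \<theta>))" using \<theta>0 by simp
      finally show ?thesis using B0 b by (simp add: power2_eq_square algebra_simps)
    qed
    then have "\<bar>(\<Sum>i<N. trunc \<tau> (X v (z i)) * trunc \<tau> (X w (z i))) - (\<Sum>i<N. \<integral>x. trunc \<tau> (X v x) * trunc \<tau> (X w x) \<partial>\<mu> i)\<bar> < real N * (21 * b * (B * \<theta>))"
      using zn(2) zs v w unfolding W2_def U2_def by (force simp: not_le)
    then have d1: "\<bar>(\<Sum>i<N. X v (z i) * X w (z i)) - (\<Sum>i<N. \<integral>x. trunc \<tau> (X v x) * trunc \<tau> (X w x) \<partial>\<mu> i)\<bar> \<le> real N * (21 * b * (B * \<theta>))"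
      using t[OF v] t[OF w] by simp
    have "\<bar>(\<Sum>i<N. \<integral>x. X v x * X w x \<partial>\<mu> i) - (\<Sum>i<N. \<integral>x. trunc \<tau> (X v x) * trunc \<tau> (X w x) \<partial>\<mu> i)\<bar>
       \<le> (\<Sum>i<N. \<bar>(\<integral>x. X v x * X w x \<partial>\<mu> i) - (\<integral>x. trunc \<tau> (X v x) * trunc \<tau> (X w x) \<partial>\<mu> i)\<bar>)"
      unfolding sum_subtractf[symmetric] by (rule sum_abs)
    also have "\<dots> \<le> (\<Sum>i<N. 40 * (B * \<theta>))"
      using TB(3) bias2 by (intro sum_mono) (force intro: order_trans)
    also have "\<dots> = real N * (40 * (B * \<theta>))" by simp
    finally have d2: "\<bar>(\<Sum>i<N. X v (z i) * X w (z i)) - (\<Sum>i<N. \<integral>x. X v x * X w x \<partial>\<mu> i)\<bar> \<le> real N * ((21 * b + 40) * (B * \<theta>))"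
      using d1 by (simp add: distrib_right distrib_left abs_le_iff)
    have "real N * (\<theta> / B) * (4 * B\<^sup>2) + (20 * l) / (\<theta> / B) = real N * (24 * (B * \<theta>))"
    proof -
      have "(20 * l) / (\<theta> / B) = 20 * B * (real N * (\<theta> * \<theta>)) / \<theta>" unfolding \<theta>2 using N0 by simp
      also have "\<dots> = real N * (20 * (B * \<theta>))" using \<theta>0 by simp
      finally show ?thesis using B0 by (simp add: power2_eq_square algebra_simps)
    qed
    then have "\<bar>(\<Sum>i<N. trunc \<tau> (X v (z i))) - (\<Sum>i<N. \<integral>x. trunc \<tau> (X v x) \<partial>\<mu> i)\<bar> < real N * (24 * (B * \<theta>))"
      using zn(3) zs v unfolding W3_def U3_def by (force simp: not_le)
    then have d3: "\<bar>(\<Sum>i<N. X v (z i)) - (\<Sum>i<N. \<integral>x. trunc \<tau> (X v x) \<partial>\<mu> i)\<bar> \<le> real N * (24 * (B * \<theta>))"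
      using t[OF v] by simp
    have "\<bar>\<Sum>i<N. \<integral>x. trunc \<tau> (X v x) \<partial>\<mu> i\<bar> \<le> (\<Sum>i<N. \<bar>\<integral>x. trunc \<tau> (X v x) \<partial>\<mu> i\<bar>)" by (rule sum_abs)
    also have "\<dots> \<le> (\<Sum>i<N. 5 * (B * \<theta>))"
    proof (rule sum_mono)
      fix i assume "i \<in> {..<N}"
      then show "\<bar>\<integral>x. trunc \<tau> (X v x) \<partial>\<mu> i\<bar> \<le> 5 * (B * \<theta>)" using TB(6)[of i] mean[OF v, of i] bias1 by simp
    qed
    also have "\<dots> = real N * (5 * (B * \<theta>))" by simp
    finally have d4: "\<bar>\<Sum>i<N. X v (z i)\<bar> \<le> real N * (29 * (B * \<theta>))"
      using d3 by (simp add: abs_le_iff)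
    show ?thesis
    proof
      have "\<bar>(1 / real N) * (\<Sum>i<N. X v (z i) * X w (z i)) - (1 / real N) * (\<Sum>i<N. \<integral>x. X v x * X w x \<partial>\<mu> i)\<bar>
        = (1 / real N) * \<bar>(\<Sum>i<N. X v (z i) * X w (z i)) - (\<Sum>i<N. \<integral>x. X v x * X w x \<partial>\<mu> i)\<bar>"
        using N0 by (simp only: right_diff_distrib[symmetric] abs_mult) simp
      also have "\<dots> \<le> (1 / real N) * (real N * ((21 * b + 40) * (B * \<theta>)))" using d2 by (intro mult_left_mono) auto
      finally show "\<bar>(1 / real N) * (\<Sum>i<N. X v (z i) * X w (z i)) - (1 / real N) * (\<Sum>i<N. \<integral>x. X v x * X w x \<partial>\<mu> i)\<bar> \<le> (21 * b + 40) * (B * \<theta>)"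
        using N0 by simp
      have "\<bar>(1 / real N) * (\<Sum>i<N. X v (z i))\<bar> = (1 / real N) * \<bar>\<Sum>i<N. X v (z i)\<bar>"
        using N0 by (simp only: abs_mult) simp
      also have "\<dots> \<le> (1 / real N) * (real N * (29 * (B * \<theta>)))" using d4 by (intro mult_left_mono) auto
      finally show "\<bar>(1 / real N) * (\<Sum>i<N. X v (z i))\<bar> \<le> 29 * (B * \<theta>)" using N0 by simp
    qed
  qed
  show ?thesis using Es mE main by blast
qed

section \<open>Comparison on sparsely convex sets\<close>

definition bil :: "nat \<Rightarrow> (nat \<Rightarrow> nat \<Rightarrow> real) \<Rightarrow> (nat \<Rightarrow> real) \<Rightarrow> (nat \<Rightarrow> real) \<Rightarrow> real" where
  "bil p C v w = (\<Sum>j<p. \<Sum>k<p. v j * C j k * w k)"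

lemma bil_self: "bil p C v v = quad_form p C v"
  by (simp add: bil_def quad_form_def)

lemma bil_average:
  "bil p (\<lambda>j k. (1 / real N) * (\<Sum>i<N. D i j k)) v w = (1 / real N) * (\<Sum>i<N. bil p (D i) v w)"
proof -
  define f where "f i j k = 1 / real N * (v j * D i j k * w k)" for i j k
  have "1 / real N * (\<Sum>i<N. bil p (D i) v w) = (\<Sum>i<N. \<Sum>j<p. \<Sum>k<p. f i j k)"
    by (simp add: bil_def sum_distrib_left f_def)
  also have "\<dots> = (\<Sum>j<p. \<Sum>i<N. \<Sum>k<p. f i j k)" by (rule sum.swap)
  also have "\<dots> = (\<Sum>j<p. \<Sum>k<p. \<Sum>i<N. f i j k)" by (rule sum.cong[OF refl], rule sum.swap)
  finally show ?thesis
    by (simp add: bil_def sum_distrib_left sum_distrib_right f_def mult_ac)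
qed

lemma bil_rank_one: "bil p (\<lambda>j k. c j * c k) v w = ip p v c * ip p w c"
  unfolding bil_def ip_def sum_product by (simp add: mult_ac)

lemma bil_integral:
  assumes i: "\<And>j k. j < p \<Longrightarrow> k < p \<Longrightarrow> integrable M (\<lambda>x. x j * x k)"
  shows "bil p (\<lambda>j k. \<integral>x. x j * x k \<partial>M) v w = (\<integral>x. ip p v x * ip p w x \<partial>M)"
proof -
  have i': "integrable M (\<lambda>x. v j * w k * (x j * x k))" if "j < p" "k < p" for j k
    using i[OF that] by (rule integrable_mult_right)
  have "(\<integral>x. ip p v x * ip p w x \<partial>M) = (\<integral>x. (\<Sum>j<p. \<Sum>k<p. v j * w k * (x j * x k)) \<partial>M)"
    unfolding ip_def sum_product by (simp add: mult_ac)
  also have "\<dots> = (\<Sum>j<p. \<integral>x. (\<Sum>k<p. v j * w k * (x j * x k)) \<partial>M)"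
    using i' by (intro Bochner_Integration.integral_sum Bochner_Integration.integrable_sum) auto
  also have "\<dots> = (\<Sum>j<p. \<Sum>k<p. \<integral>x. v j * w k * (x j * x k) \<partial>M)"
    using i' by (intro sum.cong refl Bochner_Integration.integral_sum) auto
  also have "\<dots> = (\<Sum>j<p. \<Sum>k<p. v j * w k * (\<integral>x. x j * x k \<partial>M))" by (simp only: integral_mult_right_zero)
  finally show ?thesis by (simp add: bil_def mult_ac)
qed

text \<open>Chebyshev in every coordinate. A polynomial tail is enough, because a large
  \<open>R\<close> costs only a finer net.\<close>

lemma gaussian_cube_tail:
  assumes g: "gaussian_law p P C" and T: "\<And>j. j < p \<Longrightarrow> C j j \<le> T" and R: "0 < R"
  shows "measure P (space P - cube p R) \<le> real p * T / R\<^sup>2" "cube p R \<in> sets P"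
proof -
  note G = gaussian_lawD[OF g]
  interpret prob_space P by (rule G)
  have xm: "(\<lambda>x. x j) \<in> borel_measurable P" if "j < p" for j by (rule Rp_coordinate_measurable[OF G(2) that])
  define F where "F j = {x \<in> space P. R\<^sup>2 \<le> (x j)\<^sup>2}" for j
  have Fs: "F j \<in> sets P" if "j < p" for j
    unfolding F_def using xm[OF that] by (intro borel_measurable_le borel_measurable_power borel_measurable_const)
  have Fm: "measure P (F j) \<le> T / R\<^sup>2" if j: "j < p" for j
  proof -
    have "measure P (F j) \<le> (\<integral>x. (x j)\<^sup>2 \<partial>P) / R\<^sup>2"
      unfolding F_def using gaussian_law_moments(2)[OF g, of "basis_vec j" 2] R j
      by (intro integral_Markov_inequality_measure[OF _ sets.top]) (auto simp: ip_basis_vec)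
    also have "(\<integral>x. (x j)\<^sup>2 \<partial>P) = C j j"
      using gaussian_law_moments(4)[OF g, of "basis_vec j"] quad_form_basis[OF j, of C 1] j by (simp add: ip_basis_vec)
    also have "C j j / R\<^sup>2 \<le> T / R\<^sup>2" using T[OF j] by (intro divide_right_mono) auto
    finally show ?thesis .
  qed
  have Qs: "{x \<in> space P. \<forall>j\<in>{..<p}. \<bar>x j\<bar> \<le> R} \<in> sets P"
    using xm by (intro sets.sets_Collect_finite_All borel_measurable_le borel_measurable_abs borel_measurable_const) auto
  moreover have "cube p R = {x \<in> space P. \<forall>j\<in>{..<p}. \<bar>x j\<bar> \<le> R}" by (auto simp: cube_def G(3))
  ultimately show cs: "cube p R \<in> sets P" by metis
  have "space P - cube p R \<subseteq> (\<Union>j<p. F j)"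
  proof
    fix x assume x: "x \<in> space P - cube p R"
    then obtain j where j: "j < p" "R < \<bar>x j\<bar>" by (auto simp: cube_def G(3) not_le)
    then have "R\<^sup>2 \<le> \<bar>x j\<bar>\<^sup>2" using R by (intro power_mono) auto
    then show "x \<in> (\<Union>j<p. F j)" using j x by (auto simp: F_def)
  qed
  then have "measure P (space P - cube p R) \<le> measure P (\<Union>j<p. F j)"
    using Fs by (intro finite_measure_mono) auto
  also have "\<dots> \<le> (\<Sum>j<p. measure P (F j))" using Fs by (intro measure_UNION_le) auto
  also have "\<dots> \<le> (\<Sum>j<p. T / R\<^sup>2)" using Fm by (intro sum_mono) auto
  finally show "measure P (space P - cube p R) \<le> real p * T / R\<^sup>2" by simp
qed

text \<open>The outer polytope has its facets at the heights \<open>h a\<close>, the support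
  function of \<open>A\<close> inside the cube; for the inner one they are lowered by
  \<open>2 * \<epsilon>\<close>. A one-sided bound suffices: the hypotheses are symmetric in the two
  laws, so the reverse bound comes from exchanging them.\<close>

theorem sparse_convex_comparison:
  assumes g: "gaussian_law p P C" "gaussian_law p P' C'" and sym: "\<And>j k. C j k = C k j" "\<And>j k. C' j k = C' k j"
    and A: "A \<in> sparse_convex_class p s I" and I: "\<And>J. J \<in> I \<Longrightarrow> J \<subseteq> {..<p} \<and> card J \<le> s"
    and s: "1 \<le> s" and M: "s \<le> M" and R: "0 < R"
    and diag: "\<And>v. v \<in> net p M I \<Longrightarrow> \<sigma>\<^sup>2 \<le> quad_form p C v" "\<And>v. v \<in> net p M I \<Longrightarrow> \<sigma>\<^sup>2 \<le> quad_form p C' v" and sig: "0 < \<sigma>"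
    and cov: "\<And>v w. v \<in> net p M I \<Longrightarrow> w \<in> net p M I \<Longrightarrow> \<bar>bil p C v w - bil p C' v w\<bar> \<le> \<Delta>" "0 \<le> \<Delta>"
    and L: "1 \<le> L" "real (card (net p M I)) \<le> exp (L\<^sup>2 / 2)" and \<beta>: "0 < \<beta>"
    and T: "\<And>j. j < p \<Longrightarrow> C j j \<le> T" "\<And>j. j < p \<Longrightarrow> C' j j \<le> T"
    and \<epsilon>: "\<epsilon> = 4 * (real s)\<^sup>2 * R / real M"
  shows "measure P A \<le> measure P' A + 80 * \<Delta> * \<beta> * L / \<sigma> + 20 * L * (2 * \<epsilon> + 2 * L\<^sup>2 / \<beta>) / \<sigma>
    + 2 * exp (- L\<^sup>2 / 2) + 2 * (real p * T / R\<^sup>2)"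
proof -
  note G = gaussian_lawD[OF g(1)] and G' = gaussian_lawD[OF g(2)]
  interpret P: prob_space P by (rule G)
  interpret P': prob_space P' by (rule G')
  define tt where "tt = real p * T / R\<^sup>2"
  have tail: "measure P (space P - cube p R) \<le> tt" "cube p R \<in> sets P"
    using gaussian_cube_tail[OF g(1) _ R, of T, folded tt_def] T(1) by auto
  have tail': "measure P' (space P' - cube p R) \<le> tt" "cube p R \<in> sets P'"
    using gaussian_cube_tail[OF g(2) _ R, of T, folded tt_def] T(2) by auto
  have \<epsilon>0: "0 < \<epsilon>" using s M R by (simp add: \<epsilon>)
  have As: "A \<in> sets (Rp_meas p)" using A by (auto simp: sparse_convex_class_def)
  have AP: "A \<in> sets P" "A \<in> sets P'" using As G(2) G'(2) by auto
  have tail0: "0 \<le> tt" using tail(1) measure_nonneg[of P "space P - cube p R"] by linarith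
  have split: "measure P A \<le> measure P (A \<inter> cube p R) + tt"
  proof -
    have "measure P A \<le> measure P ((A \<inter> cube p R) \<union> (space P - cube p R))"
      using AP tail(2) sets.sets_into_space[OF AP(1)] by (intro P.finite_measure_mono) auto
    also have "\<dots> \<le> measure P (A \<inter> cube p R) + measure P (space P - cube p R)"
      using AP tail(2) by (intro measure_Un_le) auto
    finally show ?thesis using tail(1) by linarith
  qed
  have err: "0 \<le> 80 * \<Delta> * \<beta> * L / \<sigma>" "0 \<le> 20 * L * (2 * \<epsilon> + 2 * L\<^sup>2 / \<beta>) / \<sigma>" "0 \<le> 2 * exp (- L\<^sup>2 / 2)"
    using cov(2) \<beta> L sig \<epsilon>0 by auto
  show ?thesis unfolding tt_def[symmetric]
  proof (cases "A \<inter> cube p R = {}")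
    case True
    show "measure P A \<le> measure P' A + 80 * \<Delta> * \<beta> * L / \<sigma> + 20 * L * (2 * \<epsilon> + 2 * L\<^sup>2 / \<beta>) / \<sigma>
      + 2 * exp (- L\<^sup>2 / 2) + 2 * tt" using split err tail0 measure_nonneg[of P' A] unfolding True measure_empty by linarith
  next
    case False
    then obtain y0 where y0: "y0 \<in> A \<inter> cube p R" by auto
    let ?V = "net p M I"
    have finV: "finite ?V" by (rule net_finite_card(1)[OF I s])
    define m where "m = card ?V"
    obtain v where v: "bij_betw v {0..<m} ?V" using ex_bij_betw_nat_finite[OF finV] unfolding m_def by blast
    have vV: "v a \<in> ?V" if "a < m" for a using v that by (auto simp: bij_betw_def)
    \<comment> \<open>The supremum is meaningful only for a nonempty bounded set, hence the separate
      case above and \<open>bdd\<close> below.\<close>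
    define h where "h a = Sup ((\<lambda>y. ip p (v a) y) ` (A \<inter> cube p R))" for a
    have bdd: "bdd_above ((\<lambda>y. ip p w y) ` (A \<inter> cube p R))" for w
    proof (rule bdd_aboveI)
      fix x assume "x \<in> (\<lambda>y. ip p w y) ` (A \<inter> cube p R)"
      then obtain y where y: "y \<in> cube p R" "x = ip p w y" by auto
      have "ip p w y \<le> (\<Sum>j<p. \<bar>w j\<bar> * R)" unfolding ip_def
      proof (rule sum_mono)
        fix j assume "j \<in> {..<p}"
        then have "\<bar>y j\<bar> \<le> R" using y(1) by (auto simp: cube_def)
        then have "\<bar>w j\<bar> * \<bar>y j\<bar> \<le> \<bar>w j\<bar> * R" by (intro mult_left_mono) auto
        then show "w j * y j \<le> \<bar>w j\<bar> * R" using abs_ge_self[of "w j * y j"] by (simp add: abs_mult)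
      qed
      then show "x \<le> (\<Sum>j<p. \<bar>w j\<bar> * R)" using y(2) by simp
    qed
    define \<gamma> where "\<gamma> = distr P (Rp_meas m) (lin_map m p v)"
    define \<gamma>' where "\<gamma>' = distr P' (Rp_meas m) (lin_map m p v)"
    have gg: "gaussian_law m \<gamma> (push_cov p v C)" "gaussian_law m \<gamma>' (push_cov p v C')"
      unfolding \<gamma>_def \<gamma>'_def by (rule gaussian_law_lin_map[OF g(1)], rule gaussian_law_lin_map[OF g(2)])
    have lm: "lin_map m p v \<in> measurable P (Rp_meas m)" "lin_map m p v \<in> measurable P' (Rp_meas m)"
      by (rule lin_map_measurable[OF G(2)], rule lin_map_measurable[OF G'(2)])
    have pb: "push_cov p v D a b = bil p D (v a) (v b)" for D a b by (simp add: push_cov_def bil_def)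
    have bsym: "bil p D a b = bil p D b a" if "\<And>j k. D j k = D k j" for D a b
      unfolding bil_def by (subst sum.swap) (simp add: mult_ac that[of _ ])
    have o1: "A \<inter> cube p R \<subseteq> lin_map m p v -` orthant m h \<inter> space P"
    proof
      fix x assume x: "x \<in> A \<inter> cube p R"
      have "ip p (v a) x \<le> h a" for a unfolding h_def using x by (intro cSup_upper bdd) auto
      then show "x \<in> lin_map m p v -` orthant m h \<inter> space P"
        using x G(3) by (auto simp: orthant_def lin_map_def space_Rp_meas cube_def)
    qed
    \<comment> \<open>The supremum need not be attained. Lowering by \<open>2 * \<epsilon>\<close>
      instead of \<open>\<epsilon>\<close> leaves a strict inequality, so that some point of
      \<open>A\<close> in the cube lies beyond \<open>ip p w x + \<epsilon>\<close>.\<close>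
    have o2: "lin_map m p v -` orthant m (\<lambda>a. h a - 2 * \<epsilon>) \<inter> space P' \<subseteq> A \<union> (space P' - cube p R)"
    proof
      fix x assume x: "x \<in> lin_map m p v -` orthant m (\<lambda>a. h a - 2 * \<epsilon>) \<inter> space P'"
      show "x \<in> A \<union> (space P' - cube p R)"
      proof (cases "x \<in> cube p R")
        case True
        have "x \<in> A"
        proof (rule sparse_convex_inner[OF A I s M True y0])
          fix w assume "w \<in> ?V"
          then have "w \<in> v ` {0..<m}" using v by (simp add: bij_betw_def)
          then obtain a where a: "a < m" "w = v a" by auto
          have "ip p w x \<le> h a - 2 * \<epsilon>" using x a by (auto simp: orthant_def lin_map_def)
          then have "ip p w x + \<epsilon> < h a" using \<epsilon>0 by linarith
          then have "\<exists>t\<in>(\<lambda>y. ip p (v a) y) ` (A \<inter> cube p R). ip p w x + \<epsilon> < t"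
            unfolding h_def using False bdd by (subst (asm) less_cSup_iff) auto
          then show "\<exists>y\<in>A \<inter> cube p R. ip p w x + 4 * (real s)\<^sup>2 * R / real M < ip p w y"
            unfolding \<epsilon> a by auto
        qed
        then show ?thesis by simp
      qed (use x in auto)
    qed
    have s1: "measure P (A \<inter> cube p R) \<le> measure \<gamma> (orthant m h)"
      unfolding \<gamma>_def measure_distr[OF lm(1) orthant_sets]
      using o1 measurable_sets[OF lm(1) orthant_sets] by (intro P.finite_measure_mono)
    have s2: "measure \<gamma> (orthant m h) \<le> measure \<gamma>' (orthant m (\<lambda>a. h a - 2 * \<epsilon>)) + 80 * \<Delta> * \<beta> * L / \<sigma>
        + 20 * L * (2 * \<epsilon> + 2 * L\<^sup>2 / \<beta>) / \<sigma> + 2 * exp (- L\<^sup>2 / 2)"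
    proof (rule orthant_comparison[OF gg])
      show "push_cov p v C j k = push_cov p v C k j" for j k unfolding pb by (rule bsym[OF sym(1)])
      show "push_cov p v C' j k = push_cov p v C' k j" for j k unfolding pb by (rule bsym[OF sym(2)])
      show "\<sigma>\<^sup>2 \<le> push_cov p v C j j" if "j < m" for j unfolding pb bil_self by (rule diag(1)[OF vV[OF that]])
      show "\<sigma>\<^sup>2 \<le> push_cov p v C' j j" if "j < m" for j unfolding pb bil_self by (rule diag(2)[OF vV[OF that]])
      show "\<bar>push_cov p v C j k - push_cov p v C' j k\<bar> \<le> \<Delta>" if "j < m" "k < m" for j k
        unfolding pb by (rule cov(1)[OF vV[OF that(1)] vV[OF that(2)]])
    qed (use sig L \<beta> cov(2) \<epsilon>0 m_def in auto)
    have s3: "measure \<gamma>' (orthant m (\<lambda>a. h a - 2 * \<epsilon>)) \<le> measure P' (A \<union> (space P' - cube p R))"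
      unfolding \<gamma>'_def measure_distr[OF lm(2) orthant_sets]
      using o2 AP tail'(2) by (intro P'.finite_measure_mono) auto
    have s4: "measure P' (A \<union> (space P' - cube p R)) \<le> measure P' A + measure P' (space P' - cube p R)"
      using AP tail'(2) by (intro measure_Un_le) auto
    show "measure P A \<le> measure P' A + 80 * \<Delta> * \<beta> * L / \<sigma> + 20 * L * (2 * \<epsilon> + 2 * L\<^sup>2 / \<beta>) / \<sigma>
      + 2 * exp (- L\<^sup>2 / 2) + 2 * tt" using split tail'(1) s1 s2 s3 s4 by linarith
  qed
qed

section \<open>The bootstrap covariance and the choice of parameters\<close>

lemma S_eZ_measurable: "S_eZ p N z \<in> measurable (std_normal_vec N) (Rp_meas p)"
  unfolding S_eZ_def
  using Rp_coordinate_measurable[OF gaussian_lawD(2)[OF std_normal_vec_gaussian]]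
  by (intro restrict_measurable_Rp borel_measurable_times borel_measurable_sum borel_measurable_const) auto

lemma ip_zbar: "ip p v (zbar p N z) = (1 / real N) * (\<Sum>i<N. ip p v (z i))"
  unfolding ip_def zbar_def by (subst sum.swap) (simp add: sum_distrib_left mult_ac)

lemma ip_restrict: "ip p (restrict v {..<p}) x = ip p v x"
  by (simp add: ip_def)

lemma centered_sum_product:
  fixes x y :: "nat \<Rightarrow> real"
  assumes "0 < N"
  shows "(1 / real N) * (\<Sum>i<N. (x i - (1 / real N) * (\<Sum>i<N. x i)) * (y i - (1 / real N) * (\<Sum>i<N. y i)))
    = (1 / real N) * (\<Sum>i<N. x i * y i) - ((1 / real N) * (\<Sum>i<N. x i)) * ((1 / real N) * (\<Sum>i<N. y i))"
proof -
  define a where "a = (1 / real N) * (\<Sum>i<N. x i)"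
  define b where "b = (1 / real N) * (\<Sum>i<N. y i)"
  have sx: "(\<Sum>i<N. x i) = real N * a" and sy: "(\<Sum>i<N. y i) = real N * b"
    using assms by (simp_all add: a_def b_def)
  have "(\<Sum>i<N. (x i - a) * (y i - b)) = (\<Sum>i<N. x i * y i) - (\<Sum>i<N. x i) * b - a * (\<Sum>i<N. y i) + real N * (a * b)"
    by (simp add: left_diff_distrib right_diff_distrib sum_subtractf sum_distrib_left sum_distrib_right algebra_simps sum.distrib)
  also have "\<dots> = (\<Sum>i<N. x i * y i) - real N * (a * b)" unfolding sx sy by simp
  finally have "(1 / real N) * (\<Sum>i<N. (x i - a) * (y i - b)) = (1 / real N) * (\<Sum>i<N. x i * y i) - a * b"
    using assms by (simp add: right_diff_distrib)
  then show ?thesis unfolding a_def b_def .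
qed

text \<open>Centering at the sample mean costs a product of two averages. On the event of the
  concentration theorem each is of order \<open>B \<theta>\<close>, so this is a second-order
  correction.\<close>

lemma bil_bootstrap_covariance:
  assumes "0 < N"
  shows "bil p (\<lambda>j k. (1 / real N) * (\<Sum>i<N. (z i j - zbar p N z j) * (z i k - zbar p N z k))) v w
    = (1 / real N) * (\<Sum>i<N. ip p v (z i) * ip p w (z i))
      - ((1 / real N) * (\<Sum>i<N. ip p v (z i))) * ((1 / real N) * (\<Sum>i<N. ip p w (z i)))"
proof -
  have d: "ip p v (\<lambda>j. z i j - zbar p N z j) = ip p v (z i) - (1 / real N) * (\<Sum>i<N. ip p v (z i))" for v i
    unfolding ip_zbar[symmetric] by (simp add: ip_def right_diff_distrib sum_subtractf)
  show ?thesis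
    unfolding bil_average bil_rank_one[of p "\<lambda>j. z _ j - zbar p N z j"] d
    by (rule centered_sum_product[OF assms])
qed

text \<open>The bound is trivial unless \<open>r = (B^2 l^5 / N) powr (1 / 4)\<close> is small, where \<open>l = s ln (p N)\<close>;
  for small \<open>r\<close> the covariance concentration holds with probability \<open>1 - 1 / N\<close>.\<close>

lemma bootstrap_comparison:
  fixes b1 b2 B r l :: real
  assumes b: "0 < b1" "b1 \<le> b2" and N: "2 \<le> N" and p: "1 \<le> p" and s: "1 \<le> s" and B: "1 \<le> B"
    and I: "\<And>J. J \<in> I \<Longrightarrow> J \<subseteq> {..<p} \<and> card J \<le> s" and I1: "\<And>j. j < p \<Longrightarrow> {j} \<in> I"
    and mu: "\<And>i. i < N \<Longrightarrow> prob_space (\<mu> i)" "\<And>i. i < N \<Longrightarrow> sets (\<mu> i) = sets (Rp_meas p)"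
    and mean: "\<And>i j. i < N \<Longrightarrow> j < p \<Longrightarrow> integrable (\<mu> i) (\<lambda>x. x j) \<and> (\<integral>x. x j \<partial>\<mu> i) = 0"
    and nu: "\<And>i. i < N \<Longrightarrow> centered_gaussian_law p (\<nu> i) (\<lambda>j k. \<integral>x. x j * x k \<partial>\<mu> i)"
    and E: "\<And>v i. v \<in> unit_sphere p \<Longrightarrow> vsupp p v \<in> I \<Longrightarrow> i < N \<Longrightarrow> (\<integral>\<^sup>+x. ennreal (exp (\<bar>ip p v x\<bar> / B)) \<partial>\<mu> i) \<le> 2"
    and M2: "\<And>v. v \<in> unit_sphere p \<Longrightarrow> vsupp p v \<in> I \<Longrightarrow> b1\<^sup>2 \<le> (1 / real N) * (\<Sum>i<N. \<integral>x. (ip p v x)\<^sup>2 \<partial>\<mu> i)"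
    and M4: "\<And>v. v \<in> unit_sphere p \<Longrightarrow> vsupp p v \<in> I \<Longrightarrow> (1 / real N) * (\<Sum>i<N. \<integral>x. (ip p v x) ^ 4 \<partial>\<mu> i) \<le> B\<^sup>2 * b2\<^sup>2"
    and l: "l = real s * ln (real p * real N)" and r0: "0 \<le> r" and r: "r ^ 4 = B\<^sup>2 * l ^ 5 / real N"
  defines "K \<equiv> 21 * b2 + 881"
  assumes small: "40 * r \<le> 1" "169 * r \<le> b2" "5 * K * r \<le> b1\<^sup>2" "5 * K * r \<le> 1"
  shows "\<exists>E\<in>sets (PiM {..<N} \<mu>). 1 - 1 / real N \<le> measure (PiM {..<N} \<mu>) E \<and>
    (\<forall>z\<in>E. \<forall>A\<in>sparse_convex_class p s I.
      \<bar>boot_prob p N z A - measure (PiM {..<N} \<nu>) {y \<in> space (PiM {..<N} \<nu>). S_Y p N y \<in> A}\<bar>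
        \<le> (640 * K / b1 + 6000 / b1 + 40) * r)"
proof -
  have N0: "0 < real N" and p0: "0 < real p" and s0: "0 < real s" and B0: "0 < B" and b2: "0 < b2"
    using N p s B b by auto
  have K0: "0 < K" using b2 by (simp add: K_def)
  have pN: "2 \<le> real p * real N"
    using mult_mono[of 1 "real p" 2 "real N"] N p by simp
  have lnpN: "2 / 3 \<le> ln (real p * real N)"
  proof -
    have "ln 2 \<le> ln (real p * real N)" using pN by (subst ln_le_cancel_iff) auto
    then show ?thesis using ln2_ge_two_thirds by linarith
  qed
  have l23: "2 / 3 \<le> l"
    unfolding l using mult_mono[of 1 "real s" "2/3" "ln (real p * real N)"] s lnpN by simp
  have sl: "real s \<le> 3 / 2 * l"
    unfolding l using mult_left_mono[OF lnpN, of "real s"] by simp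
  have l0: "0 < l" using l23 by simp
  have expl: "exp l = (real p * real N) ^ s"
    unfolding l using pN by (subst exp_of_nat_mult) simp
  have Nexpl: "real N \<le> exp l"
  proof -
    have "real N \<le> real p * real N" using p N0 by simp
    also have "\<dots> \<le> (real p * real N) ^ s" using pN s by (intro self_le_power) auto
    finally show ?thesis by (simp add: expl)
  qed
  \<comment> \<open>With \<open>y = sqrt l\<close> and \<open>n = sqrt N\<close> the quantities
    become monomials: \<open>r^2 = B y^5 / n\<close>, \<open>\<theta> = y / n\<close>,
    \<open>B \<theta> = r^2 / l^2\<close>. In this form the error terms are compared with
    \<open>r\<close>.\<close>
  define y where "y = sqrt l"
  have y0: "0 < y" and ly: "l = y\<^sup>2" using l0 by (simp_all add: y_def)
  define n where "n = sqrt (real N)"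
  have n0: "0 < n" and Nn: "real N = n\<^sup>2" using N0 by (simp_all add: n_def)
  have n1: "1 \<le> n" unfolding n_def using N by simp
  have y45: "4 / 5 \<le> y"
  proof -
    have "sqrt ((4/5)\<^sup>2) \<le> sqrt l" using l23 by (intro real_sqrt_le_mono) (simp add: power2_eq_square)
    then show ?thesis by (simp add: y_def)
  qed
  have r1: "r \<le> 1" using small(1) by simp
  have rr: "r\<^sup>2 \<le> r" using mult_left_mono[OF r1 r0] by (simp add: power2_eq_square)
  have r2: "r\<^sup>2 = B * y ^ 5 / n"
  proof -
    have "(r\<^sup>2)\<^sup>2 = (B * y ^ 5 / n)\<^sup>2"
      using r by (simp add: ly Nn power_mult_distrib power_divide flip: power_mult)
    then show ?thesis using B0 y0 n0 by (subst (asm) power2_eq_iff_nonneg) auto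
  qed
  have Bl: "B * l\<^sup>2 * sqrt l = r\<^sup>2 * n"
    unfolding r2 y_def[symmetric] using n0 by (simp add: ly power2_eq_square eval_nat_numeral)
  define \<theta> where "\<theta> = sqrt l / sqrt (real N)"
  have \<theta>: "\<theta> = y / n" by (simp add: \<theta>_def y_def n_def)
  have B\<theta>: "B * \<theta> = r\<^sup>2 / l\<^sup>2"
    unfolding r2 \<theta> using y0 n0 by (simp add: ly field_simps eval_nat_numeral)
  have B\<theta>r: "B * \<theta> \<le> 9 / 4 * r"
  proof -
    have "4 / 9 \<le> l\<^sup>2" using power_mono[OF l23, of 2] by (simp add: power2_eq_square)
    then have "r\<^sup>2 / l\<^sup>2 \<le> r\<^sup>2 / (4 / 9)" by (intro divide_left_mono) auto
    then show ?thesis unfolding B\<theta> using rr by simp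
  qed
  have B\<theta>1: "B * \<theta> \<le> 1" using B\<theta>r small(1) by simp
  have B\<theta>0: "0 \<le> B * \<theta>" unfolding \<theta> using B0 y0 n0 by simp
  have \<theta>B: "\<theta> \<le> B * \<theta>" using mult_right_mono[OF B, of \<theta>] y0 n0 by (simp add: \<theta>)
  have yN: "y / real N \<le> 9 / 4 * r"
  proof -
    have "y / real N = \<theta> / n" by (simp add: \<theta> Nn power2_eq_square)
    also have "\<dots> \<le> \<theta> / 1" using n1 y0 by (intro divide_left_mono) (auto simp: \<theta>)
    finally have "y / real N \<le> \<theta>" by simp
    then show ?thesis using \<theta>B B\<theta>r by linarith
  qed
  have invN: "1 / real N \<le> 3 * r"
  proof -
    have "4 / 5 / real N \<le> y / real N" using y45 N0 by (intro divide_right_mono) auto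
    then show ?thesis using yN r0 by simp
  qed
  have BN: "B \<le> n"
  proof -
    have "B * (4 / 5) / n \<le> B * y / n" using y45 B0 n0 by (intro divide_right_mono mult_left_mono) auto
    also have "\<dots> = B * \<theta>" by (simp add: \<theta>)
    also have "\<dots> \<le> 4 / 5" using B\<theta>r small(1) by simp
    finally show ?thesis using n0 by (simp add: field_simps)
  qed
  \<comment> \<open>Smallness of \<open>r\<close> bounds \<open>l\<close>, and with it
    \<open>s\<close>, by \<open>n\<close>. This lets the net size below be a power of
    \<open>p * N\<close>, with no \<open>s\<close> in the base.\<close>
  have sN: "real s \<le> real N"
  proof -
    have "l \<le> B * l\<^sup>2 * sqrt l * (3 / 2) * (5 / 4)"
    proof -
      have a: "(2 / 3) * (4 / 5) \<le> l * sqrt l" using l23 y45 by (intro mult_mono) (auto simp: y_def)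
      have "1 * ((2 / 3) * (4 / 5)) \<le> B * (l * sqrt l)" by (rule mult_mono[OF B a]) (use B in auto)
      then have "l * ((2 / 3) * (4 / 5)) \<le> l * (B * (l * sqrt l))" using l0 by (intro mult_left_mono) auto
      then show ?thesis by (simp add: power2_eq_square mult_ac)
    qed
    also have "\<dots> = r\<^sup>2 * n * (15 / 8)" unfolding Bl by simp
    also have "\<dots> \<le> 1 / 40 * n * (15 / 8)" using rr small(1) n0 by (intro mult_right_mono) auto
    finally have "real s \<le> n" using sl n0 by linarith
    also have "\<dots> \<le> n * n" using n1 n0 by simp
    finally show ?thesis by (simp add: Nn power2_eq_square)
  qed
  \<comment> \<open>Together with \<open>R = p * N\<close> this makes the margin
    \<open>4 s^2 R / M\<close> equal to \<open>1 / N\<close>, while \<open>M\<close> remains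
    polynomial in \<open>s\<close>, \<open>p\<close> and \<open>N\<close>.\<close>
  define M where "M = 4 * s\<^sup>2 * p * N\<^sup>2"
  have sM: "s \<le> M"
  proof -
    have "s * 1 \<le> s * (4 * s * p * N\<^sup>2)" using s p N by (intro mult_le_mono) auto
    then show ?thesis by (simp add: M_def power2_eq_square mult_ac)
  qed
  have M0: "0 < M" using sM s by simp
  let ?V = "net p M I"
  have net: "v \<in> unit_sphere p" "vsupp p v \<in> I" if "v \<in> ?V" for v
    using net_unit_sphere[OF M0 _ that] I by blast+
  have finV: "finite ?V" and cV: "card ?V \<le> (p * (2 * M + 1)) ^ s" using net_finite_card[OF I s] by auto
  \<comment> \<open>\<open>p * (2 M + 1)\<close> is at most \<open>12 s^2 p^2 N^2\<close>, and by
    \<open>s <= N\<close> and \<open>12 <= N^4\<close> at most \<open>(p N)^8\<close>; its power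
    \<open>s\<close> is bounded by \<open>exp (8 l)\<close>.\<close>
  have card8: "real (card ?V) \<le> exp (8 * l)"
  proof -
    have "p * (2 * M + 1) \<le> p * (3 * M)" using M0 by (intro mult_le_mono2) simp
    then have "real (p * (2 * M + 1)) \<le> real (p * (3 * M))" by (simp only: of_nat_le_iff)
    also have "\<dots> = real p * (3 * real M)" by simp
    also have "\<dots> = 12 * (real s)\<^sup>2 * (real p)\<^sup>2 * (real N)\<^sup>2" by (simp add: M_def power2_eq_square)
    also have "\<dots> \<le> (real N) ^ 4 * (real N)\<^sup>2 * (real p)\<^sup>2 * (real N)\<^sup>2"
    proof (intro mult_right_mono mult_mono)
      have "(2::real) ^ 4 \<le> real N ^ 4" using N by (intro power_mono) auto
      then show "12 \<le> real N ^ 4" by simp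
      show "(real s)\<^sup>2 \<le> (real N)\<^sup>2" using sN by (intro power_mono) auto
    qed auto
    also have "\<dots> = (real p)\<^sup>2 * real N ^ 8" by (simp add: eval_nat_numeral)
    also have "\<dots> \<le> real p ^ 8 * real N ^ 8" using p by (intro mult_right_mono power_increasing) auto
    finally have "real (p * (2 * M + 1)) \<le> (real p * real N) ^ 8" by (simp add: power_mult_distrib)
    then have "real (p * (2 * M + 1)) ^ s \<le> ((real p * real N) ^ 8) ^ s" by (intro power_mono) auto
    also have "\<dots> = exp l ^ 8" by (simp add: expl flip: power_mult) (simp add: mult.commute)
    also have "\<dots> = exp (8 * l)" by (simp add: exp_of_nat_mult[symmetric])
    finally have "real ((p * (2 * M + 1)) ^ s) \<le> exp (8 * l)" by simp
    then show ?thesis using cV by (meson of_nat_le_iff order_trans)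
  qed
  have ipm: "ip p v \<in> borel_measurable (\<mu> i)" if "i < N" for v i using ip_measurable[OF mu(2)[OF that]] .
  have bj: "restrict (basis_vec j) {..<p} \<in> ?V" if "j < p" for j by (rule basis_vec_net[OF that I1[OF that] M0])
  have ipb: "ip p (restrict (basis_vec j) {..<p}) x = x j" if "j < p" for j x
    unfolding ip_restrict by (rule ip_basis_vec[OF that])
  have xx: "integrable (\<mu> i) (\<lambda>x. x j * x k)" if "i < N" "j < p" "k < p" for i j k
    using trunc_product_bias(1)[OF mu(1)[OF that(1)] ipm[OF that(1)] ipm[OF that(1)] B0 E[OF net[OF bj[OF that(2)]] that(1)] E[OF net[OF bj[OF that(3)]] that(1)], of 0]
    by (simp add: ipb that)
  have bint: "bil p (\<lambda>j k. \<integral>x. x j * x k \<partial>\<mu> i) v w = (\<integral>x. ip p v x * ip p w x \<partial>\<mu> i)" if "i < N" for i v w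
    using xx[OF that] by (rule bil_integral)
  have ipmean: "(\<integral>x. ip p v x \<partial>\<mu> i) = 0" if "i < N" for v i
    unfolding ip_def using mean[OF that]
    by (subst Bochner_Integration.integral_sum) auto
  have fourth: "(\<Sum>i<N. \<integral>x. (ip p v x) ^ 4 \<partial>\<mu> i) \<le> real N * (B\<^sup>2 * b2\<^sup>2)" if "v \<in> ?V" for v
    using M4[OF net[OF that]] N0 by (simp add: field_simps)
  have "\<exists>E\<in>sets (PiM {..<N} \<mu>). 1 - 1 / real N \<le> measure (PiM {..<N} \<mu>) E \<and>
    (\<forall>z\<in>E. \<forall>v\<in>?V. \<forall>w\<in>?V.
      \<bar>(1 / real N) * (\<Sum>i<N. ip p v (z i) * ip p w (z i)) - (1 / real N) * (\<Sum>i<N. \<integral>x. ip p v x * ip p w x \<partial>\<mu> i)\<bar> \<le> (21 * b2 + 40) * (B * (sqrt l / sqrt (real N)))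
      \<and> \<bar>(1 / real N) * (\<Sum>i<N. ip p v (z i))\<bar> \<le> 29 * (B * (sqrt l / sqrt (real N))))"
  \<comment> \<open>By \<open>Bl\<close> the regularity condition holds with equality for
    \<open>r^2\<close>, and \<open>r^2 <= r\<close> hands on the smallness of
    \<open>r\<close>.\<close>
  proof (rule covariance_concentration[where \<rho>="r\<^sup>2"])
    show "B * l\<^sup>2 * sqrt l \<le> r\<^sup>2 * sqrt (real N)" using Bl by (simp add: n_def)
    show "169 * r\<^sup>2 \<le> b2" "30 * r\<^sup>2 \<le> 1" using rr small(1,2) r0 by linarith+
  qed (use mu ipm E net ipmean fourth finV card8 l23 Nexpl N B b2 in auto)
  then obtain Ev where Ev: "Ev \<in> sets (PiM {..<N} \<mu>)" "1 - 1 / real N \<le> measure (PiM {..<N} \<mu>) Ev"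
    "\<And>z v w. z \<in> Ev \<Longrightarrow> v \<in> ?V \<Longrightarrow> w \<in> ?V \<Longrightarrow>
      \<bar>(1 / real N) * (\<Sum>i<N. ip p v (z i) * ip p w (z i)) - (1 / real N) * (\<Sum>i<N. \<integral>x. ip p v x * ip p w x \<partial>\<mu> i)\<bar> \<le> (21 * b2 + 40) * (B * \<theta>)"
    "\<And>z v. z \<in> Ev \<Longrightarrow> v \<in> ?V \<Longrightarrow> \<bar>(1 / real N) * (\<Sum>i<N. ip p v (z i))\<bar> \<le> 29 * (B * \<theta>)"
    unfolding \<theta>_def by blast
  have nug: "gaussian_law p (\<nu> i) (\<lambda>j k. \<integral>x. x j * x k \<partial>\<mu> i)" if i: "i < N" for i
  proof (rule centered_gaussian_law_imp[OF nu[OF i]])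
    fix v
    have "0 \<le> (\<integral>x. ip p v x * ip p v x \<partial>\<mu> i)" by (intro Bochner_Integration.integral_nonneg) auto
    then show "0 \<le> quad_form p (\<lambda>j k. \<integral>x. x j * x k \<partial>\<mu> i) v" unfolding bil_self[symmetric] bint[OF i] .
  qed
  define C' where "C' j k = (1 / real N) * (\<Sum>i<N. \<integral>x. x j * x k \<partial>\<mu> i)" for j k
  define P' where "P' = distr (PiM {..<N} \<nu>) (Rp_meas p) (S_Y p N)"
  have gP': "gaussian_law p P' C'" unfolding P'_def C'_def[abs_def] by (rule S_Y_gaussian(2)[OF nug])
  have bC': "bil p C' v w = (1 / real N) * (\<Sum>i<N. \<integral>x. ip p v x * ip p w x \<partial>\<mu> i)" for v w
    unfolding C'_def[abs_def] bil_average using bint by simp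
  have C'jj: "C' j j \<le> 4 * B\<^sup>2" if j: "j < p" for j
  proof -
    have "(\<integral>x. x j * x j \<partial>\<mu> i) \<le> 4 * B\<^sup>2" if i: "i < N" for i
      using subexp_moments(3)[OF mu(1)[OF i] ipm[OF i] B0 E[OF net[OF bj[OF j]] i]] by (simp add: ipb[OF j] power2_eq_square)
    then have "(\<Sum>i<N. \<integral>x. x j * x j \<partial>\<mu> i) \<le> (\<Sum>i<N. 4 * B\<^sup>2)" by (intro sum_mono) auto
    then show ?thesis using N0 by (simp add: C'_def field_simps)
  qed
  have main: "\<bar>boot_prob p N z A - measure (PiM {..<N} \<nu>) {y \<in> space (PiM {..<N} \<nu>). S_Y p N y \<in> A}\<bar>
        \<le> (640 * K / b1 + 6000 / b1 + 40) * r" if z: "z \<in> Ev" and A: "A \<in> sparse_convex_class p s I" for z A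
  proof -
    have As: "A \<in> sets (Rp_meas p)" using A by (auto simp: sparse_convex_class_def)
    define C where "C j k = (1 / real N) * (\<Sum>i<N. (z i j - zbar p N z j) * (z i k - zbar p N z k))" for j k
    define P where "P = distr (std_normal_vec N) (Rp_meas p) (S_eZ p N z)"
    have gP: "gaussian_law p P C" unfolding P_def C_def[abs_def] by (rule S_eZ_gaussian)
    have bP: "boot_prob p N z A = measure P A"
      unfolding boot_prob_def P_def measure_distr[OF S_eZ_measurable As] by (simp add: vimage_def Int_def conj_commute)
    have bP': "measure (PiM {..<N} \<nu>) {y \<in> space (PiM {..<N} \<nu>). S_Y p N y \<in> A} = measure P' A"
    proof -
      have m: "S_Y p N \<in> measurable (PiM {..<N} \<nu>) (Rp_meas p)" by (rule S_Y_gaussian(1)[OF nug])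
      show ?thesis unfolding P'_def measure_distr[OF m As] by (simp add: vimage_def Int_def conj_commute)
    qed
    \<comment> \<open>\<open>K\<close> is \<open>21 * b2 + 40\<close> from the products plus
      \<open>841 = 29^2\<close> from the two averages, where one factor \<open>B \<theta>\<close> is
      bounded by 1.\<close>
    define \<Delta> where "\<Delta> = K * (B * \<theta>)"
    have \<Delta>0: "0 \<le> \<Delta>" using K0 B\<theta>0 by (simp add: \<Delta>_def)
    have \<Delta>r: "\<Delta> \<le> 9 / 4 * (K * r)" unfolding \<Delta>_def using mult_left_mono[OF B\<theta>r, of K] K0 by simp
    have cov: "\<bar>bil p C v w - bil p C' v w\<bar> \<le> \<Delta>" if v: "v \<in> ?V" and w: "w \<in> ?V" for v w
    proof -
      let ?a = "\<lambda>v. (1 / real N) * (\<Sum>i<N. ip p v (z i))"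
      have "\<bar>?a v * ?a w\<bar> \<le> (29 * (B * \<theta>)) * (29 * (B * \<theta>))"
        unfolding abs_mult[of "?a v"] using Ev(4)[OF z v] Ev(4)[OF z w] B\<theta>0 by (intro mult_mono) auto
      also have "\<dots> \<le> 841 * (B * \<theta>)" using mult_left_mono[OF B\<theta>1 B\<theta>0] by simp
      finally have "\<bar>?a v * ?a w\<bar> \<le> 841 * (B * \<theta>)" .
      moreover have "bil p C v w = (1 / real N) * (\<Sum>i<N. ip p v (z i) * ip p w (z i)) - ?a v * ?a w"
        unfolding C_def[abs_def] using N by (intro bil_bootstrap_covariance) simp
      moreover have "\<Delta> = (21 * b2 + 40) * (B * \<theta>) + 841 * (B * \<theta>)" by (simp add: \<Delta>_def K_def algebra_simps)
      ultimately show ?thesis using Ev(3)[OF z v w] unfolding bC' by linarith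
    qed
    \<comment> \<open>On the net the variances under \<open>C'\<close> are at least
      \<open>b1^2\<close>. Those of the bootstrap lose at most \<open>\<Delta>\<close>, which is at
      most \<open>9/20 * b1^2\<close>, so \<open>b1 / 2\<close> serves for both laws.\<close>
    define \<sigma> where "\<sigma> = b1 / 2"
    have sig: "0 < \<sigma>" using b by (simp add: \<sigma>_def)
    have \<sigma>2: "\<sigma>\<^sup>2 = b1\<^sup>2 / 4" by (simp add: \<sigma>_def power_divide)
    have diag': "b1\<^sup>2 \<le> quad_form p C' v" if "v \<in> ?V" for v
      using M2[OF net[OF that]] unfolding bil_self[symmetric] bC' by (simp add: power2_eq_square)
    have d': "\<sigma>\<^sup>2 \<le> quad_form p C' v" if "v \<in> ?V" for v
      using diag'[OF that] zero_le_power2[of b1] unfolding \<sigma>2 by linarith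
    have d: "\<sigma>\<^sup>2 \<le> quad_form p C v" if "v \<in> ?V" for v
      using diag'[OF that] cov[OF that that] \<Delta>r small(3) unfolding \<sigma>2 bil_self by linarith
    have T: "C j j \<le> 5 * B\<^sup>2" if j: "j < p" for j
    proof -
      have e: "bil p D (restrict (basis_vec j) {..<p}) (restrict (basis_vec j) {..<p}) = D j j" for D
        using bilinear_basis[OF j j, of D] by (simp add: bil_def)
      have "C j j \<le> C' j j + \<Delta>" using cov[OF bj[OF j] bj[OF j]] unfolding e by linarith
      moreover have "\<Delta> \<le> 1" using \<Delta>r small(4) by linarith
      moreover have "1 \<le> B\<^sup>2" using B by simp
      ultimately show ?thesis using C'jj[OF j] by linarith
    qed
    have T': "C' j j \<le> 5 * B\<^sup>2" if "j < p" for j using C'jj[OF that] zero_le_power2[of B] by linarith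
    \<comment> \<open>By Chebyshev the mass outside the cube is then at most
      \<open>5 B^2 / (p N^2)\<close>, a multiple of \<open>1 / N\<close> in view of
      \<open>B <= n\<close>.\<close>
    define R where "R = real p * real N"
    have R0: "0 < R" using p0 N0 by (simp add: R_def)
    have eps: "1 / real N = 4 * (real s)\<^sup>2 * R / real M"
      using s0 p0 N0 by (simp add: R_def M_def power2_eq_square)
    have sym: "C j k = C k j" "C' j k = C' k j" for j k by (simp_all add: C_def C'_def mult.commute)
    \<comment> \<open>This makes \<open>L^2 / 2\<close> equal to \<open>8 l\<close>, the bound for
      the logarithm of the net size.\<close>
    define L where "L = 4 * y"
    have L2: "L\<^sup>2 / 2 = 8 * l" by (simp add: L_def ly power_mult_distrib)
    have L1: "1 \<le> L" using y45 by (simp add: L_def)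
    have cL: "real (card ?V) \<le> exp (L\<^sup>2 / 2)" unfolding L2 by (rule card8)
    have rpos: "0 < r"
    proof -
      have "0 < r ^ 4" unfolding r using B0 l0 N0 by simp
      then show ?thesis using r0 by (cases "r = 0") auto
    qed
    \<comment> \<open>Balances \<open>\<Delta> * \<beta> * L\<close> against
      \<open>L^3 / \<beta>\<close>: as \<open>\<Delta> = K * r^2 / l^2\<close> and
      \<open>L = 4 y\<close>, both become multiples of \<open>r\<close>.\<close>
    define \<beta> where "\<beta> = y ^ 3 / r"
    have \<beta>0: "0 < \<beta>" using y0 rpos by (simp add: \<beta>_def)
    have e1: "80 * \<Delta> * \<beta> * L / \<sigma> = 640 * K / b1 * r"
      unfolding \<Delta>_def B\<theta> \<beta>_def L_def \<sigma>_def ly using y0 rpos b by (simp add: field_simps eval_nat_numeral)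
    have e2: "20 * L * (2 * (1 / real N) + 2 * L\<^sup>2 / \<beta>) / \<sigma> \<le> 6000 / b1 * r"
    proof -
      have "20 * L * (2 * (1 / real N) + 2 * L\<^sup>2 / \<beta>) / \<sigma> = 160 / b1 * (2 * (y / real N) + 32 * r)"
        unfolding \<beta>_def L_def \<sigma>_def using y0 rpos b N0 by (simp add: field_simps eval_nat_numeral)
      also have "\<dots> \<le> 160 / b1 * (2 * (9 / 4 * r) + 32 * r)"
        using yN b by (intro mult_left_mono add_mono) auto
      also have "\<dots> = 5840 / b1 * r" using b by (simp add: field_simps)
      also have "\<dots> \<le> 6000 / b1 * r" using b r0 by (intro mult_right_mono divide_right_mono) auto
      finally show ?thesis .
    qed
    have e3: "2 * exp (- L\<^sup>2 / 2) \<le> 6 * r"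
    proof -
      have "- L\<^sup>2 / 2 \<le> - l" using L2 l0 by simp
      then have "exp (- L\<^sup>2 / 2) \<le> exp (- l)" by simp
      also have "\<dots> \<le> 1 / real N" using Nexpl N0 by (simp add: exp_minus field_simps)
      finally show ?thesis using invN by linarith
    qed
    have e4: "2 * (real p * (5 * B\<^sup>2) / R\<^sup>2) \<le> 30 * r"
    proof -
      have "B\<^sup>2 \<le> real N" unfolding Nn using BN B0 by (intro power_mono) auto
      moreover have "real N * 1 \<le> real N * real p" using p N0 by (intro mult_left_mono) auto
      ultimately have "B\<^sup>2 \<le> real N * real p" by linarith
      have "2 * (real p * (5 * B\<^sup>2) / R\<^sup>2) = 10 * (B\<^sup>2 / (real N * real p)) * (1 / real N)"
        using p0 N0 by (simp add: R_def power2_eq_square)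
      also have "\<dots> \<le> 10 * 1 * (1 / real N)"
        using \<open>B\<^sup>2 \<le> real N * real p\<close> p0 N0 by (intro mult_right_mono mult_left_mono) auto
      finally show ?thesis using invN by linarith
    qed
    have up: "measure P A \<le> measure P' A + (640 * K / b1 + 6000 / b1 + 40) * r"
    proof -
      have "measure P A \<le> measure P' A + 80 * \<Delta> * \<beta> * L / \<sigma> + 20 * L * (2 * (1 / real N) + 2 * L\<^sup>2 / \<beta>) / \<sigma>
        + 2 * exp (- L\<^sup>2 / 2) + 2 * (real p * (5 * B\<^sup>2) / R\<^sup>2)"
        by (rule sparse_convex_comparison[OF gP gP' sym A I s sM R0 d d' sig cov \<Delta>0 L1 cL \<beta>0 T T' eps])
      then show ?thesis using e1 e2 e3 e4 r0 unfolding distrib_right by linarith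
    qed
    have down: "measure P' A \<le> measure P A + (640 * K / b1 + 6000 / b1 + 40) * r"
    proof -
      have cov': "\<bar>bil p C' v w - bil p C v w\<bar> \<le> \<Delta>" if "v \<in> ?V" "w \<in> ?V" for v w
        using cov[OF that] by (simp add: abs_minus_commute)
      have "measure P' A \<le> measure P A + 80 * \<Delta> * \<beta> * L / \<sigma> + 20 * L * (2 * (1 / real N) + 2 * L\<^sup>2 / \<beta>) / \<sigma>
        + 2 * exp (- L\<^sup>2 / 2) + 2 * (real p * (5 * B\<^sup>2) / R\<^sup>2)"
        by (rule sparse_convex_comparison[OF gP' gP sym(2,1) A I s sM R0 d' d sig cov' \<Delta>0 L1 cL \<beta>0 T' T eps])
      then show ?thesis using e1 e2 e3 e4 r0 unfolding distrib_right by linarith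
    qed
    show ?thesis unfolding bP bP' using up down by (simp add: abs_le_iff)
  qed
  then show ?thesis using Ev(1,2) by blast
qed

lemma powr_quarter_power4: "0 \<le> x \<Longrightarrow> (x powr (1 / 4)) ^ 4 = (x :: real)"
proof -
  assume x: "0 \<le> x"
  have "(x powr (1 / 4)) ^ 4 = (x powr (1 / 4)) powr 4" by (simp add: powr_numeral)
  also have "\<dots> = x powr (1 / 4 * 4)" by (rule powr_powr)
  finally show ?thesis using x by simp
qed

theorem theorem2:
  shows "\<exists>c1::real. c1 > 0 \<and> (\<forall>b1 b2::real. 0 < b1 \<and> b1 \<le> b2 \<longrightarrow>
    (\<exists>c2::real. c2 > 0 \<and>
      (\<forall>(N::nat) (p::nat) (s::nat) (I::nat set set) (B::real)
         (\<mu>::nat \<Rightarrow> (nat \<Rightarrow> real) measure) (\<nu>::nat \<Rightarrow> (nat \<Rightarrow> real) measure).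
        N \<ge> 1 \<and> p \<ge> 1 \<and> s \<ge> 1 \<and> B \<ge> 1 \<and>
        I \<noteq> {} \<and> (\<forall>J\<in>I. J \<subseteq> {..<p} \<and> card J \<le> s) \<and> (\<forall>j<p. {j} \<in> I) \<and>
        (\<forall>i<N. prob_space (\<mu> i) \<and> sets (\<mu> i) = sets (Rp_meas p)) \<and>
        (\<forall>i<N. \<forall>j<p. integrable (\<mu> i) (\<lambda>x. x j) \<and> (\<integral>x. x j \<partial>\<mu> i) = 0) \<and>
        (\<forall>i<N. centered_gaussian_law p (\<nu> i) (\<lambda>j k. \<integral>x. x j * x k \<partial>\<mu> i)) \<and>
        (\<forall>v\<in>unit_sphere p. vsupp p v \<in> I \<longrightarrow>
           (\<forall>i<N. (\<integral>\<^sup>+x. ennreal (exp (\<bar>ip p v x\<bar> / B)) \<partial>\<mu> i) \<le> 2)) \<and>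
        (\<forall>v\<in>unit_sphere p. vsupp p v \<in> I \<longrightarrow>
           (1 / real N) * (\<Sum>i<N. \<integral>x. (ip p v x)^2 \<partial>\<mu> i) \<ge> b1^2 \<and>
           (1 / real N) * (\<Sum>i<N. \<integral>x. (ip p v x)^4 \<partial>\<mu> i) \<le> B^2 * b2^2)
        \<longrightarrow>
        (\<exists>E \<in> sets (PiM {..<N} \<mu>).
           measure (PiM {..<N} \<mu>) E \<ge>
             1 - 1 / real N - 3 * c1 * B * real s powr (3/2) * ln (real p * real N) powr (3/2)
                 / sqrt (real N) \<and>
           (\<forall>z\<in>E. \<forall>A\<in>sparse_convex_class p s I.
              \<bar>boot_prob p N z A
               - measure (PiM {..<N} \<nu>) {y \<in> space (PiM {..<N} \<nu>). S_Y p N y \<in> A}\<bar>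
              \<le> c2 * (B^2 * real s ^ 5 * ln (real p * real N) ^ 5 / real N) powr (1/4))))))"
proof (rule exI[of _ 1], intro conjI allI impI, simp)
  fix b1 b2 :: real assume "0 < b1 \<and> b1 \<le> b2"
  then have b: "0 < b1" "b1 \<le> b2" by auto
  then have b2: "0 < b2" by simp
  define K where "K = 21 * b2 + 881"
  have K0: "0 < K" using b2 by (simp add: K_def)
  \<comment> \<open>The bracket is the constant of \<open>bootstrap_comparison\<close>. Its 40 and
    the remaining summands ensure that \<open>c2 * r < 1\<close> implies the four smallness
    conditions on \<open>r\<close>.\<close>
  define c2 where "c2 = (640 * K / b1 + 6000 / b1 + 40) + 169 / b2 + 5 * K / b1\<^sup>2 + 5 * K"
  have pos: "0 < 640 * K / b1 + 6000 / b1" "0 < 169 / b2" "0 < 5 * K / b1\<^sup>2" "0 < 5 * K" using b b2 K0 by (auto intro: add_pos_pos)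
  have c2: "0 < c2" "40 \<le> c2" "169 / b2 \<le> c2" "5 * K / b1\<^sup>2 \<le> c2" "5 * K \<le> c2" "640 * K / b1 + 6000 / b1 + 40 \<le> c2"
    using pos unfolding c2_def by linarith+
  show "\<exists>c2::real. c2 > 0 \<and>
      (\<forall>(N::nat) (p::nat) (s::nat) (I::nat set set) (B::real)
         (\<mu>::nat \<Rightarrow> (nat \<Rightarrow> real) measure) (\<nu>::nat \<Rightarrow> (nat \<Rightarrow> real) measure).
        N \<ge> 1 \<and> p \<ge> 1 \<and> s \<ge> 1 \<and> B \<ge> 1 \<and>
        I \<noteq> {} \<and> (\<forall>J\<in>I. J \<subseteq> {..<p} \<and> card J \<le> s) \<and> (\<forall>j<p. {j} \<in> I) \<and>
        (\<forall>i<N. prob_space (\<mu> i) \<and> sets (\<mu> i) = sets (Rp_meas p)) \<and>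
        (\<forall>i<N. \<forall>j<p. integrable (\<mu> i) (\<lambda>x. x j) \<and> (\<integral>x. x j \<partial>\<mu> i) = 0) \<and>
        (\<forall>i<N. centered_gaussian_law p (\<nu> i) (\<lambda>j k. \<integral>x. x j * x k \<partial>\<mu> i)) \<and>
        (\<forall>v\<in>unit_sphere p. vsupp p v \<in> I \<longrightarrow>
           (\<forall>i<N. (\<integral>\<^sup>+x. ennreal (exp (\<bar>ip p v x\<bar> / B)) \<partial>\<mu> i) \<le> 2)) \<and>
        (\<forall>v\<in>unit_sphere p. vsupp p v \<in> I \<longrightarrow>
           (1 / real N) * (\<Sum>i<N. \<integral>x. (ip p v x)^2 \<partial>\<mu> i) \<ge> b1^2 \<and>
           (1 / real N) * (\<Sum>i<N. \<integral>x. (ip p v x)^4 \<partial>\<mu> i) \<le> B^2 * b2^2)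
        \<longrightarrow>
        (\<exists>E \<in> sets (PiM {..<N} \<mu>).
           measure (PiM {..<N} \<mu>) E \<ge>
             1 - 1 / real N - 3 * 1 * B * real s powr (3/2) * ln (real p * real N) powr (3/2)
                 / sqrt (real N) \<and>
           (\<forall>z\<in>E. \<forall>A\<in>sparse_convex_class p s I.
              \<bar>boot_prob p N z A
               - measure (PiM {..<N} \<nu>) {y \<in> space (PiM {..<N} \<nu>). S_Y p N y \<in> A}\<bar>
              \<le> c2 * (B^2 * real s ^ 5 * ln (real p * real N) ^ 5 / real N) powr (1/4))))"
  proof (rule exI[of _ c2], intro conjI allI impI, rule c2(1), elim conjE)
    fix N p s :: nat and I :: "nat set set" and B :: real and \<mu> \<nu> :: "nat \<Rightarrow> (nat \<Rightarrow> real) measure"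
    assume N1: "1 \<le> N" and p: "1 \<le> p" and s: "1 \<le> s" and B: "1 \<le> B"
      and I: "\<forall>J\<in>I. J \<subseteq> {..<p} \<and> card J \<le> s" "\<forall>j<p. {j} \<in> I"
      and mu: "\<forall>i<N. prob_space (\<mu> i) \<and> sets (\<mu> i) = sets (Rp_meas p)"
      and mean: "\<forall>i<N. \<forall>j<p. integrable (\<mu> i) (\<lambda>x. x j) \<and> (\<integral>x. x j \<partial>\<mu> i) = 0"
      and nu: "\<forall>i<N. centered_gaussian_law p (\<nu> i) (\<lambda>j k. \<integral>x. x j * x k \<partial>\<mu> i)"
      and E: "\<forall>v\<in>unit_sphere p. vsupp p v \<in> I \<longrightarrow> (\<forall>i<N. (\<integral>\<^sup>+x. ennreal (exp (\<bar>ip p v x\<bar> / B)) \<partial>\<mu> i) \<le> 2)"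
      and M: "\<forall>v\<in>unit_sphere p. vsupp p v \<in> I \<longrightarrow>
           (1 / real N) * (\<Sum>i<N. \<integral>x. (ip p v x)^2 \<partial>\<mu> i) \<ge> b1^2 \<and>
           (1 / real N) * (\<Sum>i<N. \<integral>x. (ip p v x)^4 \<partial>\<mu> i) \<le> B^2 * b2^2"
    define q where "q = 3 * 1 * B * real s powr (3/2) * ln (real p * real N) powr (3/2) / sqrt (real N)"
    define l where "l = real s * ln (real p * real N)"
    define r where "r = (B^2 * real s ^ 5 * ln (real p * real N) ^ 5 / real N) powr (1/4)"
    have q0: "0 \<le> q" using B by (simp add: q_def)
    have r0: "0 \<le> r" by (simp add: r_def)
    show "\<exists>E \<in> sets (PiM {..<N} \<mu>). 1 - 1 / real N - 3 * 1 * B * real s powr (3/2) * ln (real p * real N) powr (3/2) / sqrt (real N)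
         \<le> measure (PiM {..<N} \<mu>) E \<and>
           (\<forall>z\<in>E. \<forall>A\<in>sparse_convex_class p s I.
              \<bar>boot_prob p N z A - measure (PiM {..<N} \<nu>) {y \<in> space (PiM {..<N} \<nu>). S_Y p N y \<in> A}\<bar>
              \<le> c2 * (B^2 * real s ^ 5 * ln (real p * real N) ^ 5 / real N) powr (1/4))"
      unfolding q_def[symmetric] r_def[symmetric]
    proof -
      \<comment> \<open>For \<open>N = 1\<close> the required probability is at most 0 and the empty
        event will do. For \<open>1 <= c2 * r\<close> the bound holds trivially, since two
        probabilities differ by at most 1. In the last case \<open>2 <= N\<close> also provides
        \<open>ln (p N) >= ln 2 >= 2/3\<close>, the source of the numerical constants above.\<close>
      consider "N = 1" | "2 \<le> N" "1 \<le> c2 * r" | "2 \<le> N" "c2 * r < 1" using N1 by linarith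
      then show "\<exists>E \<in> sets (PiM {..<N} \<mu>). 1 - 1 / real N - q \<le> measure (PiM {..<N} \<mu>) E \<and>
           (\<forall>z\<in>E. \<forall>A\<in>sparse_convex_class p s I.
              \<bar>boot_prob p N z A - measure (PiM {..<N} \<nu>) {y \<in> space (PiM {..<N} \<nu>). S_Y p N y \<in> A}\<bar> \<le> c2 * r)"
      proof cases
        case 1
        then show ?thesis using q0 by (intro bexI[of _ "{}"]) auto
      next
        case 2
        interpret P: prob_space "PiM {..<N} \<mu>" using mu by (intro prob_space_PiM_lessThan) auto
        interpret Q: prob_space "PiM {..<N} \<nu>"
          using nu by (intro prob_space_PiM_lessThan) (auto simp: centered_gaussian_law_def)
        interpret S: prob_space "std_normal_vec N" by (rule gaussian_lawD(1)[OF std_normal_vec_gaussian])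
        have "\<bar>boot_prob p N z A - measure (PiM {..<N} \<nu>) {y \<in> space (PiM {..<N} \<nu>). S_Y p N y \<in> A}\<bar> \<le> 1" for z A
        proof -
          have "0 \<le> boot_prob p N z A" "boot_prob p N z A \<le> 1"
            unfolding boot_prob_def by (rule measure_nonneg, rule S.prob_le_1)
          moreover have "0 \<le> measure (PiM {..<N} \<nu>) {y \<in> space (PiM {..<N} \<nu>). S_Y p N y \<in> A}"
            "measure (PiM {..<N} \<nu>) {y \<in> space (PiM {..<N} \<nu>). S_Y p N y \<in> A} \<le> 1"
            by (rule measure_nonneg, rule Q.prob_le_1)
          ultimately show ?thesis by linarith
        qed
        then have "\<bar>boot_prob p N z A - measure (PiM {..<N} \<nu>) {y \<in> space (PiM {..<N} \<nu>). S_Y p N y \<in> A}\<bar> \<le> c2 * r" for z A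
          using 2(2) order_trans by blast
        moreover have "1 - 1 / real N - q \<le> measure (PiM {..<N} \<mu>) (space (PiM {..<N} \<mu>))"
        proof -
          have "0 \<le> 1 / real N" by simp
          then show ?thesis using q0 unfolding P.prob_space by linarith
        qed
        ultimately show ?thesis by (intro bexI[OF _ sets.top]) blast
      next
        case 3
        have r4: "r ^ 4 = B\<^sup>2 * l ^ 5 / real N"
        proof -
          have pN: "1 \<le> real p * real N" using mult_mono[of 1 "real p" 1 "real N"] p N1 by simp
          have nn: "0 \<le> B\<^sup>2 * l ^ 5 / real N" unfolding l_def using pN by simp
          have "r = (B\<^sup>2 * l ^ 5 / real N) powr (1 / 4)" by (simp add: r_def l_def power_mult_distrib mult.assoc)
          then show ?thesis using powr_quarter_power4[OF nn] by simp
        qed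
        have sm: "c * r \<le> 1" if "c \<le> c2" for c using mult_right_mono[OF that r0] 3(2) by linarith
        have small: "40 * r \<le> 1" "169 * r \<le> b2" "5 * K * r \<le> b1\<^sup>2" "5 * K * r \<le> 1"
          using sm[OF c2(2)] sm[OF c2(3)] sm[OF c2(4)] sm[OF c2(5)] b b2 by (simp_all add: field_simps)
        have "\<exists>E\<in>sets (PiM {..<N} \<mu>). 1 - 1 / real N \<le> measure (PiM {..<N} \<mu>) E \<and>
          (\<forall>z\<in>E. \<forall>A\<in>sparse_convex_class p s I.
            \<bar>boot_prob p N z A - measure (PiM {..<N} \<nu>) {y \<in> space (PiM {..<N} \<nu>). S_Y p N y \<in> A}\<bar>
              \<le> (640 * (21 * b2 + 881) / b1 + 6000 / b1 + 40) * r)"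
          by (rule bootstrap_comparison[where B=B and l=l])
             (use b 3(1) p s B I mu mean nu E M l_def r0 r4 small in \<open>auto simp: K_def\<close>)
        then obtain Ev where Ev: "Ev \<in> sets (PiM {..<N} \<mu>)" "1 - 1 / real N \<le> measure (PiM {..<N} \<mu>) Ev"
          "\<And>z A. z \<in> Ev \<Longrightarrow> A \<in> sparse_convex_class p s I \<Longrightarrow>
            \<bar>boot_prob p N z A - measure (PiM {..<N} \<nu>) {y \<in> space (PiM {..<N} \<nu>). S_Y p N y \<in> A}\<bar> \<le> (640 * K / b1 + 6000 / b1 + 40) * r"
          unfolding K_def by blast
        have "(640 * K / b1 + 6000 / b1 + 40) * r \<le> c2 * r" using c2(6) r0 by (rule mult_right_mono)
        then have "\<bar>boot_prob p N z A - measure (PiM {..<N} \<nu>) {y \<in> space (PiM {..<N} \<nu>). S_Y p N y \<in> A}\<bar> \<le> c2 * r"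
          if "z \<in> Ev" "A \<in> sparse_convex_class p s I" for z A using Ev(3)[OF that] by linarith
        moreover have "1 - 1 / real N - q \<le> measure (PiM {..<N} \<mu>) Ev" using Ev(2) q0 by linarith
        ultimately show ?thesis using Ev(1) by blast
      qed
    qed
  qed
qed

end
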